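(* There are infinitely many primes $p$ for which $G(p^2)=S_{p^2-1}$. In fact, \[ \liminf_{N\to\infty} \frac{\#\{\text{primes } p\le N:\, G(p^2)=S_{p^2-1}\}}{\#\{\text{primes } p\le N\}} \ge \frac{1}{96}. \]
   Context: For a prime power $q$, $\mathbb F_q$ denotes the field with $q$ elements and $\mathbb F_q^*$ its multiplicative group. $G(q)$ denotes the group of permutations of $\mathbb F_q^*$ generated by all permutations of $\mathbb F_q^*$ which can be represented as $c\mapsto ac^m+bc^n$ with $a,b\in\mathbb F_q^*$ and integers $0<m<n<q$ (such a binomial fixes $0$, so if it permutes $\mathbb F_q$ it permutes $\mathbb F_q^*$). $S_{q-1}$ is identified with the group of all permutations of $\mathbb F_q^*$. *)

theory Defs
  imports "HOL-Algebra.Algebra" "HOL-Library.Extended_Real" "HOL-Library.Liminf_Limsup"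
    "HOL-Computational_Algebra.Primes"
begin

definition units_set :: "('a, 'b) ring_scheme \<Rightarrow> 'a set" where
  "units_set R = carrier R - {\<zero>\<^bsub>R\<^esub>}"

definition binom_map :: "('a, 'b) ring_scheme \<Rightarrow> 'a \<Rightarrow> 'a \<Rightarrow> nat \<Rightarrow> nat \<Rightarrow> 'a \<Rightarrow> 'a" where
  "binom_map R a b m n = (\<lambda>c. (a \<otimes>\<^bsub>R\<^esub> (c [^]\<^bsub>R\<^esub> m)) \<oplus>\<^bsub>R\<^esub> (b \<otimes>\<^bsub>R\<^esub> (c [^]\<^bsub>R\<^esub> n)))"

definition binom_perms :: "('a, 'b) ring_scheme \<Rightarrow> ('a \<Rightarrow> 'a) set" where
  "binom_perms R = {f. \<exists>a b m n. a \<in> units_set R \<and> b \<in> units_set R \<and>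
       0 < m \<and> m < n \<and> n < card (carrier R) \<and>
       bij_betw (binom_map R a b m n) (units_set R) (units_set R) \<and>
       f = restrict (binom_map R a b m n) (units_set R)}"

definition G_group :: "('a, 'b) ring_scheme \<Rightarrow> ('a \<Rightarrow> 'a) set" where
  "G_group R = generate (BijGroup (units_set R)) (binom_perms R)"

text \<open>G(q) = S_{q-1} for (every model of) the field with q elements; fields are
  taken with carrier a subset of nat, which can host every finite field up to isomorphism.\<close>
definition G_full :: "nat \<Rightarrow> bool" where
  "G_full q \<longleftrightarrow> (\<forall>R :: nat ring. field R \<and> finite (carrier R) \<and> card (carrier R) = q
       \<longrightarrow> G_group R = Bij (units_set R))"

end

theory Submission
  imports Defs "HOL-Number_Theory.Cong" "HOL-Real_Asymp.Real_Asymp" "HOL-Library.Function_Algebras"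
begin

text \<open>
Let \<open>q = p ^ 2\<close> with \<open>p mod 3 = 2\<close>, and let \<open>S\<close> be the squares of the unit group \<open>U\<close>. The additive binomials
\<open>\<alpha> x + \<beta> x ^ p\<close> put all multiplications and the inversion into \<open>G(q)\<close>, and the binomials
\<open>x (a + x ^ ((q - 1) / 2))\<close> then put every half rotation (multiplication by a square \<open>t\<close> on \<open>S\<close>, identity
elsewhere) into \<open>G(q)\<close>. Any two distinct points are moved by some element of \<open>G(q)\<close> to a square and a
nonsquare: for a ratio outside the prime field this follows from linear maps; for a ratio in the prime
field other than \<open>-1\<close> from the binomial \<open>x (a + x ^ (p + 1))\<close>, which acts on norms by
\<open>n \<mapsto> (n + 1) ^ 3 - 1\<close>; for the ratio \<open>-1\<close> from \<open>x (a + x ^ s)\<close> with \<open>s\<close> the odd part of \<open>q - 1\<close>, where \<open>a\<close>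
is chosen such that all \<open>a + \<zeta>\<close> with \<open>\<zeta> ^ ((q - 1) / s) = 1\<close> have the same \<open>s\<close>-th power. Such an \<open>a\<close> exists for
large \<open>p\<close> by Gallai's theorem on monochromatic homothetic copies, provided that \<open>(q - 1) / s\<close> is bounded.

Consider two images of \<open>S\<close> under \<open>G(q)\<close> whose intersection is nonempty and as small as possible. It is
a coset of a subgroup of \<open>U\<close>, and commutators of half rotations permute disjoint points in 3-cycles; together
with the separation property this forces the intersection to be a single point. So \<open>G(q)\<close> contains
3-cycles, and it contains a transposition because inversion is an odd permutation.

The exceptional primes are, up to finitely many, \<open>1\<close> modulo 6 or \<open>\<plusminus>1\<close> modulo 1024. Their number is
bounded in the manner of Chebyshev, by the prime factors of \<open>\<Prod>k<n. M k + a\<close> above \<open>n\<close>; compared with the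
lower bound \<open>ln 2\<close> for \<open>\<pi>(N) ln N / N\<close> this leaves more than a fraction 1/96 of all primes.
\<close>

hide_const (open) Divisibility.prime Ring_Divisibility.mult_of

section \<open>Monochromatic homothetic copies\<close>

text \<open>Additive binomials are linear over the prime field, so they cannot change a ratio lying
  in it; the norm binomial can. But linear maps, inversion, half rotations and the norm binomial
  have odd exponents only and commute with negation, so they permute the pairs of \<open>x\<close>
  and \<open>-x\<close>. Breaking these pairs takes an even exponent, here \<open>s + 1\<close> with
  \<open>s\<close> odd. Among the odd divisors of \<open>q - 1\<close> the odd part gives the fewest
  values \<open>x ^ s\<close>. Their number must be bounded because Gallai's theorem has to give a
  bound independent of \<open>p\<close>, so that the dilation is invertible modulo \<open>p\<close>;
  hence the exclusion of 1 and -1 modulo 1024. The density is a matter of constants. A class modulo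
  \<open>M\<close> has at most about \<open>ln (M * c) / (M - 1)\<close> times
  \<open>N / ln N\<close> primes, where \<open>c ^ n\<close> bounds the part of \<open>n!\<close>
  built from the primes dividing \<open>M\<close>. The class 1 modulo 6 costs at most
  \<open>0.88 * ln 2\<close>, the two classes modulo 1024 together \<open>22 / 1023 * ln 2\<close>;
  the sum stays below \<open>ln 2\<close>, so no equidistribution theorem enters.\<close>

definition axis :: "nat \<Rightarrow> nat \<Rightarrow> nat \<Rightarrow> nat" where
  "axis d i = (\<lambda>j. if j = i then d else 0)"

text \<open>Vectors are total functions, so that pointwise addition applies; the value 0 from
  coordinate \<open>K\<close> on keeps the box finite.\<close>

definition box :: "nat \<Rightarrow> nat \<Rightarrow> (nat \<Rightarrow> nat) set" where
  "box K N = {v. \<forall>i. v i \<le> (if i < K then N else 0)}"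

lemma finite_box: "finite (box K N)"
proof -
  have "v i \<le> N" "i \<notin> {..<K} \<Longrightarrow> v i = 0" if "v \<in> box K N" for v i
    using that spec[of "\<lambda>i. v i \<le> (if i < K then N else 0)" i] by (auto simp: box_def split: if_splits)
  then have "box K N \<subseteq> {v. \<forall>i. (i \<in> {..<K} \<longrightarrow> v i \<in> {..N}) \<and> (i \<notin> {..<K} \<longrightarrow> v i = 0)}"
    by auto
  then show ?thesis
    by (rule finite_subset) (intro finite_set_of_finite_funs, simp_all)
qed

lemma axis_add: "axis (c + d) i = axis c i + axis d i"
  by (auto simp: axis_def)

lemma axis_box: "i < K \<Longrightarrow> d \<le> N \<Longrightarrow> axis d i \<in> box K N"
  by (auto simp: axis_def box_def)

lemma box_add:
  assumes "v \<in> box K M" "w \<in> box K N"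
  shows "v + w \<in> box K (M + N)"
  unfolding box_def
proof (intro CollectI allI)
  fix i
  have "v i \<le> (if i < K then M else 0)" "w i \<le> (if i < K then N else 0)"
    using assms unfolding box_def by blast+
  then show "(v + w) i \<le> (if i < K then M + N else 0)" by (auto split: if_splits)
qed

lemma box_mono:
  assumes "v \<in> box K M" "M \<le> N"
  shows "v \<in> box K N"
  unfolding box_def
proof (intro CollectI allI)
  fix i
  have "v i \<le> (if i < K then M else 0)" using assms(1) unfolding box_def by blast
  then show "v i \<le> (if i < K then N else 0)" using assms(2) by (auto split: if_splits)
qed

text \<open>The points \<open>v + axis d i\<close> with \<open>i < k\<close> form a homothetic copy
  of the first \<open>k\<close> unit vectors. That \<open>N\<close> is chosen before the colouring
  matters later: it bounds the dilation \<open>d\<close> independently of \<open>p\<close>.\<close>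

definition homothety_regular :: "nat \<Rightarrow> nat \<Rightarrow> bool" where
  "homothety_regular K k \<longleftrightarrow> (\<forall>r. \<exists>N. \<forall>\<chi> :: (nat \<Rightarrow> nat) \<Rightarrow> nat. finite (range \<chi>) \<and> card (range \<chi>) \<le> r \<longrightarrow>
     (\<exists>v\<in>box K N. \<exists>d. 1 \<le> d \<and> d \<le> N \<and> (\<forall>i<k. \<chi> (v + axis d i) = \<chi> (v + axis d 0))))"

text \<open>Colouring a point by the pattern of colours seen through a finite window.\<close>
lemma homothety_regular_window:
  assumes "homothety_regular K k" and "finite V"
  shows "\<exists>N. \<forall>\<chi> :: (nat \<Rightarrow> nat) \<Rightarrow> nat. finite (range \<chi>) \<and> card (range \<chi>) \<le> r \<longrightarrow>
     (\<exists>v\<in>box K N. \<exists>d. 1 \<le> d \<and> d \<le> N \<and>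
        (\<forall>i<k. \<forall>w\<in>V. \<chi> (v + axis d i + w) = \<chi> (v + axis d 0 + w)))"
proof -
  obtain N where N: "\<forall>\<chi> :: (nat \<Rightarrow> nat) \<Rightarrow> nat. finite (range \<chi>) \<and> card (range \<chi>) \<le> r ^ card V \<longrightarrow>
     (\<exists>v\<in>box K N. \<exists>d. 1 \<le> d \<and> d \<le> N \<and> (\<forall>i<k. \<chi> (v + axis d i) = \<chi> (v + axis d 0)))"
    using assms(1) unfolding homothety_regular_def by blast
  show ?thesis
  proof (rule exI[of _ N], intro allI impI)
    fix \<chi> :: "(nat \<Rightarrow> nat) \<Rightarrow> nat" assume \<chi>: "finite (range \<chi>) \<and> card (range \<chi>) \<le> r"
    define pat where "pat = (\<lambda>x. restrict (\<lambda>w. \<chi> (x + w)) V)"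
    have sub: "range pat \<subseteq> PiE V (\<lambda>_. range \<chi>)"
      unfolding pat_def by auto
    have fin: "finite (range pat)"
      using sub \<chi> assms(2) by (meson finite_PiE finite_subset)
    have "card (range pat) \<le> card (PiE V (\<lambda>_. range \<chi>))"
      using sub \<chi> assms(2) by (intro card_mono finite_PiE) auto
    also have "\<dots> = card (range \<chi>) ^ card V"
      using assms(2) by (simp add: card_PiE)
    also have "\<dots> \<le> r ^ card V" using \<chi> by (simp add: power_mono)
    finally have card: "card (range pat) \<le> r ^ card V" .
    obtain f :: "((nat \<Rightarrow> nat) \<Rightarrow> nat) \<Rightarrow> nat" where f: "inj_on f (range pat)"
      using finite_imp_inj_to_nat_seg[OF fin] by blast
    have r: "range (\<lambda>x. f (pat x)) = f ` range pat" by auto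
    have "finite (range (\<lambda>x. f (pat x)))" "card (range (\<lambda>x. f (pat x))) \<le> r ^ card V"
      using fin card card_image_le[OF fin, of f] unfolding r by auto
    then obtain v d where vd: "v \<in> box K N" "1 \<le> d" "d \<le> N"
      "\<forall>i<k. f (pat (v + axis d i)) = f (pat (v + axis d 0))"
      using N[rule_format, of "\<lambda>x. f (pat x)"] by blast
    have "\<chi> (v + axis d i + w) = \<chi> (v + axis d 0 + w)" if "i < k" "w \<in> V" for i w
    proof -
      have "pat (v + axis d i) = pat (v + axis d 0)"
        using vd(4) that(1) f by (auto dest: inj_onD)
      from fun_cong[OF this, of w] show ?thesis using that(2) by (simp add: pat_def)
    qed
    then show "\<exists>v\<in>box K N. \<exists>d. 1 \<le> d \<and> d \<le> N \<and>
        (\<forall>i<k. \<forall>w\<in>V. \<chi> (v + axis d i + w) = \<chi> (v + axis d 0 + w))"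
      using vd by blast
  qed
qed

text \<open>Colour focusing: for \<open>s < t\<close> the points \<open>y s\<close> and
  \<open>y t\<close> are the vertices 0 and \<open>k\<close> of one copy whose first
  \<open>k\<close> vertices all have the colour of \<open>y s\<close>. If \<open>y t\<close> has
  that colour too, the copy with \<open>k + 1\<close> vertices is monochromatic.\<close>

definition homothety_chain :: "nat \<Rightarrow> nat \<Rightarrow> nat \<Rightarrow> ((nat \<Rightarrow> nat) \<Rightarrow> nat) \<Rightarrow> nat \<Rightarrow> (nat \<Rightarrow> nat \<Rightarrow> nat) \<Rightarrow> bool" where
  "homothety_chain K k N \<chi> m y \<longleftrightarrow> y m \<in> box K N \<and>
    (\<forall>s t. s < t \<and> t \<le> m \<longrightarrow> (\<exists>b\<in>box K N. \<exists>d. 1 \<le> d \<and> d \<le> N \<and>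
       y s = b + axis d 0 \<and> y t = b + axis d k \<and> (\<forall>i<k. \<chi> (b + axis d i) = \<chi> (y s))))"

text \<open>The window lemma gives translates \<open>x + axis e i\<close>, \<open>i < k\<close>,
  around which the colouring looks the same. The old chain is placed at \<open>x + axis e 0\<close>,
  and the new point is \<open>x + axis e k + y m\<close>. An old copy of size \<open>d\<close>
  ending in \<open>y m\<close> grows to size \<open>e + d\<close>: its vertex \<open>i\<close> moves
  from the window at \<open>axis e 0\<close> to the one at \<open>axis e i\<close>, which does not
  change its colour. The last two points are joined by the copy of size \<open>e\<close> at
  \<open>x + y m\<close>.\<close>

lemma homothety_chain_exists:
  fixes m :: nat
  assumes P: "homothety_regular K k" and k: "0 < k" "k < K"
  shows "\<exists>N. \<forall>\<chi> :: (nat \<Rightarrow> nat) \<Rightarrow> nat. finite (range \<chi>) \<and> card (range \<chi>) \<le> r \<longrightarrow>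
    (\<exists>y. homothety_chain K k N \<chi> m y)"
proof (induction m)
  case 0
  have "(\<lambda>_. 0 :: nat) \<in> box K 0" by (simp add: box_def)
  then show ?case by (intro exI[of _ 0] allI impI exI[of _ "\<lambda>_ _. 0"]) (auto simp: homothety_chain_def)
next
  case (Suc m)
  then obtain N where N: "\<And>\<chi> :: (nat \<Rightarrow> nat) \<Rightarrow> nat. finite (range \<chi>) \<and> card (range \<chi>) \<le> r \<Longrightarrow>
    (\<exists>y. homothety_chain K k N \<chi> m y)" by blast
  \<comment> \<open>Large enough for every vertex \<open>b + axis d i\<close> of the old copies, a
    sum of two vectors from \<open>box K N\<close>.\<close>
  define V where "V = box K (N + N)"
  obtain M where M: "\<And>\<chi> :: (nat \<Rightarrow> nat) \<Rightarrow> nat. finite (range \<chi>) \<and> card (range \<chi>) \<le> r \<Longrightarrow>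
     (\<exists>v\<in>box K M. \<exists>d. 1 \<le> d \<and> d \<le> M \<and>
        (\<forall>i<k. \<forall>w\<in>V. \<chi> (v + axis d i + w) = \<chi> (v + axis d 0 + w)))"
    using homothety_regular_window[OF P finite_box[of K "N + N"], of r, folded V_def] by metis
  show ?case
  proof (rule exI[of _ "M + M + N"], intro allI impI)
    fix \<chi> :: "(nat \<Rightarrow> nat) \<Rightarrow> nat" assume \<chi>: "finite (range \<chi>) \<and> card (range \<chi>) \<le> r"
    obtain x e where x: "x \<in> box K M" "1 \<le> e" "e \<le> M"
      "\<And>i w. i < k \<Longrightarrow> w \<in> V \<Longrightarrow> \<chi> (x + axis e i + w) = \<chi> (x + axis e 0 + w)"
      using M[OF \<chi>] by blast
    have sub: "range (\<lambda>w. \<chi> (x + axis e 0 + w)) \<subseteq> range \<chi>" by auto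
    then have "finite (range (\<lambda>w. \<chi> (x + axis e 0 + w))) \<and> card (range (\<lambda>w. \<chi> (x + axis e 0 + w))) \<le> r"
      using \<chi> by (meson card_mono finite_subset le_trans)
    from N[OF this] obtain y where "homothety_chain K k N (\<lambda>w. \<chi> (x + axis e 0 + w)) m y" by blast
    then have y: "y m \<in> box K N"
      "\<And>s t. s < t \<Longrightarrow> t \<le> m \<Longrightarrow> (\<exists>b\<in>box K N. \<exists>d. 1 \<le> d \<and> d \<le> N \<and>
       y s = b + axis d 0 \<and> y t = b + axis d k \<and>
       (\<forall>i<k. \<chi> (x + axis e 0 + (b + axis d i)) = \<chi> (x + axis e 0 + y s)))"
      unfolding homothety_chain_def by blast+
    define z where "z = (\<lambda>t. if t \<le> m then x + axis e 0 + y t else x + axis e k + y m)"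
    have ymV: "y m \<in> V" unfolding V_def using box_mono[OF y(1)] by auto
    have "z (Suc m) \<in> box K (M + M + N)"
      unfolding z_def using box_add[OF box_add[OF x(1) axis_box[OF k(2) x(3)]] y(1)] by simp
    moreover have "\<exists>b\<in>box K (M + M + N). \<exists>d. 1 \<le> d \<and> d \<le> M + M + N \<and>
       z s = b + axis d 0 \<and> z t = b + axis d k \<and> (\<forall>i<k. \<chi> (b + axis d i) = \<chi> (z s))"
      if st: "s < t" "t \<le> Suc m" for s t
    proof -
      consider "t \<le> m" | "t = Suc m" "s = m" | "t = Suc m" "s < m" using st by linarith
      then show ?thesis
      proof cases
        case 1
        from y(2)[OF st(1) 1] obtain b d where b: "b \<in> box K N" "1 \<le> d" "d \<le> N"
          "y s = b + axis d 0" "y t = b + axis d k"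
          "\<forall>i<k. \<chi> (x + axis e 0 + (b + axis d i)) = \<chi> (x + axis e 0 + y s)" by blast
        have bx: "x + axis e 0 + b \<in> box K (M + M + N)"
          using box_add[OF box_add[OF x(1) axis_box[of 0 K, OF _ x(3)]] b(1)] k by simp
        have zs: "z s = x + axis e 0 + b + axis d 0" "z t = x + axis e 0 + b + axis d k"
          using st 1 b(4,5) unfolding z_def by (simp_all only: add.assoc if_True less_imp_le order.trans)
        have col: "\<chi> (x + axis e 0 + b + axis d i) = \<chi> (z s)" if "i < k" for i
          using b(6) that st 1 unfolding z_def by (simp only: add.assoc if_True less_imp_le order.trans)
        show ?thesis
          by (intro bexI[OF _ bx] exI[of _ d] conjI allI impI; (rule zs col | use b(2,3) in linarith))
      next
        case 2
        have bx: "x + y m \<in> box K (M + M + N)"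
          by (rule box_mono[OF box_add[OF x(1) y(1)]]) simp
        have col: "\<chi> (x + y m + axis e i) = \<chi> (z s)" if "i < k" for i
          using x(4)[OF that ymV] 2 by (simp add: z_def add_ac)
        have zs: "z s = x + y m + axis e 0" "z t = x + y m + axis e k"
          using 2 by (simp_all add: z_def add_ac)
        show ?thesis
          by (intro bexI[OF _ bx] exI[of _ e] conjI allI impI; (rule zs col | use x(2,3) in linarith))
      next
        case 3
        from y(2)[OF 3(2) order_refl] obtain b d where b: "b \<in> box K N" "1 \<le> d" "d \<le> N"
          "y s = b + axis d 0" "y m = b + axis d k"
          "\<forall>i<k. \<chi> (x + axis e 0 + (b + axis d i)) = \<chi> (x + axis e 0 + y s)" by blast
        have bx: "x + b \<in> box K (M + M + N)"
          by (rule box_mono[OF box_add[OF x(1) b(1)]]) simp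
        have z0: "z s = x + axis e 0 + y s" "z t = x + axis e k + y m"
          unfolding z_def using 3 by (simp_all only: less_imp_le if_True not_less_eq_eq[symmetric] if_False order_refl not_True_eq_False)
        have col: "\<chi> (x + b + axis (e + d) i) = \<chi> (z s)" if "i < k" for i
        proof -
          have "b + axis d i \<in> V"
            unfolding V_def using box_add[OF b(1) axis_box[OF _ b(3)]] that k by simp
          have "\<chi> (x + b + axis (e + d) i) = \<chi> (x + axis e i + (b + axis d i))"
            by (simp only: axis_add add_ac)
          also have "\<dots> = \<chi> (x + axis e 0 + y s)"
            by (rule trans[OF x(4)[OF that \<open>b + axis d i \<in> V\<close>] b(6)[rule_format, OF that]])
          also have "\<dots> = \<chi> (z s)" unfolding z0 ..
          finally show ?thesis .
        qed
        have zs: "z s = x + b + axis (e + d) 0" "z t = x + b + axis (e + d) k"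
          unfolding z0 b(4,5) axis_add by (simp_all only: add_ac)
        show ?thesis
          by (intro bexI[OF _ bx] exI[of _ "e + d"] conjI allI impI; (rule zs col | use x(2,3) b(2,3) in linarith))
      qed
    qed
    ultimately show "\<exists>y. homothety_chain K k (M + M + N) \<chi> (Suc m) y"
      unfolding homothety_chain_def by blast
  qed
qed

text \<open>One vertex is added at a time. A chain of \<open>r + 1\<close> points in
  \<open>r\<close> colours has two points of the same colour, and the copy joining them is
  monochromatic including its new vertex \<open>k\<close>.\<close>

lemma homothety_regular: "k \<le> K \<Longrightarrow> homothety_regular K k"
proof (induction k)
  case 0
  then show ?case unfolding homothety_regular_def
    by (intro allI exI[of _ 1] impI bexI[of _ 0]) (auto simp: box_def)
next
  case (Suc k)
  show ?case
  proof (cases "k = 0")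
    case True
    then show ?thesis unfolding homothety_regular_def
      by (intro allI exI[of _ 1] impI bexI[of _ 0]) (auto simp: box_def)
  next
    case False
    show ?thesis unfolding homothety_regular_def
    proof
      fix r :: nat
      obtain N where N: "\<And>\<chi> :: (nat \<Rightarrow> nat) \<Rightarrow> nat. finite (range \<chi>) \<and> card (range \<chi>) \<le> r \<Longrightarrow>
        (\<exists>y. homothety_chain K k N \<chi> r y)"
        using homothety_chain_exists[of K k r r, OF Suc.IH[OF Suc_leD[OF Suc.prems]]] False Suc.prems
        unfolding Suc_le_eq neq0_conv by blast
      show "\<exists>N. \<forall>\<chi> :: (nat \<Rightarrow> nat) \<Rightarrow> nat. finite (range \<chi>) \<and> card (range \<chi>) \<le> r \<longrightarrow>
        (\<exists>v\<in>box K N. \<exists>d. 1 \<le> d \<and> d \<le> N \<and> (\<forall>i<Suc k. \<chi> (v + axis d i) = \<chi> (v + axis d 0)))"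
      proof (rule exI[of _ N], intro allI impI)
        fix \<chi> :: "(nat \<Rightarrow> nat) \<Rightarrow> nat" assume \<chi>: "finite (range \<chi>) \<and> card (range \<chi>) \<le> r"
        from N[OF \<chi>] obtain y where y: "\<And>s t. s < t \<Longrightarrow> t \<le> r \<Longrightarrow>
          (\<exists>b\<in>box K N. \<exists>d. 1 \<le> d \<and> d \<le> N \<and>
           y s = b + axis d 0 \<and> y t = b + axis d k \<and> (\<forall>i<k. \<chi> (b + axis d i) = \<chi> (y s)))"
          unfolding homothety_chain_def by blast
        have "card ((\<lambda>s. \<chi> (y s)) ` {..r}) \<le> card (range \<chi>)"
          using \<chi> by (intro card_mono) auto
        then have "card ((\<lambda>s. \<chi> (y s)) ` {..r}) < card {..r}" using \<chi> by simp
        then have "\<not> inj_on (\<lambda>s. \<chi> (y s)) {..r}" using pigeonhole by blast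
        then obtain s t where st: "s < t" "t \<le> r" "\<chi> (y s) = \<chi> (y t)"
          unfolding inj_on_def by (metis atMost_iff linorder_neqE_nat)
        from y[OF st(1,2)] obtain b d where b: "b \<in> box K N" "1 \<le> d" "d \<le> N"
          "y s = b + axis d 0" "y t = b + axis d k" "\<forall>i<k. \<chi> (b + axis d i) = \<chi> (y s)" by blast
        have "\<forall>i<Suc k. \<chi> (b + axis d i) = \<chi> (b + axis d 0)"
          using b st(3) by (auto simp: less_Suc_eq)
        then show "\<exists>v\<in>box K N. \<exists>d. 1 \<le> d \<and> d \<le> N \<and> (\<forall>i<Suc k. \<chi> (v + axis d i) = \<chi> (v + axis d 0))"
          using b by blast
      qed
    qed
  qed
qed

section \<open>Primes in arithmetic progressions\<close>

text \<open>A weak form of Legendre's formula. The multiples of \<open>p\<close> up to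
  \<open>n\<close> contribute \<open>p ^ k * fact k\<close> with \<open>k = n div p\<close>, and the
  remaining factors are prime to \<open>p\<close>.\<close>

lemma multiplicity_fact_bound:
  fixes p :: nat assumes p: "prime p"
  shows "multiplicity p (fact n :: nat) * (p - 1) \<le> n"
proof (induction n rule: less_induct)
  case (less n)
  show ?case
  proof (cases "n = 0")
    case False
    define k where "k = n div p"
    have p1: "p > 1" using p prime_gt_1_nat by blast
    have kn: "k < n" unfolding k_def using False p1 by simp
    have split: "{1..n} = (\<lambda>j. p * j) ` {1..k} \<union> {i\<in>{1..n}. \<not> p dvd i}"
    proof (intro equalityI subsetI)
      fix i assume "i \<in> {1..n}"
      then show "i \<in> (\<lambda>j. p * j) ` {1..k} \<union> {i\<in>{1..n}. \<not> p dvd i}"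
        using p1 by (cases "p dvd i") (auto simp: k_def elim!: dvdE intro!: imageI simp: less_eq_div_iff_mult_less_eq mult.commute)
    next
      fix i assume "i \<in> (\<lambda>j. p * j) ` {1..k} \<union> {i\<in>{1..n}. \<not> p dvd i}"
      then show "i \<in> {1..n}"
        using p1 by (auto simp: k_def less_eq_div_iff_mult_less_eq mult.commute)
    qed
    have "fact n = \<Prod>{1..n}" by (simp add: fact_prod)
    also have "\<dots> = \<Prod>((\<lambda>j. p * j) ` {1..k}) * \<Prod>{i\<in>{1..n}. \<not> p dvd i}"
      by (subst split, rule prod.union_disjoint) auto
    also have "\<Prod>((\<lambda>j. p * j) ` {1..k}) = p ^ k * fact k"
      using p1 by (subst prod.reindex) (auto simp: inj_on_def prod.distrib fact_prod)
    finally have f: "fact n = p ^ k * fact k * \<Prod>{i\<in>{1..n}. \<not> p dvd i}" .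
    have nd: "\<not> p dvd \<Prod>{i\<in>{1..n}. \<not> p dvd i}"
      using p by (subst prime_dvd_prod_iff) auto
    have "multiplicity p (fact n :: nat) = k + multiplicity p (fact k :: nat)"
      unfolding f using p p1 nd
      by (subst prime_elem_multiplicity_mult_distrib; (subst prime_elem_multiplicity_mult_distrib)?)
        (auto simp: not_dvd_imp_multiplicity_0 intro: Nat.gr0I)
    then have "multiplicity p (fact n :: nat) * (p - 1) = k * (p - 1) + multiplicity p (fact k :: nat) * (p - 1)"
      by (simp add: add_mult_distrib)
    also have "\<dots> \<le> k * (p - 1) + k" using less.IH[OF kn] by simp
    also have "\<dots> = k * p" using p1 by (metis Suc_pred' add.commute less_trans mult_Suc_right zero_less_one)
    also have "\<dots> \<le> n" unfolding k_def by simp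
    finally show ?thesis .
  qed auto
qed

text \<open>The witness is the odd part of \<open>n!\<close>. The constants 2 here and
  \<open>2 * sqrt 3\<close> in the next lemma come from the multiplicities of 2 and 3 in
  \<open>n!\<close>, at most \<open>n\<close> and \<open>n / 2\<close>.\<close>

lemma fact_coprime_part_2power:
  assumes "M = 2 ^ k"
  shows "\<exists>m::nat. coprime m M \<and> m dvd fact n \<and> m > 0 \<and> real (fact n) \<le> real m * 2 ^ n"
proof -
  obtain m where m: "(fact n :: nat) = 2 ^ multiplicity 2 (fact n :: nat) * m" "\<not> 2 dvd m"
    using multiplicity_decompose'[of "fact n :: nat" 2] by auto
  have "real (fact n) = 2 ^ multiplicity 2 (fact n :: nat) * real m"
    by (subst m(1)) simp
  also have "\<dots> \<le> 2 ^ n * real m"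
    using multiplicity_fact_bound[of 2 n] by (intro mult_right_mono power_increasing) auto
  finally have "real (fact n) \<le> real m * 2 ^ n" by (simp add: mult.commute)
  moreover have "coprime m M" using m(2) assms by (auto simp: coprime_commute)
  moreover have "m dvd fact n" by (subst m(1)) simp
  moreover have "m > 0" using m(2) by (auto intro: Nat.gr0I)
  ultimately show ?thesis by blast
qed

lemma fact_coprime_part_6:
  "\<exists>m::nat. coprime m 6 \<and> m dvd fact n \<and> m > 0 \<and> real (fact n) \<le> real m * (2 * sqrt 3) ^ n"
proof -
  define f where "f = multiplicity 3 (fact n :: nat)"
  obtain m' where m': "(fact n :: nat) = 3 ^ f * m'" "\<not> 3 dvd m'"
    unfolding f_def using multiplicity_decompose'[of "fact n :: nat" 3] by auto
  have m'0: "m' \<noteq> 0" using m'(2) by (intro notI) simp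
  define e where "e = multiplicity 2 m'"
  obtain m where m: "m' = 2 ^ e * m" "\<not> 2 dvd m"
    unfolding e_def by (rule multiplicity_decompose'[OF m'0, of 2]) auto
  have "e \<le> multiplicity 2 (fact n :: nat)"
    unfolding e_def by (rule dvd_imp_multiplicity_le) (use m'0 in \<open>auto simp: m'(1)\<close>)
  then have e: "e \<le> n" using multiplicity_fact_bound[of 2 n] by simp
  have f: "2 * f \<le> n" unfolding f_def using multiplicity_fact_bound[of 3 n] by simp
  have "(3::real) ^ f = sqrt 3 ^ (2 * f)" by (simp add: power_mult)
  also have "\<dots> \<le> sqrt 3 ^ n" using f by (intro power_increasing) auto
  finally have 3: "(3::real) ^ f \<le> sqrt 3 ^ n" .
  have 2: "(2::real) ^ e \<le> 2 ^ n" using e by (intro power_increasing) auto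
  have "real (fact n) = (3 ^ f * 2 ^ e) * real m"
    by (subst m'(1), subst m(1)) simp
  also have "\<dots> \<le> (sqrt 3 ^ n * 2 ^ n) * real m"
    using 2 3 by (intro mult_right_mono mult_mono) auto
  finally have "real (fact n) \<le> real m * (2 * sqrt 3) ^ n" by (simp add: power_mult_distrib mult_ac)
  moreover have "coprime m 6"
  proof -
    have "\<not> 3 dvd m" using m'(2) m(1) by auto
    then have "coprime 3 m" by (intro prime_imp_coprime) auto
    moreover have "coprime 2 m" using m(2) by simp
    ultimately have "coprime (2 * 3) m" by (simp only: coprime_mult_left_iff)
    then have "coprime m (2 * 3)" by (simp only: coprime_commute)
    then show ?thesis by simp
  qed
  moreover have "m dvd fact n" by (subst m'(1), subst m(1)) simp
  moreover have "m > 0" using m(2) by (auto intro: Nat.gr0I)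
  ultimately show ?thesis by blast
qed

definition progression_primes :: "nat \<Rightarrow> nat \<Rightarrow> nat \<Rightarrow> nat set" where
  "progression_primes M a N = {p. prime p \<and> p mod M = a \<and> p \<le> N}"

definition progression_theta :: "nat \<Rightarrow> nat \<Rightarrow> nat \<Rightarrow> real" where
  "progression_theta M a N = (\<Sum>p\<in>progression_primes M a N. ln (real p))"

lemma finite_progression_primes [simp]: "finite (progression_primes M a N)"
  unfolding progression_primes_def by (rule finite_subset[of _ "{..N}"]) auto

text \<open>The product of the first \<open>n\<close> terms of the progression is divisible by \<open>m\<close>, because modulo \<open>m\<close>
  it is \<open>M ^ n\<close> times a product of \<open>n\<close> consecutive integers.\<close>
lemma prod_progression_primes_le:
  assumes M: "0 < a" "a < M" and m: "coprime m M" "m dvd fact n" "m > 0"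
    and c: "real (fact n) \<le> real m * c ^ n"
  shows "real (\<Prod>{p. prime p \<and> p mod M = a \<and> n < p \<and> p \<le> M * n}) \<le> (real M * c) ^ n"
proof -
  define Q where "Q = {p. prime p \<and> p mod M = a \<and> n < p \<and> p \<le> M * n}"
  define A where "A = (\<Prod>k<n. M * k + a)"
  have finQ: "finite Q" unfolding Q_def by (rule finite_subset[of _ "{..M * n}"]) auto
  have "Q \<subseteq> (\<lambda>k. M * k + a) ` {..<n}"
  proof
    fix p assume "p \<in> Q"
    then have p: "p mod M = a" "p \<le> M * n" unfolding Q_def by auto
    have eq: "p = M * (p div M) + a" using p(1) by (metis mult_div_mod_eq)
    have "p div M < n"
    proof (rule ccontr)
      assume "\<not> p div M < n"
      then have "M * n \<le> M * (p div M)" by simp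
      then show False using eq p(2) M by linarith
    qed
    then show "p \<in> (\<lambda>k. M * k + a) ` {..<n}" using eq by blast
  qed
  then have "\<Prod>Q dvd \<Prod>((\<lambda>k. M * k + a) ` {..<n})"
    by (intro prod_dvd_prod_subset) auto
  also have "\<Prod>((\<lambda>k. M * k + a) ` {..<n}) = A"
    unfolding A_def using M by (subst prod.reindex) (auto simp: inj_on_def)
  finally have QA: "\<Prod>Q dvd A" .
  have mA: "m dvd A"
  proof -
    have "coprime (int M) (int m)" using m(1) by (simp add: coprime_commute)
    then obtain j' where "[int M * j' = 1] (mod int m)" using cong_solve_coprime_int by blast
    then have "[int M * j' * int a = 1 * int a] (mod int m)" by (rule cong_scalar_right)
    then have j: "[int M * (j' * int a) = int a] (mod int m)" by (simp only: mult.assoc mult_1)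
    define j where "j = j' * int a"
    have "[(\<Prod>k<n. int M * int k + int a) = (\<Prod>k<n. int M * (j + int k))] (mod int m)"
    proof (rule cong_prod)
      fix k
      have "[int M * int k + int a = int M * int k + int M * j] (mod int m)"
        by (rule cong_add[OF cong_refl cong_sym[OF j[folded j_def]]])
      then show "[int M * int k + int a = int M * (j + int k)] (mod int m)"
        by (simp add: distrib_left add.commute)
    qed
    also have "(\<Prod>k<n. int M * (j + int k)) = int M ^ n * pochhammer j n"
      by (simp add: prod.distrib pochhammer_prod lessThan_atLeast0)
    finally have "[int A = int M ^ n * pochhammer j n] (mod int m)"
      by (simp add: A_def)
    moreover have "int m dvd int M ^ n * pochhammer j n"
    proof -
      have "int m dvd int (fact n)" using m(2) by (simp only: int_dvd_int_iff)
      then show ?thesis using fact_dvd_pochhammer[of n j] by (metis dvd_mult dvd_trans of_nat_fact)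
    qed
    ultimately have "int m dvd int A" using cong_dvd_iff by blast
    then show ?thesis by simp
  qed
  \<comment> \<open>Primes above \<open>n\<close> do not divide \<open>n!\<close>, so they are prime
    to \<open>m\<close>. Hence \<open>m\<close> and the product of the primes divide
    \<open>A\<close> jointly, and dividing by \<open>m\<close> removes almost all of the factor
    \<open>n!\<close> from the trivial bound \<open>M ^ n * n!\<close>.\<close>
  have "coprime m (\<Prod>Q)"
  proof (rule prod_coprime_right)
    fix p assume "p \<in> Q"
    then have p: "prime p" "n < p" by (auto simp: Q_def)
    then have "\<not> p dvd fact n" by (simp add: prime_dvd_fact_iff)
    then have "\<not> p dvd m" using m(2) dvd_trans by blast
    then show "coprime m p" using p(1) by (metis coprime_commute prime_imp_coprime)
  qed
  then have "m * \<Prod>Q dvd A" using mA QA by (simp add: divides_mult)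
  moreover have "A > 0" unfolding A_def using M by (intro prod_pos) auto
  ultimately have "m * \<Prod>Q \<le> A" by (auto dest: dvd_imp_le)
  also have "A \<le> (\<Prod>k<n. M * Suc k)" unfolding A_def using M by (intro prod_mono) auto
  also have "\<dots> = M ^ n * fact n"
    by (simp add: prod.distrib fact_prod_Suc lessThan_atLeast0 del: mult_Suc_right)
  finally have "real m * real (\<Prod>Q) \<le> real (M ^ n * fact n)"
    by (metis of_nat_le_iff of_nat_mult)
  also have "\<dots> \<le> real M ^ n * (real m * c ^ n)"
    using c by (simp add: mult_left_mono)
  also have "\<dots> = real m * (real M * c) ^ n" by (simp add: power_mult_distrib)
  finally show ?thesis using m(3) unfolding Q_def by simp
qed

lemma progression_theta_rec:
  assumes M: "0 < a" "a < M" and m: "\<exists>m. coprime m M \<and> m dvd fact n \<and> m > 0 \<and> real (fact n) \<le> real m * c ^ n"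
    and c: "c > 0" and N: "N \<le> M * n"
  shows "progression_theta M a N \<le> progression_theta M a n + real n * ln (real M * c)"
proof -
  define Q where "Q = {p. prime p \<and> p mod M = a \<and> n < p \<and> p \<le> M * n}"
  have finQ: "finite Q" unfolding Q_def by (rule finite_subset[of _ "{..M * n}"]) auto
  have pos: "ln (real p) \<ge> 0" if "prime p" for p :: nat
    using prime_gt_0_nat[OF that] by simp
  have "progression_theta M a N \<le> (\<Sum>p\<in>progression_primes M a n \<union> Q. ln (real p))"
    unfolding progression_theta_def using N finQ
    by (intro sum_mono2) (auto simp: Q_def progression_primes_def pos)
  also have "\<dots> \<le> progression_theta M a n + (\<Sum>p\<in>Q. ln (real p))"
    unfolding progression_theta_def using finQ
    by (subst sum.union_disjoint) (auto simp: Q_def progression_primes_def)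
  also have "(\<Sum>p\<in>Q. ln (real p)) = ln (\<Prod>p\<in>Q. real p)"
    by (rule ln_prod[symmetric, OF finQ]) (auto simp: Q_def prime_gt_0_nat)
  also have "\<dots> = ln (real (\<Prod>Q))" by simp
  also have "\<dots> \<le> ln ((real M * c) ^ n)"
  proof -
    have "\<Prod>Q > 0" unfolding Q_def by (intro prod_pos) (auto simp: prime_gt_0_nat)
    then have "0 < real (\<Prod>Q)" by (simp only: of_nat_0_less_iff)
    moreover have "real (\<Prod>Q) \<le> (real M * c) ^ n"
      using m prod_progression_primes_le[OF M] unfolding Q_def by blast
    ultimately show ?thesis by (rule ln_mono[rotated])
  qed
  also have "\<dots> = real n * ln (real M * c)" using c M by (simp add: ln_realpow)
  finally show ?thesis by simp
qed

text \<open>Iterating with \<open>n\<close> close to \<open>N / M\<close> sums the geometric series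
  \<open>L / M + L / M^2 + ...\<close>, which is \<open>L / (M - 1)\<close>. The summand
  \<open>e\<close> pays for rounding \<open>n\<close> up.\<close>

lemma linear_bound_from_rec:
  fixes f :: "nat \<Rightarrow> real"
  assumes mono: "\<And>m n. m \<le> n \<Longrightarrow> f m \<le> f n" and L: "L \<ge> 0" and M: "M \<ge> 2"
    and rec: "\<And>N n. N \<le> M * n \<Longrightarrow> f N \<le> f n + real n * L" and e: "e > 0"
  shows "\<exists>K. \<forall>N. f N \<le> (L / (real M - 1) + e) * real N + K"
proof -
  define \<alpha> where "\<alpha> = L / (real M - 1)"
  have \<alpha>: "\<alpha> \<ge> 0" "\<alpha> + L = \<alpha> * real M" using L M by (auto simp: \<alpha>_def field_simps)
  \<comment> \<open>Beyond \<open>N0\<close> the rounding loss, \<open>\<alpha> * M + e\<close>, is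
    at most \<open>e * N / 2\<close>. The summand 3 makes \<open>N div M + 1 < N\<close>.\<close>
  define N0 where "N0 = nat \<lceil>2 * \<alpha> * real M / e\<rceil> + 3"
  have "f N \<le> (\<alpha> + e) * real N + \<bar>f N0\<bar>" for N
  proof (induction N rule: less_induct)
    case (less N)
    show ?case
    proof (cases "N \<le> N0")
      case True
      then have "f N \<le> \<bar>f N0\<bar>" using mono[of N N0] by linarith
      moreover have "(\<alpha> + e) * real N \<ge> 0" using \<alpha> e by simp
      ultimately show ?thesis by linarith
    next
      case False
      define n where "n = N div M + 1"
      have "N div M \<le> N div 2" using M by (simp add: div_le_mono2)
      then have n2: "real n \<le> real N / 2 + 1" unfolding n_def by linarith
      have nN: "n < N" using \<open>N div M \<le> N div 2\<close> False unfolding n_def N0_def by linarith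
      have Mn: "real M * real n \<le> real N + real M"
      proof -
        have "M * (N div M) \<le> N" by simp
        then have "M * n \<le> N + M" unfolding n_def by (simp add: distrib_left)
        then show ?thesis by (metis of_nat_add of_nat_le_iff of_nat_mult)
      qed
      have "N \<le> M * n"
      proof -
        have "M * (N div M) + N mod M = N" by (rule mult_div_mod_eq)
        moreover have "N mod M < M" using M by simp
        ultimately show ?thesis unfolding n_def distrib_left by linarith
      qed
      then have "f N \<le> f n + real n * L" by (rule rec)
      also have "\<dots> \<le> (\<alpha> + e) * real n + \<bar>f N0\<bar> + real n * L" using less[OF nN] by simp
      also have "\<dots> = \<alpha> * (real M * real n) + e * real n + \<bar>f N0\<bar>"
      proof -
        have "(\<alpha> + e) * real n + real n * L = (\<alpha> + L) * real n + e * real n" by (simp add: algebra_simps)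
        also have "\<dots> = \<alpha> * (real M * real n) + e * real n" unfolding \<alpha>(2) by simp
        finally show ?thesis by simp
      qed
      also have "\<dots> \<le> \<alpha> * (real N + real M) + e * (real N / 2 + 1) + \<bar>f N0\<bar>"
        using Mn n2 \<alpha> e by (intro add_mono mult_left_mono) auto
      also have "\<dots> \<le> (\<alpha> + e) * real N + \<bar>f N0\<bar>"
      proof -
        have "real N \<ge> 2 * \<alpha> * real M / e + 2" using False unfolding N0_def by linarith
        then have "e * real N \<ge> e * (2 * \<alpha> * real M / e + 2)" using e by simp
        then have "e * real N \<ge> e * (2 * \<alpha> * real M / e) + e * 2" by (simp only: distrib_left)
        moreover have "e * (2 * \<alpha> * real M / e) = 2 * \<alpha> * real M" using e by simp
        ultimately have "e * real N \<ge> 2 * \<alpha> * real M + 2 * e" by linarith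
        then show ?thesis by (simp add: algebra_simps)
      qed
      finally show ?thesis .
    qed
  qed
  then show ?thesis unfolding \<alpha>_def by blast
qed

text \<open>Primes up to \<open>y = N / (ln N)^2\<close> are negligible in number; each of the
  others contributes at least \<open>ln y\<close> to the theta function, and \<open>ln y\<close> is
  asymptotic to \<open>ln N\<close>.\<close>

lemma card_progression_primes_eventually_le:
  assumes M: "0 < a" "a < M" and c: "c \<ge> 1"
    and m: "\<And>n. \<exists>m. coprime m M \<and> m dvd fact n \<and> m > 0 \<and> real (fact n) \<le> real m * c ^ n"
    and e: "e > 0"
  shows "eventually (\<lambda>N. real (card (progression_primes M a N)) * ln (real N)
           \<le> (ln (real M * c) / (real M - 1) + e) * real N) sequentially"
proof -
  define \<alpha> where "\<alpha> = ln (real M * c) / (real M - 1)"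
  define \<theta> where "\<theta> = progression_theta M a"
  have M2: "M \<ge> 2" using M by linarith
  have "1 * 1 \<le> real M * c" using M c by (intro mult_mono) auto
  then have L: "ln (real M * c) \<ge> 0" by simp
  have mono: "\<theta> m \<le> \<theta> n" if "m \<le> n" for m n
    unfolding \<theta>_def progression_theta_def
    by (intro sum_mono2) (use that in \<open>auto simp: progression_primes_def prime_gt_0_nat Suc_le_eq\<close>)
  have rec: "\<theta> N \<le> \<theta> n + real n * ln (real M * c)" if "N \<le> M * n" for N n
    unfolding \<theta>_def by (rule progression_theta_rec[OF M m _ that]) (use c in simp)
  from linear_bound_from_rec[of \<theta>, OF mono L M2 rec, of "e / 2"] e
  obtain K where K: "\<And>N. \<theta> N \<le> (\<alpha> + e / 2) * real N + K" unfolding \<alpha>_def by auto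
  \<comment> \<open>The bound divided by \<open>N\<close>: the first term stems from the primes up
    to \<open>y\<close>, the second from the larger ones. Its limit is
    \<open>\<alpha> + e / 2\<close>, which leaves \<open>e / 2\<close> of room.\<close>
  define g where "g = (\<lambda>x::real. 1 / ln x + ((\<alpha> + e / 2) * x + K) / x * (ln x / (ln x - 2 * ln (ln x))))"
  have bound: "eventually (\<lambda>N. real (card (progression_primes M a N)) * ln (real N) \<le> real N * g (real N)) sequentially"
  proof -
    have "eventually (\<lambda>N. ln (real N) > 1) sequentially" by real_asymp
    moreover have "eventually (\<lambda>N. ln (real N) - 2 * ln (ln (real N)) > 0) sequentially" by real_asymp
    moreover have "eventually (\<lambda>N. N \<ge> 1) sequentially" by (rule eventually_ge_at_top)
    ultimately show ?thesis
    proof eventually_elim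
      case (elim N)
      define y where "y = real N / (ln (real N))\<^sup>2"
      define A where "A = {p\<in>progression_primes M a N. real p \<le> y}"
      define B where "B = {p\<in>progression_primes M a N. real p > y}"
      have y0: "y > 0" unfolding y_def using elim by (intro divide_pos_pos) auto
      have lny: "ln y = ln (real N) - 2 * ln (ln (real N))"
        unfolding y_def using elim by (subst ln_div) (auto simp: ln_realpow)
      have AB: "progression_primes M a N = A \<union> B" by (auto simp: A_def B_def)
      have fin: "finite A" "finite B" by (auto simp: A_def B_def)
      have "A \<subseteq> {1..nat \<lfloor>y\<rfloor>}"
        by (auto simp: A_def progression_primes_def prime_gt_0_nat Suc_le_eq le_nat_floor)
      then have "card A \<le> card {1..nat \<lfloor>y\<rfloor>}" by (intro card_mono) auto
      then have cA: "real (card A) \<le> y" using y0 by simp linarith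
      have "real (card B) * ln y = (\<Sum>p\<in>B. ln y)" by simp
      also have "\<dots> \<le> (\<Sum>p\<in>B. ln (real p))"
        using y0 by (intro sum_mono) (auto simp: B_def)
      also have "\<dots> \<le> \<theta> N"
        unfolding \<theta>_def progression_theta_def
        by (intro sum_mono2) (auto simp: B_def progression_primes_def prime_gt_0_nat Suc_le_eq)
      also have "\<dots> \<le> (\<alpha> + e / 2) * real N + K" by (rule K)
      finally have "real (card B) * ln y \<le> (\<alpha> + e / 2) * real N + K" .
      moreover have "ln y > 0" using elim lny by simp
      ultimately have cB: "real (card B) \<le> ((\<alpha> + e / 2) * real N + K) / ln y"
        by (simp only: pos_le_divide_eq)
      have "card (progression_primes M a N) \<le> card A + card B" unfolding AB by (rule card_Un_le)
      then have "real (card (progression_primes M a N)) \<le> y + ((\<alpha> + e / 2) * real N + K) / ln y"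
        using cA cB by linarith
      then have "real (card (progression_primes M a N)) * ln (real N)
          \<le> (y + ((\<alpha> + e / 2) * real N + K) / ln y) * ln (real N)"
        using elim by (intro mult_right_mono) auto
      also have "\<dots> = real N * g (real N)"
      proof -
        have "y * ln (real N) = real N * (1 / ln (real N))"
          unfolding y_def using elim by (simp add: power2_eq_square)
        moreover have "((\<alpha> + e / 2) * real N + K) / ln y * ln (real N)
            = real N * (((\<alpha> + e / 2) * real N + K) / real N * (ln (real N) / ln y))"
          using elim(3) by simp
        ultimately show ?thesis unfolding g_def lny[symmetric] by (simp only: distrib_left distrib_right)
      qed
      finally show ?case .
    qed
  qed
  have "(g \<longlongrightarrow> \<alpha> + e / 2) at_top" unfolding g_def by real_asymp
  then have "eventually (\<lambda>x. g x < \<alpha> + e) at_top" using e by (intro order_tendstoD) auto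
  then have "eventually (\<lambda>N. g (real N) < \<alpha> + e) sequentially"
    by (rule eventually_compose_filterlim[OF _ filterlim_real_sequentially])
  with bound show ?thesis unfolding \<alpha>_def[symmetric]
  proof eventually_elim
    case (elim N)
    have "real N * g (real N) \<le> real N * (\<alpha> + e)" using elim(2) by (intro mult_left_mono) auto
    with elim(1) show ?case by (simp add: mult.commute)
  qed
qed

section \<open>The lower bound for the number of primes\<close>

text \<open>The entries \<open>1 / (k * (n choose k))\<close> of the Leibniz harmonic triangle are differences of entries
  of the preceding column.\<close>
lemma leibniz_triangle_dvd:
  fixes d :: nat
  assumes "1 \<le> k" "k \<le> n" "\<And>i. 1 \<le> i \<Longrightarrow> i \<le> n \<Longrightarrow> i dvd d"
  shows "k * (n choose k) dvd d"
proof -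
  have "\<exists>z::int. real d / (real k * real (n choose k)) = of_int z"
    using assms
  proof (induction k arbitrary: n rule: dec_induct)
    case base
    then have "n dvd d" by simp
    then obtain z where "d = n * z" ..
    then show ?case using base by (intro exI[of _ "int z"]) auto
  next
    case (step k n)
    have "\<exists>z::int. real d / (real k * real ((n - 1) choose k)) = of_int z"
      using step by (intro step.IH) auto
    moreover have "\<exists>z::int. real d / (real k * real (n choose k)) = of_int z"
      using step by (intro step.IH) auto
    moreover have "1 / (real (Suc k) * real (n choose Suc k)) =
        1 / (real k * real ((n - 1) choose k)) - 1 / (real k * real (n choose k))"
    proof -
      define C where "C = real (n choose k)"
      have C: "C > 0" unfolding C_def using step.prems by simp
      have kn: "real k < real n" "real k > 0" using step.prems step.hyps by auto
      have 1: "real (Suc k) * real (n choose Suc k) = C * (real n - real k)"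
      proof -
        have "Suc k * (n choose Suc k) = (n choose k) * (n - k)"
          using binomial_absorption[of k n] binomial_absorb_comp[of n k] by (simp add: mult.commute)
        then show ?thesis unfolding C_def using step.prems
          by (metis Suc_leD of_nat_diff of_nat_mult)
      qed
      have "(n - k) * (n choose k) = n * ((n - 1) choose k)" using binomial_absorb_comp[of n k] by simp
      then have "(real n - real k) * C = real n * real ((n - 1) choose k)"
        unfolding C_def using step.prems by (metis Suc_leD of_nat_diff of_nat_mult)
      then have 2: "real ((n - 1) choose k) = (real n - real k) * C / real n"
        using kn by (simp add: field_simps)
      show ?thesis unfolding 1 2 C_def[symmetric] using C kn by (simp add: field_simps)
    qed
    from arg_cong[OF this, of "\<lambda>x. real d * x"]
    have "real d / (real (Suc k) * real (n choose Suc k)) =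
        real d / (real k * real ((n - 1) choose k)) - real d / (real k * real (n choose k))"
      by (simp only: right_diff_distrib times_divide_eq_right mult_1_right)
    ultimately show ?case by (metis of_int_diff)
  qed
  then obtain z :: int where z: "real d / (real k * real (n choose k)) = of_int z" by blast
  have "real k * real (n choose k) \<noteq> 0" using assms by simp
  then have "real_of_int (int d) = real_of_int (int (k * (n choose k)) * z)"
    using z by (simp add: field_simps)
  then have "int d = int (k * (n choose k)) * z" by (simp only: of_int_eq_iff)
  then have "int (k * (n choose k)) dvd int d" by simp
  then show ?thesis by (simp only: int_dvd_int_iff)
qed

text \<open>Each prime power in the factorization of the least common multiple divides some number
  up to \<open>N\<close>, hence is at most \<open>N\<close>.\<close>

lemma Lcm_le_power_card_primes:
  "Lcm {1..N} \<le> N ^ card {p::nat. prime p \<and> p \<le> N}"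
proof (cases "N = 0")
  case False
  define P where "P = {p::nat. prime p \<and> p \<le> N}"
  define e where "e = (\<lambda>p. Max (multiplicity p ` {1..N}))"
  have finP: "finite P" unfolding P_def by (rule finite_subset[of _ "{..N}"]) auto
  have "k dvd (\<Prod>p\<in>P. p ^ e p)" if k: "k \<in> {1..N}" for k
  proof -
    have "k = (\<Prod>p\<in>prime_factors k. p ^ multiplicity p k)"
      using k by (simp add: prod_prime_factors)
    also have "\<dots> dvd (\<Prod>p\<in>P. p ^ e p)"
    proof (rule prod_dvd_prod_subset2[OF finP])
      show "prime_factors k \<subseteq> P"
        using k unfolding P_def by (auto simp: in_prime_factors_iff dest!: dvd_imp_le)
      show "p ^ multiplicity p k dvd p ^ e p" if "p \<in> prime_factors k" for p
        unfolding e_def using k by (intro le_imp_power_dvd Max_ge) auto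
    qed
    finally show ?thesis .
  qed
  then have "Lcm {1..N} dvd (\<Prod>p\<in>P. p ^ e p)" by (rule Lcm_least)
  moreover have "(\<Prod>p\<in>P. p ^ e p) > 0" by (intro prod_pos) (auto simp: P_def prime_gt_0_nat)
  ultimately have "Lcm {1..N} \<le> (\<Prod>p\<in>P. p ^ e p)" by (rule dvd_imp_le)
  also have "\<dots> \<le> (\<Prod>p\<in>P. N)"
  proof (rule prod_mono)
    fix p assume "p \<in> P"
    have "e p \<in> multiplicity p ` {1..N}"
      unfolding e_def using False by (intro Max_in) auto
    then obtain k where k: "k \<in> {1..N}" "e p = multiplicity p k" by auto
    have "p ^ e p dvd k" unfolding k(2) by (rule multiplicity_dvd)
    then show "0 \<le> p ^ e p \<and> p ^ e p \<le> N" using k(1) by (auto dest!: dvd_imp_le)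
  qed
  finally show ?thesis by (simp add: P_def)
next
  case True
  then have empty: "{p::nat. prime p \<and> p \<le> N} = {}" by (auto dest: prime_gt_0_nat)
  show ?thesis unfolding empty using True by simp
qed

text \<open>With \<open>n = N div 2\<close> the least common multiple of \<open>1..N\<close> is
  divisible by \<open>n * (2n choose n)\<close>. The factor \<open>n\<close> from the Leibniz
  triangle cancels the denominator of the bound \<open>4 ^ n / (2 n)\<close> for the central
  binomial coefficient, so only the additive 2 is lost.\<close>

lemma prime_count_lower_bound:
  assumes "N \<ge> 2"
  shows "(real N - 2) * ln 2 \<le> real (card {p::nat. prime p \<and> p \<le> N}) * ln (real N)"
proof -
  define n where "n = N div 2"
  have n: "n \<ge> 1" "2 * n \<le> N" "N \<le> 2 * n + 1" using assms unfolding n_def by linarith+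
  have "n * ((2 * n) choose n) dvd Lcm {1..N}"
    by (rule leibniz_triangle_dvd) (use n in auto)
  then have "n * ((2 * n) choose n) \<le> Lcm {1..N}"
    by (rule dvd_imp_le) (auto intro!: Nat.gr0I simp: Lcm_0_iff)
  also have "\<dots> \<le> N ^ card {p::nat. prime p \<and> p \<le> N}" by (rule Lcm_le_power_card_primes)
  finally have 1: "real n * real ((2 * n) choose n) \<le> real N ^ card {p::nat. prime p \<and> p \<le> N}"
    by (metis of_nat_le_iff of_nat_mult of_nat_power)
  have "4 ^ n / (2 * real n) \<le> real ((2 * n) choose n)"
    using central_binomial_lower_bound[of n] n by simp
  then have "real n * (4 ^ n / (2 * real n)) \<le> real n * real ((2 * n) choose n)"
    using n by (intro mult_left_mono) auto
  moreover have "real n * (4 ^ n / (2 * real n)) = 2 powr (2 * real n - 1)"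
  proof -
    have "(4::real) ^ n = 2 ^ (2 * n)" by (simp add: power_mult)
    also have "\<dots> = 2 powr (2 * real n)" by (simp flip: powr_realpow)
    finally have "(4::real) ^ n = 2 powr (2 * real n)" .
    then show ?thesis using n by (simp add: powr_diff)
  qed
  ultimately have "2 powr (2 * real n - 1) \<le> real N ^ card {p::nat. prime p \<and> p \<le> N}"
    using 1 by linarith
  then have "ln (2 powr (2 * real n - 1)) \<le> ln (real N ^ card {p::nat. prime p \<and> p \<le> N})"
    using assms by (subst ln_le_cancel_iff) auto
  then have "(2 * real n - 1) * ln 2 \<le> real (card {p::nat. prime p \<and> p \<le> N}) * ln (real N)"
    using assms by (simp add: ln_powr ln_realpow)
  moreover have "(real N - 2) * ln 2 \<le> (2 * real n - 1) * ln 2"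
    using n by (intro mult_right_mono) auto
  ultimately show ?thesis by linarith
qed

section \<open>The density of the primes to which the field argument applies\<close>

lemma not_good_prime_cases:
  fixes p :: nat
  assumes "prime p" "p > 3" "\<not> (p mod 3 = 2 \<and> p mod 1024 \<noteq> 1 \<and> p mod 1024 \<noteq> 1023)"
  shows "p mod 6 = 1 \<or> p mod 1024 = 1 \<or> p mod 1024 = 1023"
proof -
  have "\<not> 2 dvd p" "\<not> 3 dvd p"
    using assms(1,2) primes_dvd_imp_eq[of 2 p] primes_dvd_imp_eq[of 3 p] by auto
  \<comment> \<open>Passing from modulus 3 to modulus 6 is essential for the constants: the same
    method with modulus 3 would give \<open>ln (3 * sqrt 3) / 2\<close>, which exceeds
    \<open>ln 2\<close>.\<close>
  then have "p mod 3 \<noteq> 2 \<Longrightarrow> p mod 6 = 1" by presburger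
  then show ?thesis using assms(3) by blast
qed

lemma ln3_less: "ln (3::real) < 8 / 5 * ln 2"
proof -
  have "ln ((3::real) ^ 5) < ln (2 ^ 8)" by (subst ln_less_cancel_iff) auto
  moreover have "ln ((3::real) ^ 5) = real 5 * ln 3" by (rule ln_realpow)
  moreover have "ln ((2::real) ^ 8) = real 8 * ln 2" by (rule ln_realpow)
  ultimately have "real 5 * ln (3::real) < real 8 * ln 2" by (simp only:)
  then show ?thesis by simp
qed

text \<open>After multiplication by \<open>ln N\<close>, the three residue classes and the finitely
  many small primes cost at most \<open>(\<beta> + 4 * e) * N\<close>, which is at most
  \<open>95 / 100 * ln 2 * N\<close>; all primes together give at least
  \<open>(N - 2) * ln 2\<close>. The fractions with 97 and 98 only trade \<open>N\<close> for
  \<open>N - 2\<close>.\<close>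

lemma density_of_good_primes:
  fixes Good :: "nat \<Rightarrow> bool"
  assumes Good: "\<And>p. prime p \<Longrightarrow> p \<ge> P0 \<Longrightarrow> p mod 3 = 2 \<Longrightarrow> p mod 1024 \<noteq> 1 \<Longrightarrow> p mod 1024 \<noteq> 1023 \<Longrightarrow> Good p"
  shows "eventually (\<lambda>N. real (card {p. prime p \<and> p \<le> N \<and> Good p}) / real (card {p. prime p \<and> p \<le> N}) \<ge> 1 / 96) sequentially"
proof -
  define \<beta> where "\<beta> = ln (6 * (2 * sqrt 3)) / 5 + 2 * (ln (1024 * 2) / 1023 :: real)"
  define C where "C = real P0 + 4"
  have \<beta>: "\<beta> \<le> 91 / 100 * ln 2"
  proof -
    have "ln (6 * (2 * sqrt 3)) = ln (2 ^ 2 * (3 * sqrt (3::real)))" by simp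
    also have "\<dots> = 2 * ln 2 + (ln 3 + ln 3 / 2)"
    proof -
      have "ln ((2::real) ^ 2 * (3 * sqrt 3)) = ln (2 ^ 2) + (ln 3 + ln (sqrt 3))"
        by (subst ln_mult_pos, simp, simp, subst ln_mult_pos) auto
      moreover have "ln ((2::real) ^ 2) = real 2 * ln 2" by (rule ln_realpow)
      moreover have "ln (sqrt (3::real)) = ln 3 / 2" by (rule ln_sqrt) simp
      ultimately show ?thesis by linarith
    qed
    also have "\<dots> \<le> 44 / 10 * ln 2" using ln3_less by simp
    finally have 1: "ln (6 * (2 * sqrt 3)) \<le> 44 / 10 * ln (2::real)" .
    have "ln (1024 * 2) = ln ((2::real) ^ 11)" by simp
    also have "\<dots> = 11 * ln 2" by (subst ln_realpow) auto
    finally have "ln (1024 * 2) = 11 * ln (2::real)" .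
    moreover have "ln (2::real) > 0" by simp
    ultimately show ?thesis using 1 unfolding \<beta>_def by linarith
  qed
  have l2: "ln (2::real) > 0" by simp
  define e where "e = ln (2::real) / 100"
  have e: "e > 0" using l2 by (simp add: e_def)
  have 6: "eventually (\<lambda>N. real (card (progression_primes 6 1 N)) * ln (real N)
      \<le> (ln (real 6 * (2 * sqrt 3)) / (real 6 - 1) + e) * real N) sequentially"
    by (rule card_progression_primes_eventually_le[OF _ _ _ fact_coprime_part_6 e])
      (auto intro: order_trans[OF _ mult_mono[of 1 2 1 "sqrt 3"]])
  have 1024: "eventually (\<lambda>N. real (card (progression_primes 1024 a N)) * ln (real N)
      \<le> (ln (real 1024 * 2) / (real 1024 - 1) + e) * real N) sequentially" if "0 < a" "a < 1024" for a
    using that by (intro card_progression_primes_eventually_le[OF _ _ _ fact_coprime_part_2power[of _ 10] e]) auto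
  have small: "eventually (\<lambda>N. C * ln (real N) \<le> e * real N) sequentially"
  proof -
    have "((\<lambda>x::real. C * ln x / x) \<longlongrightarrow> 0) at_top" by real_asymp
    then have "((\<lambda>N. C * ln (real N) / real N) \<longlongrightarrow> 0) sequentially"
      by (rule filterlim_compose[OF _ filterlim_real_sequentially])
    then have "eventually (\<lambda>N. C * ln (real N) / real N < e) sequentially" using e by (rule order_tendstoD)
    with eventually_gt_at_top[of 0] show ?thesis
      by eventually_elim (simp add: field_simps)
  qed
  have large: "eventually (\<lambda>N. 97 / 100 * real N \<le> 98 / 100 * (real N - 2)) sequentially"
    using eventually_ge_at_top[of 200] by eventually_elim auto
  from 6 1024[of 1, simplified] 1024[of 1023, simplified] small large eventually_ge_at_top[of 3] show ?thesis
  proof eventually_elim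
    case (elim N)
    define T where "T = {p. prime p \<and> p \<le> N}"
    define Gd where "Gd = {p. prime p \<and> p \<le> N \<and> Good p}"
    have fin: "finite T" unfolding T_def by (rule finite_subset[of _ "{..N}"]) auto
    have finG: "finite Gd" unfolding Gd_def by (rule finite_subset[of _ "{..N}"]) auto
    define B where "B = {..P0 + 3} \<union> (progression_primes 6 1 N \<union> (progression_primes 1024 1 N \<union> progression_primes 1024 1023 N))"
    have finB: "finite B" unfolding B_def by simp
    have "T \<subseteq> Gd \<union> B"
    proof
      fix p assume "p \<in> T"
      then have p: "prime p" "p \<le> N" by (auto simp: T_def)
      show "p \<in> Gd \<union> B"
      proof (cases "p \<le> P0 + 3")
        case False
        then show ?thesis
          using Good[OF p(1)] not_good_prime_cases[OF p(1)] p unfolding Gd_def B_def progression_primes_def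
          by (cases "p mod 3 = 2 \<and> p mod 1024 \<noteq> 1 \<and> p mod 1024 \<noteq> 1023") auto
      qed (simp add: B_def)
    qed
    then have "card T \<le> card Gd + card B"
      using fin finG finB by (meson card_Un_le card_mono finite_UnI le_trans)
    moreover have "card B \<le> (P0 + 4) + (card (progression_primes 6 1 N) + (card (progression_primes 1024 1 N) + card (progression_primes 1024 1023 N)))"
      unfolding B_def by (intro order_trans[OF card_Un_le] add_mono order_refl) simp
    ultimately have "real (card T) \<le> real (card Gd) + (C + real (card (progression_primes 6 1 N))
        + real (card (progression_primes 1024 1 N)) + real (card (progression_primes 1024 1023 N)))"
      unfolding C_def by linarith
    then have "real (card T) * ln (real N) \<le> (real (card Gd) + (C + real (card (progression_primes 6 1 N))
        + real (card (progression_primes 1024 1 N)) + real (card (progression_primes 1024 1023 N)))) * ln (real N)"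
      using elim(6) by (intro mult_right_mono) auto
    also have "\<dots> \<le> real (card Gd) * ln (real N) + (\<beta> + 4 * e) * real N"
      using elim(1-4) unfolding \<beta>_def by (simp add: algebra_simps)
    also have "(\<beta> + 4 * e) * real N \<le> 95 / 100 * ln 2 * real N"
      using \<beta> unfolding e_def by (intro mult_right_mono) auto
    also have "95 / 100 * ln 2 * real N = 95 / 97 * ln 2 * (97 / 100 * real N)" by simp
    also have "\<dots> \<le> 95 / 97 * ln 2 * (98 / 100 * (real N - 2))"
      using elim(5) l2 by (intro mult_left_mono) auto
    also have "\<dots> = 95 / 97 * (98 / 100) * ((real N - 2) * ln 2)" by simp
    also have "\<dots> \<le> 95 / 97 * (98 / 100) * (real (card T) * ln (real N))"
      using prime_count_lower_bound[of N] elim(6) unfolding T_def by (intro mult_left_mono) auto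
    \<comment> \<open>The remaining fraction is 39/970, which exceeds 1/96.\<close>
    finally have "(1 - 95 / 97 * (98 / 100)) * real (card T) * ln (real N) \<le> real (card Gd) * ln (real N)"
      by (simp add: algebra_simps)
    then have "(1 - 95 / 97 * (98 / 100)) * real (card T) \<le> real (card Gd)"
      using elim(6) by (subst (asm) mult_le_cancel_right_pos) auto
    then have "1 / 96 * real (card T) \<le> real (card Gd)" by simp
    moreover have "2 \<in> T" using elim(6) by (simp add: T_def)
    then have "card T > 0" using fin card_gt_0_iff by blast
    ultimately show ?case unfolding T_def[symmetric] Gd_def[symmetric] by (simp add: field_simps)
  qed
qed

lemma infinite_and_liminf_of_eventually:
  fixes Good :: "nat \<Rightarrow> bool"
  assumes ev: "eventually (\<lambda>N. real (card {p. prime p \<and> p \<le> N \<and> Good p}) / real (card {p. prime p \<and> p \<le> N}) \<ge> c) sequentially"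
    and c: "c > 0"
  shows "infinite {p. prime p \<and> Good p}"
    and "liminf (\<lambda>N. ereal (real (card {p. prime p \<and> p \<le> N \<and> Good p}) / real (card {p. prime p \<and> p \<le> N}))) \<ge> ereal c"
proof -
  show "liminf (\<lambda>N. ereal (real (card {p. prime p \<and> p \<le> N \<and> Good p}) / real (card {p. prime p \<and> p \<le> N}))) \<ge> ereal c"
    by (rule Liminf_bounded) (use ev in eventually_elim, simp)
  show "infinite {p. prime p \<and> Good p}"
  proof
    assume fin: "finite {p. prime p \<and> Good p}"
    define k where "k = card {p. prime p \<and> Good p}"
    define m where "m = nat \<lceil>real k / c\<rceil> + 1"
    obtain P where P: "P \<subseteq> {p::nat. prime p}" "finite P" "card P = m"
      using infinite_arbitrarily_large[OF primes_infinite] by blast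
    from ev obtain N0 where N0: "\<And>N. N \<ge> N0 \<Longrightarrow>
        real (card {p. prime p \<and> p \<le> N \<and> Good p}) / real (card {p. prime p \<and> p \<le> N}) \<ge> c"
      by (auto simp: eventually_sequentially)
    define N where "N = Max (insert N0 P)"
    have N: "N \<ge> N0" "\<And>p. p \<in> P \<Longrightarrow> p \<le> N" using P(2) by (auto simp: N_def)
    have "P \<subseteq> {p. prime p \<and> p \<le> N}" using P(1) N(2) by auto
    moreover have finT: "finite {p::nat. prime p \<and> p \<le> N}" by (rule finite_subset[of _ "{..N}"]) auto
    ultimately have mT: "m \<le> card {p. prime p \<and> p \<le> N}" using P(3) card_mono by blast
    have "card {p. prime p \<and> p \<le> N \<and> Good p} \<le> k" unfolding k_def using fin by (intro card_mono) auto
    moreover have "c * real (card {p. prime p \<and> p \<le> N}) \<le> real (card {p. prime p \<and> p \<le> N \<and> Good p})"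
      using N0[OF N(1)] mT unfolding m_def by (subst (asm) pos_le_divide_eq) auto
    moreover have "c * real m \<le> c * real (card {p. prime p \<and> p \<le> N})" using mT c by simp
    ultimately have "c * real m \<le> real k" by linarith
    moreover have "real m > real k / c" unfolding m_def by linarith
    then have "c * real m > real k" using c by (simp add: field_simps)
    ultimately show False by simp
  qed
qed

section \<open>Permutation groups containing half rotations\<close>

text \<open>In the presence of a group, \<open>inv\<close> is the inverse of a group element, so
  inverse functions need a notation of their own.\<close>

abbreviation perm_inv :: "('a \<Rightarrow> 'a) \<Rightarrow> 'a \<Rightarrow> 'a" where
  "perm_inv \<equiv> inv_into UNIV"

section \<open>From 3-cycles to the full symmetric group\<close>

locale perm_set =
  fixes \<Omega> :: "'a set" and H :: "('a \<Rightarrow> 'a) set"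
  assumes finite_points: "finite \<Omega>"
    and H_permutes: "\<sigma> \<in> H \<Longrightarrow> \<sigma> permutes \<Omega>"
    and H_comp: "\<sigma> \<in> H \<Longrightarrow> \<tau> \<in> H \<Longrightarrow> \<sigma> \<circ> \<tau> \<in> H"
    and H_inv: "\<sigma> \<in> H \<Longrightarrow> perm_inv \<sigma> \<in> H"
    and H_id: "id \<in> H"
begin

lemma H_inv_apply:
  assumes "\<sigma> \<in> H" shows "\<sigma> (perm_inv \<sigma> x) = x" "perm_inv \<sigma> (\<sigma> x) = x"
  using permutes_inverses[OF H_permutes[OF assms]] by auto

lemma H_mem_iff: "\<sigma> \<in> H \<Longrightarrow> \<sigma> x \<in> \<Omega> \<longleftrightarrow> x \<in> \<Omega>"
  using H_permutes permutes_in_image by metis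

lemma H_inj: "\<sigma> \<in> H \<Longrightarrow> inj \<sigma>"
  using H_permutes permutes_inj by blast

lemma H_card_image: "\<sigma> \<in> H \<Longrightarrow> card (\<sigma> ` U) = card U"
  by (rule card_image[OF inj_on_subset[OF H_inj subset_UNIV]])

lemma H_image_Int: "\<sigma> \<in> H \<Longrightarrow> \<sigma> ` (U \<inter> V) = \<sigma> ` U \<inter> \<sigma> ` V"
  by (rule image_Int[OF H_inj])

lemma H_transpose_conj:
  assumes "\<sigma> \<in> H"
  shows "\<sigma> \<circ> transpose a b \<circ> perm_inv \<sigma> = transpose (\<sigma> a) (\<sigma> b)"
proof
  fix x
  show "(\<sigma> \<circ> transpose a b \<circ> perm_inv \<sigma>) x = transpose (\<sigma> a) (\<sigma> b) x"
    using H_inv_apply[OF assms] by (auto simp: transpose_def)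
qed

text \<open>For involutions this says that both lie in the same right coset of
  \<open>H\<close>.\<close>

definition transp_eqv :: "('a \<Rightarrow> 'a) \<Rightarrow> ('a \<Rightarrow> 'a) \<Rightarrow> bool" where
  "transp_eqv \<tau> \<tau>' \<longleftrightarrow> \<tau> \<circ> \<tau>' \<in> H"

lemma transp_eqv_sym:
  assumes "transp_eqv (transpose a b) (transpose c d)"
  shows "transp_eqv (transpose c d) (transpose a b)"
proof -
  have "perm_inv (transpose a b \<circ> transpose c d) = transpose c d \<circ> transpose a b"
    by (subst o_inv_distrib) auto
  then show ?thesis using H_inv assms unfolding transp_eqv_def by metis
qed

lemma transp_eqv_trans:
  assumes "transp_eqv (transpose a b) (transpose c d)" "transp_eqv (transpose c d) (transpose e f)"
  shows "transp_eqv (transpose a b) (transpose e f)"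
proof -
  have "(transpose a b \<circ> transpose c d) \<circ> (transpose c d \<circ> transpose e f) = transpose a b \<circ> transpose e f"
    by (simp add: fun_eq_iff)
  then show ?thesis using H_comp assms unfolding transp_eqv_def by metis
qed

lemma transp_eqv_conj:
  assumes "transp_eqv (transpose a b) (transpose c d)" "\<sigma> \<in> H"
  shows "transp_eqv (transpose (\<sigma> a) (\<sigma> b)) (transpose (\<sigma> c) (\<sigma> d))"
proof -
  have "\<sigma> \<circ> (transpose a b \<circ> transpose c d) \<circ> perm_inv \<sigma> =
      (\<sigma> \<circ> transpose a b \<circ> perm_inv \<sigma>) \<circ> (\<sigma> \<circ> transpose c d \<circ> perm_inv \<sigma>)"
    by (simp add: fun_eq_iff H_inv_apply[OF assms(2)])
  also have "\<dots> = transpose (\<sigma> a) (\<sigma> b) \<circ> transpose (\<sigma> c) (\<sigma> d)"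
    by (simp only: H_transpose_conj[OF assms(2)])
  finally show ?thesis using assms H_comp H_inv unfolding transp_eqv_def by metis
qed

text \<open>The composition in \<open>cyc\<close> is the 3-cycle through \<open>x0\<close>,
  \<open>y\<close>, \<open>z\<close>. Read as equivalences, these 3-cycles connect all
  transpositions at \<open>x0\<close>, since \<open>A\<close> and \<open>B\<close> are nonempty, and
  hence all transpositions that fix \<open>v\<close>. Conjugating by an element that moves
  \<open>v\<close> to \<open>u\<close> gives the same for those that fix \<open>u\<close>. Two
  transpositions involve at most four of at least five points, so some \<open>u\<close> is always
  free.\<close>

lemma transpositions_equivalent:
  assumes AB: "insert x0 (A \<union> B) = \<Omega> - {v}" "x0 \<notin> A" "x0 \<notin> B" "A \<inter> B = {}" "A \<noteq> {}" "B \<noteq> {}" "v \<in> \<Omega>"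
    and cyc: "\<And>y z. y \<in> A \<Longrightarrow> z \<in> B \<Longrightarrow> transpose x0 z \<circ> transpose x0 y \<in> H"
    and trans: "\<And>x y. x \<in> \<Omega> \<Longrightarrow> y \<in> \<Omega> \<Longrightarrow> \<exists>\<sigma>\<in>H. \<sigma> x = y"
    and card: "card \<Omega> \<ge> 5"
    and abcd: "a \<in> \<Omega>" "b \<in> \<Omega>" "c \<in> \<Omega>" "d \<in> \<Omega>" "a \<noteq> b" "c \<noteq> d"
  shows "transp_eqv (transpose a b) (transpose c d)"
proof -
  obtain y0 z0 where yz: "y0 \<in> A" "z0 \<in> B" using AB by blast
  have zy: "transp_eqv (transpose x0 z) (transpose x0 y)" if "y \<in> A" "z \<in> B" for y z
    using cyc[OF that] unfolding transp_eqv_def .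
  have all: "transp_eqv (transpose x0 e) (transpose x0 z0)" if "e \<in> A \<union> B" for e
    using that zy yz transp_eqv_trans transp_eqv_sym by (metis Un_iff)
  have star: "transp_eqv (transpose x0 e) (transpose x0 f)" if "e \<in> A \<union> B" "f \<in> A \<union> B" for e f
    using all that transp_eqv_trans transp_eqv_sym by metis
  have pair: "transp_eqv (transpose e f) (transpose x0 z0)"
    if ef: "e \<in> A \<union> B" "f \<in> A \<union> B" "e \<noteq> f" for e f
  proof -
    \<comment> \<open>One 3-cycle factored in two ways: this relates a transposition off
      \<open>x0\<close> to one at \<open>x0\<close>.\<close>
    have "transpose x0 f \<circ> transpose x0 e = transpose e f \<circ> transpose x0 f"
      using ef AB by (auto simp: fun_eq_iff transpose_def)
    then have "transp_eqv (transpose e f) (transpose x0 f)"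
      using star[OF ef(2,1)] unfolding transp_eqv_def by simp
    then show ?thesis using all ef transp_eqv_trans by metis
  qed
  have base: "transp_eqv (transpose e f) (transpose x0 z0)"
    if "e \<in> \<Omega> - {v}" "f \<in> \<Omega> - {v}" "e \<noteq> f" for e f
    using that unfolding AB(1)[symmetric] using all[of e] all[of f] pair[of e f] that(3)
    by (auto simp: transpose_commute)
  have avoid: "transp_eqv (transpose e f) (transpose g h)"
    if u: "u \<in> \<Omega>" "{e, f, g, h} \<subseteq> \<Omega> - {u}" "e \<noteq> f" "g \<noteq> h" for u e f g h
  proof -
    obtain \<sigma> where \<sigma>: "\<sigma> \<in> H" "\<sigma> v = u" using trans AB(7) u(1) by blast
    define \<rho> where "\<rho> = perm_inv \<sigma>"
    have mem: "\<rho> x \<in> \<Omega> - {v}" if "x \<in> \<Omega> - {u}" for x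
      using that \<sigma> H_mem_iff[OF H_inv[OF \<sigma>(1)], of x] H_inv_apply(1)[OF \<sigma>(1), of x]
      unfolding \<rho>_def by auto
    have inj: "\<rho> x \<noteq> \<rho> y" if "x \<noteq> y" for x y
      using that H_inv_apply(1)[OF \<sigma>(1)] unfolding \<rho>_def by metis
    have "transp_eqv (transpose (\<rho> e) (\<rho> f)) (transpose (\<rho> g) (\<rho> h))"
      using base[of "\<rho> e" "\<rho> f"] base[of "\<rho> g" "\<rho> h"] mem inj u transp_eqv_trans transp_eqv_sym
      by (metis insert_subset)
    from transp_eqv_conj[OF this \<sigma>(1)] show ?thesis
      unfolding \<rho>_def H_inv_apply(1)[OF \<sigma>(1)] .
  qed
  have "card {a, b, c, d} \<le> 4" by (auto simp: card_insert_if)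
  then have "\<not> \<Omega> \<subseteq> {a, b, c, d}"
    using card card_mono[of "{a, b, c, d}" \<Omega>] by auto
  then obtain u where "u \<in> \<Omega>" "u \<notin> {a, b, c, d}" by blast
  then show ?thesis using abcd by (intro avoid[of u]) auto
qed

text \<open>Parity without the sign of a permutation: \<open>f\<close> is a product of
  \<open>2 * j + 1\<close> disjoint transpositions. Products of two transpositions lie in
  \<open>H\<close>, so they can be cancelled from \<open>f\<close> two at a time until a single one
  is left.\<close>

lemma transposition_in_H:
  assumes eqv: "\<And>a b c d. a \<in> \<Omega> \<Longrightarrow> b \<in> \<Omega> \<Longrightarrow> c \<in> \<Omega> \<Longrightarrow> d \<in> \<Omega> \<Longrightarrow> a \<noteq> b \<Longrightarrow> c \<noteq> d \<Longrightarrow>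
      transp_eqv (transpose a b) (transpose c d)"
    and f: "f \<in> H" "\<And>x. f (f x) = x" "card {x. f x \<noteq> x} = 4 * j + 2"
  shows "\<exists>a\<in>\<Omega>. \<exists>b\<in>\<Omega>. a \<noteq> b \<and> transpose a b \<in> H"
  using f
proof (induction j arbitrary: f)
  case 0
  then have "card {x. f x \<noteq> x} = 2" by simp
  then obtain a b where ab: "{x. f x \<noteq> x} = {a, b}" "a \<noteq> b" unfolding card_2_iff by blast
  have "f a \<noteq> a" "f b \<noteq> b" using ab by auto
  then have "f (f a) \<noteq> f a" "f (f b) \<noteq> f b" using "0.prems"(2) by metis+
  then have "f a \<in> {a, b}" "f b \<in> {a, b}" using ab(1) by blast+
  then have fab: "f a = b" "f b = a" using \<open>f a \<noteq> a\<close> \<open>f b \<noteq> b\<close> by auto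
  have other: "f x = x" if "x \<noteq> a" "x \<noteq> b" for x using ab that by auto
  have "f = transpose a b" using fab other by (auto simp: fun_eq_iff transpose_def)
  moreover have "a \<in> \<Omega>" "b \<in> \<Omega>" using H_permutes[OF "0.prems"(1)] \<open>f a \<noteq> a\<close> \<open>f b \<noteq> b\<close>
    by (meson permutes_not_in)+
  ultimately show ?case using "0.prems"(1) ab(2) by auto
next
  case (Suc j)
  have supp: "{x. f x \<noteq> x} \<subseteq> \<Omega>" using H_permutes[OF Suc.prems(1)] permutes_not_in by fastforce
  then have fin: "finite {x. f x \<noteq> x}" using finite_points finite_subset by blast
  have "{x. f x \<noteq> x} \<noteq> {}" using Suc.prems(3) by (metis add_is_0 card.empty zero_neq_numeral)
  then obtain a where a: "f a \<noteq> a" by blast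
  have "card ({x. f x \<noteq> x} - {a, f a}) > 0"
    using Suc.prems(3) card_Diff_subset[of "{a, f a}" "{x. f x \<noteq> x}"] a Suc.prems(2)
    by (auto simp: card_insert_if)
  then have "{x. f x \<noteq> x} - {a, f a} \<noteq> {}" by (metis card.empty less_numeral_extra(3))
  then obtain c where c: "f c \<noteq> c" "c \<noteq> a" "c \<noteq> f a" by blast
  have fc: "f c \<noteq> a" "f c \<noteq> f a" using c Suc.prems(2) by metis+
  define f' where "f' = transpose a (f a) \<circ> transpose c (f c) \<circ> f"
  have f'x: "f' x = (if x \<in> {a, f a, c, f c} then x else f x)" for x
    unfolding f'_def using a c fc Suc.prems(2) by (auto simp: transpose_def) metis+
  have "{a, f a, c, f c} \<subseteq> {x. f x \<noteq> x}" using a c Suc.prems(2) by auto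
  moreover have "{x. f' x \<noteq> x} = {x. f x \<noteq> x} - {a, f a, c, f c}" unfolding f'x by auto
  moreover have "card {a, f a, c, f c} = 4" using a c fc by (auto simp: card_insert_if)
  ultimately have "card {x. f' x \<noteq> x} = 4 * j + 2"
    using Suc.prems(3) by (simp add: card_Diff_subset)
  moreover have "f' (f' x) = x" for x
    unfolding f'x using Suc.prems(2) by auto metis+
  moreover have "f' \<in> H"
  proof -
    have "a \<in> \<Omega>" "f a \<in> \<Omega>" "c \<in> \<Omega>" "f c \<in> \<Omega>"
      using supp \<open>{a, f a, c, f c} \<subseteq> {x. f x \<noteq> x}\<close> by auto
    then have "transpose a (f a) \<circ> transpose c (f c) \<in> H"
      using eqv[of a "f a" c "f c"] a c unfolding transp_eqv_def by auto
    then show ?thesis unfolding f'_def using H_comp Suc.prems(1) by blast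
  qed
  ultimately show ?case using Suc.IH[of f'] by blast
qed

lemma H_full:
  assumes eqv: "\<And>a b c d. a \<in> \<Omega> \<Longrightarrow> b \<in> \<Omega> \<Longrightarrow> c \<in> \<Omega> \<Longrightarrow> d \<in> \<Omega> \<Longrightarrow> a \<noteq> b \<Longrightarrow> c \<noteq> d \<Longrightarrow>
      transp_eqv (transpose a b) (transpose c d)"
    and \<tau>: "a0 \<in> \<Omega>" "b0 \<in> \<Omega>" "a0 \<noteq> b0" "transpose a0 b0 \<in> H"
    and \<sigma>: "\<sigma> permutes \<Omega>"
  shows "\<sigma> \<in> H"
  using \<sigma> finite_points
proof (induction rule: permutes_induct)
  case id
  show ?case by (rule H_id)
next
  case (swap a b p)
  have "transpose a b \<circ> transpose a0 b0 \<in> H"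
    using eqv[of a b a0 b0] swap \<tau> unfolding transp_eqv_def by blast
  then have "(transpose a b \<circ> transpose a0 b0) \<circ> transpose a0 b0 \<in> H" using \<tau>(4) by (rule H_comp)
  then have "transpose a b \<in> H" by (simp add: comp_assoc)
  then show ?case using swap H_comp by blast
qed

end

section \<open>Commutators of permutations supported on two overlapping sets\<close>

lemma rotation_leaves:
  assumes bij: "bij k" and outside: "\<forall>z. z \<notin> \<Gamma> \<longrightarrow> k z = z" and disj: "k ` (\<Gamma> \<inter> \<Gamma>') \<inter> (\<Gamma> \<inter> \<Gamma>') = {}"
  shows "z \<notin> \<Gamma> \<Longrightarrow> perm_inv k z = z" and "z \<in> \<Gamma> \<Longrightarrow> perm_inv k z \<in> \<Gamma>"
    and "x \<in> \<Gamma> \<inter> \<Gamma>' \<Longrightarrow> k x \<notin> \<Gamma>'" and "x \<in> \<Gamma> \<inter> \<Gamma>' \<Longrightarrow> perm_inv k x \<notin> \<Gamma>'"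
proof -
  have i: "perm_inv k (k z) = z" "k (perm_inv k z) = z" for z
    using bij by (simp_all add: bij_is_inj bij_is_surj surj_f_inv_f)
  show 1: "perm_inv k z = z" if "z \<notin> \<Gamma>" for z using outside that i by metis
  show 2: "perm_inv k z \<in> \<Gamma>" if "z \<in> \<Gamma>" for z using that outside i by metis
  show "k x \<notin> \<Gamma>'" if x: "x \<in> \<Gamma> \<inter> \<Gamma>'"
  proof -
    have "k x \<in> \<Gamma>" using x 1 i by (metis IntD1)
    moreover have "k x \<notin> \<Gamma> \<inter> \<Gamma>'" using disj x by (meson disjoint_iff imageI)
    ultimately show ?thesis by simp
  qed
  show "perm_inv k x \<notin> \<Gamma>'" if x: "x \<in> \<Gamma> \<inter> \<Gamma>'"
  proof
    assume "perm_inv k x \<in> \<Gamma>'"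
    then have "perm_inv k x \<in> \<Gamma> \<inter> \<Gamma>'" using 2 x by simp
    then have "x \<in> k ` (\<Gamma> \<inter> \<Gamma>')" using i(2) by (metis imageI)
    then show False using disj x by (meson disjoint_iff)
  qed
qed

text \<open>When the supports share one point, the commutator is a 3-cycle. Here they share
  \<open>\<Gamma>1 \<inter> \<Gamma>2\<close>, but each rotation moves this set off itself, so every
  \<open>x\<close> in it yields its own 3-cycle from \<open>x\<close> to \<open>k1 x\<close> to
  \<open>k2 x\<close>.\<close>

lemma commutator_of_rotations:
  fixes k1 k2 :: "'a \<Rightarrow> 'a"
  assumes bij: "bij k1" "bij k2"
    and fix1: "\<forall>z. z \<notin> \<Gamma>1 \<longrightarrow> k1 z = z" and fix2: "\<forall>z. z \<notin> \<Gamma>2 \<longrightarrow> k2 z = z"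
    and d1: "k1 ` (\<Gamma>1 \<inter> \<Gamma>2) \<inter> (\<Gamma>1 \<inter> \<Gamma>2) = {}" and d2: "k2 ` (\<Gamma>1 \<inter> \<Gamma>2) \<inter> (\<Gamma>1 \<inter> \<Gamma>2) = {}"
  defines "c \<equiv> k1 \<circ> k2 \<circ> perm_inv k1 \<circ> perm_inv k2"
  shows "x \<in> \<Gamma>1 \<inter> \<Gamma>2 \<Longrightarrow> c x = k1 x"
    and "x \<in> \<Gamma>1 \<inter> \<Gamma>2 \<Longrightarrow> c (k1 x) = k2 x"
    and "x \<in> \<Gamma>1 \<inter> \<Gamma>2 \<Longrightarrow> c (k2 x) = x"
    and "z \<notin> \<Gamma>1 \<inter> \<Gamma>2 \<Longrightarrow> z \<notin> k1 ` (\<Gamma>1 \<inter> \<Gamma>2) \<Longrightarrow> z \<notin> k2 ` (\<Gamma>1 \<inter> \<Gamma>2) \<Longrightarrow> c z = z"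
proof -
  have i: "perm_inv k1 (k1 z) = z" "k1 (perm_inv k1 z) = z" "perm_inv k2 (k2 z) = z" "k2 (perm_inv k2 z) = z" for z
    using bij by (simp_all add: bij_is_inj bij_is_surj surj_f_inv_f)
  note r1 = rotation_leaves[OF bij(1) fix1 d1]
  note r2 = rotation_leaves[OF bij(2) fix2 d2[unfolded Int_commute[of \<Gamma>1 \<Gamma>2]], unfolded Int_commute[of \<Gamma>2 \<Gamma>1]]
  show "c x = k1 x" if "x \<in> \<Gamma>1 \<inter> \<Gamma>2"
    unfolding c_def using r2(4)[OF that] by (simp add: r1(1) i)
  show "c (k1 x) = k2 x" if "x \<in> \<Gamma>1 \<inter> \<Gamma>2"
    unfolding c_def using r1(3)[OF that] r2(3)[OF that] by (simp add: r2(1) i fix1)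
  show "c (k2 x) = x" if "x \<in> \<Gamma>1 \<inter> \<Gamma>2"
    unfolding c_def using r1(4)[OF that] by (simp add: fix2 i)
  show "c z = z" if z: "z \<notin> \<Gamma>1 \<inter> \<Gamma>2" "z \<notin> k1 ` (\<Gamma>1 \<inter> \<Gamma>2)" "z \<notin> k2 ` (\<Gamma>1 \<inter> \<Gamma>2)"
  proof -
    consider "z \<notin> \<Gamma>1" "z \<notin> \<Gamma>2" | "z \<in> \<Gamma>1" "z \<notin> \<Gamma>2" | "z \<in> \<Gamma>2" "z \<notin> \<Gamma>1" using z(1) by blast
    then show ?thesis
    proof cases
      case 1
      then show ?thesis unfolding c_def by (simp add: r1(1) r2(1) fix1 fix2)
    next
      case 2
      then have "perm_inv k1 z \<notin> \<Gamma>2" using z(2) r1(2)[of z] i(2)[of z] by (metis IntI imageI)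
      then show ?thesis unfolding c_def using 2 by (simp add: r2(1) fix2 i)
    next
      case 3
      then have "perm_inv k2 z \<notin> \<Gamma>1" using z(3) r2(2)[of z] i(4)[of z] by (metis IntI imageI)
      then show ?thesis unfolding c_def using 3 by (simp add: r1(1) fix1 i)
    qed
  qed
qed

text \<open>\<open>card_roots\<close> is the trace of the field: it allows at most one subgroup of
  \<open>S\<close> of each order, just as in a cyclic group. \<open>swap\<close> makes the
  complement of \<open>S\<close> an image of \<open>S\<close> as well.\<close>

locale half_rotation_group = comm_group M + perm_set "carrier M" H
  for M :: "('a, 'b) monoid_scheme" (structure) and H :: "('a \<Rightarrow> 'a) set" +
  fixes S :: "'a set"
  assumes subgroup_S: "subgroup S M"
    and card_roots: "w > 0 \<Longrightarrow> card {b\<in>S. b [^] (w::nat) = \<one>} \<le> w"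
    and rotation: "t \<in> S \<Longrightarrow> (\<lambda>x. if x \<in> S then t \<otimes> x else x) \<in> H"
    and swap: "\<exists>\<gamma>\<in>H. \<gamma> ` S = carrier M - S"
    and separation: "x \<in> carrier M \<Longrightarrow> y \<in> carrier M \<Longrightarrow> x \<noteq> y \<Longrightarrow> \<exists>g\<in>H. g x \<in> S \<and> g y \<notin> S"
    and card_S: "card S \<ge> 3"
begin

section \<open>Minimal intersections of images of \<open>S\<close>\<close>

definition halves :: "'a set set" where
  "halves = {g ` S | g. g \<in> H}"

definition min_meet :: nat where
  "min_meet = (LEAST w. \<exists>\<Gamma>\<in>halves. w = card (S \<inter> \<Gamma>) \<and> w > 0)"

lemma S_sub: "S \<subseteq> carrier M" using subgroup.subset[OF subgroup_S] .

lemma finite_S: "finite S" using S_sub finite_points finite_subset by blast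

lemma S_half: "S \<in> halves" unfolding halves_def using H_id by (intro CollectI exI[of _ id]) simp

lemma half_sub: "\<Gamma> \<in> halves \<Longrightarrow> \<Gamma> \<subseteq> carrier M"
  unfolding halves_def using S_sub H_mem_iff by blast

lemma half_finite: "\<Gamma> \<in> halves \<Longrightarrow> finite \<Gamma>"
  using half_sub finite_points finite_subset by blast

lemma half_card: "\<Gamma> \<in> halves \<Longrightarrow> card \<Gamma> = card S"
  unfolding halves_def using H_card_image by auto

lemma half_image: "\<Gamma> \<in> halves \<Longrightarrow> g \<in> H \<Longrightarrow> g ` \<Gamma> \<in> halves"
  unfolding halves_def using H_comp[of g] image_comp[of g _ S] by blast

lemma half_compl: "\<Gamma> \<in> halves \<Longrightarrow> carrier M - \<Gamma> \<in> halves"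
proof -
  assume "\<Gamma> \<in> halves"
  then obtain g where g: "g \<in> H" "\<Gamma> = g ` S" unfolding halves_def by auto
  obtain \<gamma> where \<gamma>: "\<gamma> \<in> H" "\<gamma> ` S = carrier M - S" using swap by blast
  have "g ` (carrier M - S) = g ` carrier M - g ` S"
    by (rule image_set_diff[OF H_inj[OF g(1)]])
  also have "g ` carrier M = carrier M" using permutes_image[OF H_permutes[OF g(1)]] .
  finally have "(g \<circ> \<gamma>) ` S = carrier M - \<Gamma>" using g(2) \<gamma>(2) by (simp only: image_comp[symmetric])
  then show ?thesis unfolding halves_def using H_comp[OF g(1) \<gamma>(1)] by blast
qed

lemma card_carrier: "card (carrier M) = 2 * card S"
proof -
  have "card (carrier M - S) = card S" using half_card[OF half_compl[OF S_half]] .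
  moreover have "card (carrier M - S) = card (carrier M) - card S"
    using card_Diff_subset[OF finite_S S_sub] .
  ultimately show ?thesis using card_S by linarith
qed

lemma min_meet_attained: "\<exists>\<Gamma>\<in>halves. card (S \<inter> \<Gamma>) = min_meet" and min_meet_pos: "min_meet > 0"
proof -
  have "\<exists>\<Gamma>\<in>halves. min_meet = card (S \<inter> \<Gamma>) \<and> min_meet > 0"
    unfolding min_meet_def by (rule LeastI[of _ "card S"]) (use S_half card_S in \<open>auto intro!: bexI[of _ S]\<close>)
  then show "\<exists>\<Gamma>\<in>halves. card (S \<inter> \<Gamma>) = min_meet" "min_meet > 0" by auto
qed

text \<open>Reduces statements on two arbitrary halves to the case where one of them is
  \<open>S\<close> itself.\<close>

lemma half_pullback:
  assumes g: "g \<in> H" and \<Phi>: "\<Phi> \<in> halves"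
  shows "\<exists>\<Psi>\<in>halves. g ` \<Psi> = \<Phi> \<and> g ` S \<inter> \<Phi> = g ` (S \<inter> \<Psi>) \<and> card (S \<inter> \<Psi>) = card (g ` S \<inter> \<Phi>)"
proof (rule bexI)
  show "perm_inv g ` \<Phi> \<in> halves" by (rule half_image[OF \<Phi> H_inv[OF g]])
  have "g ` (perm_inv g ` \<Phi>) = \<Phi>" by (simp add: image_image H_inv_apply[OF g])
  then show "g ` (perm_inv g ` \<Phi>) = \<Phi> \<and> g ` S \<inter> \<Phi> = g ` (S \<inter> perm_inv g ` \<Phi>) \<and>
      card (S \<inter> perm_inv g ` \<Phi>) = card (g ` S \<inter> \<Phi>)"
    using H_image_Int[OF g, of S "perm_inv g ` \<Phi>"] H_card_image[OF g, of "S \<inter> perm_inv g ` \<Phi>"] by simp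
qed

lemma min_meet_le:
  assumes "\<Gamma> \<in> halves" "\<Gamma>' \<in> halves" "\<Gamma> \<inter> \<Gamma>' \<noteq> {}"
  shows "min_meet \<le> card (\<Gamma> \<inter> \<Gamma>')"
proof -
  obtain g where g: "g \<in> H" "\<Gamma> = g ` S" using assms(1) unfolding halves_def by auto
  obtain \<Delta> where \<Delta>: "\<Delta> \<in> halves" "\<Gamma> \<inter> \<Gamma>' = g ` (S \<inter> \<Delta>)" "card (S \<inter> \<Delta>) = card (\<Gamma> \<inter> \<Gamma>')"
    using half_pullback[OF g(1) assms(2)] unfolding g(2) by blast
  then have "card (S \<inter> \<Delta>) > 0" using assms(3) finite_S by (auto simp: card_gt_0_iff)
  then show ?thesis unfolding min_meet_def \<Delta>(3)[symmetric] using \<Delta>(1) by (intro Least_le) auto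
qed

text \<open>By \<open>card_roots\<close> the only candidate for a subgroup of \<open>S\<close> of
  order \<open>min_meet\<close>.\<close>

definition B :: "'a set" where
  "B = {b\<in>S. b [^] min_meet = \<one>}"

text \<open>If \<open>t\<close> moves the minimal intersection \<open>L = S \<inter> \<Gamma>\<close> to a set meeting \<open>L\<close>, then the rotated half
  meets the complement of \<open>\<Gamma>\<close> in fewer than \<open>card L\<close> points, hence not at all.\<close>
lemma rotate_min_meet:
  assumes \<Gamma>: "\<Gamma> \<in> halves" "card (S \<inter> \<Gamma>) = min_meet" and t: "t \<in> S"
    and meet: "x \<in> S \<inter> \<Gamma>" "t \<otimes> x \<in> \<Gamma>"
  shows "(\<lambda>x. t \<otimes> x) ` (S \<inter> \<Gamma>) = S \<inter> \<Gamma>"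
proof -
  define r where "r = (\<lambda>x. if x \<in> S then t \<otimes> x else x)"
  define L where "L = S \<inter> \<Gamma>"
  have finL: "finite L" unfolding L_def using finite_S by blast
  have rH: "r \<in> H" unfolding r_def by (rule rotation[OF t])
  have closed: "t \<otimes> y \<in> S" if "y \<in> S" for y using subgroup.m_closed[OF subgroup_S t that] .
  \<comment> \<open>Points of \<open>\<Gamma>\<close> outside \<open>S\<close> stay where they are,
    so \<open>\<Gamma>\<close> is left only through the rotated copy of \<open>L\<close>.\<close>
  have diff: "r ` \<Gamma> \<inter> (carrier M - \<Gamma>) = (\<lambda>x. t \<otimes> x) ` L - L"
    unfolding L_def r_def using closed S_sub by (auto split: if_splits)
  have "inj_on (\<lambda>x. t \<otimes> x) L"
    using t S_sub unfolding L_def by (intro inj_onI) (auto simp: subset_iff)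
  then have cardL: "card ((\<lambda>x. t \<otimes> x) ` L) = card L" by (rule card_image)
  have "t \<otimes> x \<in> (\<lambda>x. t \<otimes> x) ` L \<inter> L" using meet closed unfolding L_def by auto
  then have "card ((\<lambda>x. t \<otimes> x) ` L - L) < card ((\<lambda>x. t \<otimes> x) ` L)"
    using finL by (intro psubset_card_mono) auto
  then have "\<not> min_meet \<le> card (r ` \<Gamma> \<inter> (carrier M - \<Gamma>))"
    unfolding diff using cardL \<Gamma>(2) unfolding L_def by simp
  then have "r ` \<Gamma> \<inter> (carrier M - \<Gamma>) = {}"
    using min_meet_le[OF half_image[OF \<Gamma>(1) rH] half_compl[OF \<Gamma>(1)]] by blast
  then have "(\<lambda>x. t \<otimes> x) ` L \<subseteq> L" unfolding diff by blast
  then show ?thesis using cardL finL unfolding L_def by (intro card_subset_eq) auto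
qed

text \<open>The elements \<open>t\<close> of \<open>S\<close> with \<open>t \<otimes> x\<close> in
  \<open>\<Gamma>\<close> stabilize the intersection by the previous lemma, so they form a group of
  order \<open>min_meet\<close>. By Lagrange it lies in \<open>B\<close>, and \<open>B\<close> has
  no more elements.\<close>

lemma min_meet_coset:
  assumes \<Gamma>: "\<Gamma> \<in> halves" "card (S \<inter> \<Gamma>) = min_meet" and x: "x \<in> S \<inter> \<Gamma>"
  shows "S \<inter> \<Gamma> = (\<lambda>b. b \<otimes> x) ` B" and "card B = min_meet"
proof -
  define A where "A = {t\<in>S. t \<otimes> x \<in> \<Gamma>}"
  have xM: "x \<in> carrier M" using x S_sub by blast
  have SM: "s \<in> carrier M" if "s \<in> S" for s using that S_sub by blast
  have img: "(\<lambda>b. b \<otimes> x) ` A = S \<inter> \<Gamma>"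
  proof (intro equalityI subsetI)
    fix y assume "y \<in> (\<lambda>b. b \<otimes> x) ` A"
    then show "y \<in> S \<inter> \<Gamma>" unfolding A_def using x subgroup.m_closed[OF subgroup_S] by auto
  next
    fix y assume y: "y \<in> S \<inter> \<Gamma>"
    have "y = (y \<otimes> inv x) \<otimes> x" using xM SM y by (simp add: m_assoc)
    moreover have "y \<otimes> inv x \<in> S" using x y subgroup.m_closed[OF subgroup_S] subgroup.m_inv_closed[OF subgroup_S] by auto
    ultimately show "y \<in> (\<lambda>b. b \<otimes> x) ` A" unfolding A_def using y by auto
  qed
  have "inj_on (\<lambda>b. b \<otimes> x) A" using xM SM unfolding A_def by (intro inj_onI) auto
  then have cA: "card A = min_meet" using img \<Gamma>(2) card_image by metis
  have stab: "(\<lambda>y. t \<otimes> y) ` (S \<inter> \<Gamma>) = S \<inter> \<Gamma>" if "t \<in> A" for t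
    using that x unfolding A_def by (intro rotate_min_meet[OF \<Gamma> _ x]) auto
  have "subgroup A M"
  proof (rule subgroupI)
    show "A \<subseteq> carrier M" unfolding A_def using SM by blast
    have "\<one> \<in> A" unfolding A_def using subgroup.one_closed[OF subgroup_S] x xM by simp
    then show "A \<noteq> {}" by blast
  next
    fix t assume t: "t \<in> A"
    then have tS: "t \<in> S" "t \<in> carrier M" unfolding A_def using SM by auto
    obtain y where y: "y \<in> S \<inter> \<Gamma>" "x = t \<otimes> y" using stab[OF t] x by blast
    then have "inv t \<otimes> x = y" using tS SM by (auto simp: m_assoc[symmetric])
    then show "inv t \<in> A" unfolding A_def using y subgroup.m_inv_closed[OF subgroup_S tS(1)] by simp
  next
    fix t u assume tu: "t \<in> A" "u \<in> A"
    then have "u \<otimes> x \<in> S \<inter> \<Gamma>" using img by blast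
    then have "t \<otimes> (u \<otimes> x) \<in> S \<inter> \<Gamma>" using stab[OF tu(1)] by blast
    then show "t \<otimes> u \<in> A"
      using tu SM xM subgroup.m_closed[OF subgroup_S] unfolding A_def by (auto simp: m_assoc)
  qed
  have "A \<subseteq> B"
  proof
    fix t assume t: "t \<in> A"
    interpret A: group "M\<lparr>carrier := A\<rparr>" using subgroup_imp_group[OF \<open>subgroup A M\<close>] .
    have "t [^]\<^bsub>M\<lparr>carrier := A\<rparr>\<^esub> order (M\<lparr>carrier := A\<rparr>) = \<one>\<^bsub>M\<lparr>carrier := A\<rparr>\<^esub>"
      using t by (intro A.pow_order_eq_1) simp
    then have "t [^] card A = \<one>" by (simp add: order_def nat_pow_consistent[symmetric])
    then show "t \<in> B" using t cA unfolding A_def B_def by simp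
  qed
  moreover have "finite B" unfolding B_def using finite_S by simp
  moreover have "card B \<le> card A" using card_roots[OF min_meet_pos] cA unfolding B_def by simp
  ultimately have "A = B" by (intro card_seteq)
  then show "S \<inter> \<Gamma> = (\<lambda>b. b \<otimes> x) ` B" "card B = min_meet" using img cA by auto
qed

text \<open>Pulled back to \<open>S\<close> by a fixed \<open>g\<close>, both intersections are the
  coset of \<open>B\<close> through the preimage of \<open>x\<close>.\<close>

lemma min_meet_unique:
  assumes "\<Delta> \<in> halves" "\<Gamma> \<in> halves" "\<Gamma>' \<in> halves"
    and "card (\<Delta> \<inter> \<Gamma>) = min_meet" "card (\<Delta> \<inter> \<Gamma>') = min_meet" "x \<in> \<Delta> \<inter> \<Gamma>" "x \<in> \<Delta> \<inter> \<Gamma>'"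
  shows "\<Delta> \<inter> \<Gamma> = \<Delta> \<inter> \<Gamma>'"
proof -
  obtain g where g: "g \<in> H" "\<Delta> = g ` S" using assms(1) unfolding halves_def by auto
  have pull: "\<Delta> \<inter> \<Phi> = (\<lambda>b. g (b \<otimes> perm_inv g x)) ` B"
    if \<Phi>: "\<Phi> \<in> halves" "card (\<Delta> \<inter> \<Phi>) = min_meet" "x \<in> \<Delta> \<inter> \<Phi>" for \<Phi>
  proof -
    obtain \<Psi> where \<Psi>: "\<Psi> \<in> halves" and eq: "\<Delta> \<inter> \<Phi> = g ` (S \<inter> \<Psi>)" and c: "card (S \<inter> \<Psi>) = min_meet"
      using half_pullback[OF g(1) \<Phi>(1)] \<Phi>(2) unfolding g(2) by auto
    have "perm_inv g x \<in> S \<inter> \<Psi>" using eq \<Phi>(3) H_inv_apply(2)[OF g(1)] by auto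
    from min_meet_coset(1)[OF \<Psi> c this] eq show ?thesis by (simp add: image_image)
  qed
  show ?thesis using pull assms by metis
qed

text \<open>A conjugate of the half rotation by the quotient of the pulled back points. If it moved
  a point of the intersection into the intersection, it would stabilize all of it by
  \<open>rotate_min_meet\<close>, and \<open>y\<close> would lie in
  \<open>\<Gamma>2\<close>.\<close>

lemma rotation_exists:
  assumes "\<Gamma>1 \<in> halves" "\<Gamma>2 \<in> halves" "card (\<Gamma>1 \<inter> \<Gamma>2) = min_meet" "x \<in> \<Gamma>1 \<inter> \<Gamma>2" "y \<in> \<Gamma>1 - \<Gamma>2"
  shows "\<exists>k\<in>H. k x = y \<and> (\<forall>z. z \<notin> \<Gamma>1 \<longrightarrow> k z = z) \<and> k ` (\<Gamma>1 \<inter> \<Gamma>2) \<inter> (\<Gamma>1 \<inter> \<Gamma>2) = {}"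
proof -
  obtain g where g: "g \<in> H" "\<Gamma>1 = g ` S" using assms(1) unfolding halves_def by auto
  note gi = H_inv_apply[OF g(1)]
  define h where "h = perm_inv g"
  have hx: "h x \<in> S" "h y \<in> S" using assms(4,5) g(2) gi unfolding h_def by auto
  define t where "t = h y \<otimes> inv (h x)"
  have tS: "t \<in> S" unfolding t_def using hx subgroup.m_closed[OF subgroup_S] subgroup.m_inv_closed[OF subgroup_S] by blast
  have tx: "t \<otimes> h x = h y" unfolding t_def using hx S_sub by (auto simp: m_assoc subset_iff)
  define r where "r = (\<lambda>x. if x \<in> S then t \<otimes> x else x)"
  have rH: "r \<in> H" unfolding r_def by (rule rotation[OF tS])
  define k where "k = g \<circ> r \<circ> h"
  have kH: "k \<in> H" unfolding k_def h_def using g(1) rH H_comp H_inv by blast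
  have kx: "k x = y" unfolding k_def r_def using hx tx gi by (simp add: h_def)
  have kfix: "k z = z" if "z \<notin> \<Gamma>1" for z
  proof -
    have "h z \<notin> S" using that g(2) gi(1)[of z] unfolding h_def by (metis imageI)
    then show ?thesis unfolding k_def r_def using gi by (simp add: h_def)
  qed
  have "k ` (\<Gamma>1 \<inter> \<Gamma>2) \<inter> (\<Gamma>1 \<inter> \<Gamma>2) = {}"
  proof (rule ccontr)
    assume "k ` (\<Gamma>1 \<inter> \<Gamma>2) \<inter> (\<Gamma>1 \<inter> \<Gamma>2) \<noteq> {}"
    then obtain z where z: "z \<in> \<Gamma>1 \<inter> \<Gamma>2" "k z \<in> \<Gamma>1 \<inter> \<Gamma>2" by blast
    obtain \<Psi> where \<Psi>: "\<Psi> \<in> halves" and g\<Psi>: "g ` \<Psi> = \<Gamma>2" and eq: "\<Gamma>1 \<inter> \<Gamma>2 = g ` (S \<inter> \<Psi>)"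
      and c: "card (S \<inter> \<Psi>) = min_meet"
      using half_pullback[OF g(1) assms(2)] assms(3) unfolding g(2) by auto
    have mem: "h v \<in> S \<inter> \<Psi>" if "v \<in> \<Gamma>1 \<inter> \<Gamma>2" for v using eq that gi(2) unfolding h_def by auto
    have "h (k z) = t \<otimes> h z" unfolding k_def r_def using mem[OF z(1)] gi by (simp add: h_def)
    then have "t \<otimes> h z \<in> \<Psi>" using mem[OF z(2)] by simp
    from rotate_min_meet[OF \<Psi> c tS mem[OF z(1)] this]
    have "t \<otimes> h x \<in> \<Psi>" using mem[OF assms(4)] by blast
    then have "g (h y) \<in> \<Gamma>2" using g\<Psi> tx by auto
    then show False using assms(5) gi by (simp add: h_def)
  qed
  then show ?thesis using kH kx kfix by blast
qed

text \<open>Separate the unit element from another element \<open>b\<close> of \<open>B\<close> by a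
  half \<open>\<Gamma>\<close>. Both \<open>\<Gamma>\<close> and its complement then meet
  \<open>S\<close> in at least \<open>min_meet\<close> points. If \<open>S\<close> were too small,
  \<open>S \<inter> \<Gamma>\<close> would be minimal, hence a coset of \<open>B\<close> containing
  the unit element and so also \<open>b\<close>.\<close>

lemma card_S_gt:
  assumes "min_meet > 1"
  shows "2 * min_meet < card S"
proof (rule ccontr)
  assume "\<not> 2 * min_meet < card S"
  obtain \<Gamma>0 where \<Gamma>0: "\<Gamma>0 \<in> halves" "card (S \<inter> \<Gamma>0) = min_meet" using min_meet_attained by blast
  then have "S \<inter> \<Gamma>0 \<noteq> {}" using min_meet_pos by auto
  then have "card B = min_meet" using min_meet_coset(2)[OF \<Gamma>0] by blast
  then have "\<not> B \<subseteq> {\<one>}" using assms card_mono[of "{\<one>}" B] by auto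
  then obtain b where b: "b \<in> B" "b \<noteq> \<one>" by blast
  have bS: "b \<in> S" "b \<in> carrier M" using b(1) S_sub unfolding B_def by auto
  obtain g where g: "g \<in> H" "g \<one> \<in> S" "g b \<notin> S" using separation[of \<one> b] b bS by auto
  define \<Gamma> where "\<Gamma> = perm_inv g ` S"
  have \<Gamma>: "\<Gamma> \<in> halves" unfolding \<Gamma>_def by (rule half_image[OF S_half H_inv[OF g(1)]])
  have "\<one> \<in> \<Gamma>" unfolding \<Gamma>_def using g(2) H_inv_apply(2)[OF g(1)] by (metis imageI)
  then have one: "\<one> \<in> S \<inter> \<Gamma>" using subgroup.one_closed[OF subgroup_S] by blast
  have "b \<notin> \<Gamma>" unfolding \<Gamma>_def using g(3) H_inv_apply(1)[OF g(1)] by auto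
  then have "b \<in> S \<inter> (carrier M - \<Gamma>)" using bS by blast
  then have "min_meet \<le> card (S \<inter> (carrier M - \<Gamma>))" by (intro min_meet_le[OF S_half half_compl[OF \<Gamma>]]) auto
  moreover have le: "min_meet \<le> card (S \<inter> \<Gamma>)" using one by (intro min_meet_le[OF S_half \<Gamma>]) auto
  moreover have "card S = card (S \<inter> \<Gamma>) + card (S \<inter> (carrier M - \<Gamma>))"
  proof -
    have "S = (S \<inter> \<Gamma>) \<union> (S \<inter> (carrier M - \<Gamma>))" using S_sub by blast
    then show ?thesis using finite_S card_Un_disjoint[of "S \<inter> \<Gamma>" "S \<inter> (carrier M - \<Gamma>)"] by fastforce
  qed
  ultimately have "card (S \<inter> \<Gamma>) = min_meet" using \<open>\<not> 2 * min_meet < card S\<close> by linarith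
  from min_meet_coset(1)[OF \<Gamma> this one] have "b \<otimes> \<one> \<in> \<Gamma>" using b(1) by blast
  then show False using \<open>b \<notin> \<Gamma>\<close> bS by simp
qed

text \<open>The points entering a half under a product of disjoint 3-cycles \<open>(x, k1 x, k2 x)\<close>: there is one for
  each 3-cycle that is not constant with respect to membership.\<close>
lemma arrivals:
  assumes \<Gamma>: "\<Gamma>1 \<in> halves" "\<Gamma>2 \<in> halves" "\<Gamma>3 \<in> halves" "card (\<Gamma>1 \<inter> \<Gamma>2) = min_meet"
    and k: "k1 \<in> H" "k2 \<in> H" "\<forall>z. z \<notin> \<Gamma>1 \<longrightarrow> k1 z = z" "\<forall>z. z \<notin> \<Gamma>2 \<longrightarrow> k2 z = z"
      "k1 ` (\<Gamma>1 \<inter> \<Gamma>2) \<inter> (\<Gamma>1 \<inter> \<Gamma>2) = {}" "k2 ` (\<Gamma>1 \<inter> \<Gamma>2) \<inter> (\<Gamma>1 \<inter> \<Gamma>2) = {}"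
  defines "arr \<equiv> \<lambda>x. if x \<in> \<Gamma>3 \<and> k1 x \<notin> \<Gamma>3 then k1 x else if k1 x \<in> \<Gamma>3 \<and> k2 x \<notin> \<Gamma>3 then k2 x else x"
    and "const \<equiv> \<lambda>x. (x \<in> \<Gamma>3 \<longleftrightarrow> k1 x \<in> \<Gamma>3) \<and> (x \<in> \<Gamma>3 \<longleftrightarrow> k2 x \<in> \<Gamma>3)"
  shows "(\<forall>x\<in>\<Gamma>1 \<inter> \<Gamma>2. const x) \<or> ((\<forall>x\<in>\<Gamma>1 \<inter> \<Gamma>2. \<not> const x) \<and>
    (\<exists>\<Delta>\<in>halves. (carrier M - \<Gamma>3) \<inter> \<Delta> = arr ` (\<Gamma>1 \<inter> \<Gamma>2) \<and> card (arr ` (\<Gamma>1 \<inter> \<Gamma>2)) = min_meet))"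
proof -
  define L where "L = \<Gamma>1 \<inter> \<Gamma>2"
  have finL: "finite L" unfolding L_def using half_finite[OF \<Gamma>(1)] by blast
  define c where "c = k1 \<circ> k2 \<circ> perm_inv k1 \<circ> perm_inv k2"
  have cH: "c \<in> H" unfolding c_def using k(1,2) H_comp H_inv by blast
  have bij: "bij k1" "bij k2" using H_permutes[OF k(1)] H_permutes[OF k(2)] permutes_bij by blast+
  note comm = commutator_of_rotations[OF bij k(3-6), folded c_def L_def]
  define N where "N = {x\<in>L. \<not> const x}"
  have diff: "(carrier M - \<Gamma>3) \<inter> c ` \<Gamma>3 = arr ` N"
  proof (intro equalityI subsetI)
    fix z assume "z \<in> (carrier M - \<Gamma>3) \<inter> c ` \<Gamma>3"
    then obtain y where y: "y \<in> \<Gamma>3" "z = c y" "z \<notin> \<Gamma>3" by blast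
    then have "c y \<noteq> y" by auto
    then consider "y \<in> L" | x where "x \<in> L" "y = k1 x" | x where "x \<in> L" "y = k2 x"
      using comm(4)[of y] by blast
    then show "z \<in> arr ` N"
    proof cases
      case 1
      then have "z = k1 y" using comm(1) y by simp
      then have "y \<in> N" "arr y = z" using 1 y unfolding N_def arr_def const_def by auto
      then show ?thesis by blast
    next
      case 2
      then have "z = k2 x" using comm(2) y by simp
      then have "x \<in> N" "arr x = z" using 2 y unfolding N_def arr_def const_def by auto
      then show ?thesis by blast
    next
      case 3
      then have "z = x" using comm(3) y by simp
      then have "x \<in> N" "arr x = z" using 3 y unfolding N_def arr_def const_def by auto
      then show ?thesis by blast
    qed
  next
    fix z assume "z \<in> arr ` N"
    then obtain x where x: "x \<in> L" "\<not> const x" "z = arr x" unfolding N_def by blast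
    have "z \<notin> \<Gamma>3 \<and> z \<in> c ` \<Gamma>3"
    proof -
      consider "x \<in> \<Gamma>3" "k1 x \<notin> \<Gamma>3" | "\<not> (x \<in> \<Gamma>3 \<and> k1 x \<notin> \<Gamma>3)" "k1 x \<in> \<Gamma>3" "k2 x \<notin> \<Gamma>3"
        | "\<not> (x \<in> \<Gamma>3 \<and> k1 x \<notin> \<Gamma>3)" "\<not> (k1 x \<in> \<Gamma>3 \<and> k2 x \<notin> \<Gamma>3)" "x \<notin> \<Gamma>3" "k2 x \<in> \<Gamma>3"
        using x(2) unfolding const_def by blast
      then show ?thesis
      proof cases
        case 1
        then have "z = k1 x" using x(3) unfolding arr_def by simp
        then have "z = c x" using comm(1) x by simp
        then show ?thesis using 1 \<open>z = k1 x\<close> by simp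
      next
        case 2
        then have "z = k2 x" using x(3) unfolding arr_def by simp
        then have "z = c (k1 x)" using comm(2) x by simp
        then show ?thesis using 2 \<open>z = k2 x\<close> by simp
      next
        case 3
        then have "z = x" using x(3) unfolding arr_def by simp
        then have "z = c (k2 x)" using comm(3) x by simp
        then show ?thesis using 3 \<open>z = x\<close> by simp
      qed
    qed
    then show "z \<in> (carrier M - \<Gamma>3) \<inter> c ` \<Gamma>3"
      using half_sub[OF half_image[OF \<Gamma>(3) cH]] by blast
  qed
  show ?thesis
  proof (cases "N = {}")
    case True
    then show ?thesis unfolding N_def L_def by blast
  next
    case False
    \<comment> \<open>Nonempty intersections have at least \<open>min_meet\<close> points, but there
      are at most that many 3-cycles. So once one of them is nonconstant, all are.\<close>
    have "min_meet \<le> card (arr ` N)"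
      unfolding diff[symmetric] by (rule min_meet_le[OF half_compl[OF \<Gamma>(3)] half_image[OF \<Gamma>(3) cH]]) (use diff False in simp)
    moreover have "card (arr ` N) \<le> card N" using finL unfolding N_def by (intro card_image_le) simp
    moreover have "card N \<le> card L" using finL unfolding N_def by (intro card_mono) auto
    ultimately have eq: "card N = card L" "card (arr ` N) = min_meet" using \<Gamma>(4) unfolding L_def by auto
    then have "N = L" using finL unfolding N_def by (intro card_subset_eq) auto
    then show ?thesis using diff eq half_image[OF \<Gamma>(3) cH] unfolding N_def L_def by auto
  qed
qed

text \<open>A half \<open>\<Gamma>3\<close> that splits \<open>L = S \<inter> \<Gamma>2\<close> sees the 3-cycles \<open>(x, k1 x, k2 x)\<close>, \<open>x \<in> L\<close>, either all as constant or
  all as nonconstant. Varying \<open>k2\<close> gives two different minimal intersections of the complement of \<open>\<Gamma>3\<close>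
  through the same point, contradicting the uniqueness of such intersections.\<close>
lemma min_meet_eq_1: "min_meet = 1"
proof (rule ccontr)
  assume "min_meet \<noteq> 1"
  then have w: "min_meet > 1" using min_meet_pos by simp
  obtain \<Gamma>2 where \<Gamma>2: "\<Gamma>2 \<in> halves" "card (S \<inter> \<Gamma>2) = min_meet" using min_meet_attained by blast
  define L where "L = S \<inter> \<Gamma>2"
  have finL: "finite L" "card L = min_meet" unfolding L_def using finite_S \<Gamma>2 by auto
  obtain a where a: "a \<in> L" using finL w by (metis card.empty ex_in_conv not_less_zero)
  have "\<not> L \<subseteq> {a}" using finL w card_mono[of "{a}" L] by auto
  then obtain a' where a': "a' \<in> L" "a' \<noteq> a" by blast
  have "a \<in> carrier M" "a' \<in> carrier M" using a a' S_sub unfolding L_def by auto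
  then obtain g where g: "g \<in> H" "g a \<in> S" "g a' \<notin> S" using separation a'(2) by metis
  define \<Gamma>3 where "\<Gamma>3 = perm_inv g ` S"
  have \<Gamma>3: "\<Gamma>3 \<in> halves" unfolding \<Gamma>3_def by (rule half_image[OF S_half H_inv[OF g(1)]])
  have aP: "a \<in> \<Gamma>3" unfolding \<Gamma>3_def using g(2) H_inv_apply(2)[OF g(1)] by (metis imageI)
  have a'P: "a' \<notin> \<Gamma>3" unfolding \<Gamma>3_def using g(3) H_inv_apply(1)[OF g(1)] by auto
  define ok where "ok = (\<lambda>\<Gamma> k. k \<in> H \<and> (\<forall>z. z \<notin> \<Gamma> \<longrightarrow> k z = z) \<and> k ` L \<inter> L = {})"
  define arr where "arr = (\<lambda>k1 k2 x. if x \<in> \<Gamma>3 \<and> k1 x \<notin> \<Gamma>3 then k1 x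
      else if k1 x \<in> \<Gamma>3 \<and> k2 x \<notin> \<Gamma>3 then k2 x else x)"
  have D: "(\<forall>x\<in>L. (x \<in> \<Gamma>3 \<longleftrightarrow> k1 x \<in> \<Gamma>3) \<and> (x \<in> \<Gamma>3 \<longleftrightarrow> k2 x \<in> \<Gamma>3)) \<or>
     ((\<forall>x\<in>L. \<not> ((x \<in> \<Gamma>3 \<longleftrightarrow> k1 x \<in> \<Gamma>3) \<and> (x \<in> \<Gamma>3 \<longleftrightarrow> k2 x \<in> \<Gamma>3))) \<and>
      (\<exists>\<Delta>\<in>halves. (carrier M - \<Gamma>3) \<inter> \<Delta> = arr k1 k2 ` L \<and> card (arr k1 k2 ` L) = min_meet))"
    if "ok S k1" "ok \<Gamma>2 k2" for k1 k2
    using arrivals[OF S_half \<Gamma>2(1) \<Gamma>3 \<Gamma>2(2), of k1 k2] that unfolding ok_def L_def arr_def by blast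
  have mk1: "\<exists>k. ok S k \<and> k x = y" if "x \<in> L" "y \<in> S - L" for x y
    using rotation_exists[OF S_half \<Gamma>2, of x y] that unfolding ok_def L_def by blast
  have mk2: "\<exists>k. ok \<Gamma>2 k \<and> k x = y" if "x \<in> L" "y \<in> \<Gamma>2 - L" for x y
  proof -
    have "card (\<Gamma>2 \<inter> S) = min_meet" using \<Gamma>2(2) by (simp add: Int_commute)
    from rotation_exists[OF \<Gamma>2(1) S_half this, of x y] that show ?thesis
      unfolding ok_def L_def by (simp add: Int_commute) blast
  qed
  \<comment> \<open>Otherwise \<open>\<Delta>\<close> would meet \<open>\<Gamma>3\<close> or its
    complement inside a proper part of \<open>L\<close>, in fewer than \<open>min_meet\<close>
    points.\<close>
  have both: "(\<exists>y\<in>\<Delta> - L. y \<in> \<Gamma>3) \<and> (\<exists>y\<in>\<Delta> - L. y \<notin> \<Gamma>3)" if \<Delta>: "\<Delta> \<in> halves" "L \<subseteq> \<Delta>" for \<Delta>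
  proof -
    have "\<exists>y\<in>\<Delta> - L. y \<in> \<Gamma>'" if \<Gamma>': "\<Gamma>' \<in> halves" "b \<in> L" "b \<in> \<Gamma>'" "b' \<in> L" "b' \<notin> \<Gamma>'" for \<Gamma>' b b'
    proof (rule ccontr)
      assume "\<not> (\<exists>y\<in>\<Delta> - L. y \<in> \<Gamma>')"
      then have "\<Delta> \<inter> \<Gamma>' \<subseteq> L - {b'}" using \<Gamma>' by blast
      then have "card (\<Delta> \<inter> \<Gamma>') \<le> card (L - {b'})" using finL by (intro card_mono) auto
      also have "\<dots> < card L" using finL \<Gamma>'(4) by (intro psubset_card_mono) auto
      finally have "\<not> min_meet \<le> card (\<Delta> \<inter> \<Gamma>')" using finL(2) by simp
      then show False using min_meet_le[OF \<Delta>(1) \<Gamma>'(1)] \<Gamma>' \<Delta>(2) by blast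
    qed
    from this[OF \<Gamma>3 a aP a'(1) a'P] this[OF half_compl[OF \<Gamma>3] a'(1) _ a]
    show ?thesis using aP a'P \<open>a' \<in> carrier M\<close> by blast
  qed
  have any: "\<exists>k. ok \<Delta> k \<and> (k x \<in> \<Gamma>3 \<longleftrightarrow> v)" if "\<Delta> = S \<or> \<Delta> = \<Gamma>2" "x \<in> L" for \<Delta> x v
  proof -
    have "\<Delta> \<in> halves" "L \<subseteq> \<Delta>" using that(1) S_half \<Gamma>2(1) unfolding L_def by auto
    then obtain y where "y \<in> \<Delta> - L" "y \<in> \<Gamma>3 \<longleftrightarrow> v" using both by (cases v) blast+
    then show ?thesis using mk1[OF that(2)] mk2[OF that(2)] that(1) by blast
  qed
  \<comment> \<open>If \<open>k\<close> preserves membership in \<open>\<Gamma>3\<close> at one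
    point, a suitable \<open>k2\<close> makes the 3-cycle through this point constant. Then all
    3-cycles are constant, so \<open>k\<close> preserves membership on all of \<open>L\<close>. The
    same argument with the two halves exchanged gives \<open>type2\<close>.\<close>
  have type1: "(\<forall>x\<in>L. k x \<in> \<Gamma>3 \<longleftrightarrow> x \<in> \<Gamma>3) \<or> (\<forall>x\<in>L. k x \<in> \<Gamma>3 \<longleftrightarrow> x \<notin> \<Gamma>3)" if k: "ok S k" for k
  proof (rule disjCI)
    assume n: "\<not> (\<forall>x\<in>L. k x \<in> \<Gamma>3 \<longleftrightarrow> x \<notin> \<Gamma>3)"
    then obtain x where x: "x \<in> L" "k x \<in> \<Gamma>3 \<longleftrightarrow> x \<in> \<Gamma>3" by blast
    obtain k2 where k2: "ok \<Gamma>2 k2" "k2 x \<in> \<Gamma>3 \<longleftrightarrow> x \<in> \<Gamma>3" using any[of \<Gamma>2, OF _ x(1)] by blast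
    show "\<forall>x\<in>L. k x \<in> \<Gamma>3 \<longleftrightarrow> x \<in> \<Gamma>3" using D[OF k k2(1)] x k2(2) by blast
  qed
  have type2: "(\<forall>x\<in>L. k x \<in> \<Gamma>3 \<longleftrightarrow> x \<in> \<Gamma>3) \<or> (\<forall>x\<in>L. k x \<in> \<Gamma>3 \<longleftrightarrow> x \<notin> \<Gamma>3)" if k: "ok \<Gamma>2 k" for k
  proof (rule disjCI)
    assume n: "\<not> (\<forall>x\<in>L. k x \<in> \<Gamma>3 \<longleftrightarrow> x \<notin> \<Gamma>3)"
    then obtain x where x: "x \<in> L" "k x \<in> \<Gamma>3 \<longleftrightarrow> x \<in> \<Gamma>3" by blast
    obtain k1 where k1: "ok S k1" "k1 x \<in> \<Gamma>3 \<longleftrightarrow> x \<in> \<Gamma>3" using any[of S, OF _ x(1)] by blast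
    show "\<forall>x\<in>L. k x \<in> \<Gamma>3 \<longleftrightarrow> x \<in> \<Gamma>3" using D[OF k1(1) k] x k1(2) by blast
  qed
  \<comment> \<open>From here on \<open>k1\<close> preserves membership in \<open>\<Gamma>3\<close>
    on \<open>L\<close>, whereas the rotations of \<open>\<Gamma>2\<close> considered below reverse
    it.\<close>
  obtain k1 where k1: "ok S k1" "k1 a \<in> \<Gamma>3" using any[of S, OF _ a, of True] by blast
  then have k1': "\<And>x. x \<in> L \<Longrightarrow> k1 x \<in> \<Gamma>3 \<longleftrightarrow> x \<in> \<Gamma>3" using type1[OF k1(1)] a aP by blast
  have opp: "\<And>x. x \<in> L \<Longrightarrow> k x \<in> \<Gamma>3 \<longleftrightarrow> x \<notin> \<Gamma>3"
    if "ok \<Gamma>2 k" "x0 \<in> L" "k x0 \<in> \<Gamma>3 \<longleftrightarrow> x0 \<notin> \<Gamma>3" for k x0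
    using type2[OF that(1)] that by blast
  \<comment> \<open>Along the 3-cycle membership reads in, in, out or out, out, in. So the arrival
    outside \<open>\<Gamma>3\<close> is \<open>k x\<close> in the first case and \<open>x\<close> in
    the second.\<close>
  have arrL: "\<exists>\<Delta>\<in>halves. (carrier M - \<Gamma>3) \<inter> \<Delta> = (\<lambda>x. if x \<in> \<Gamma>3 then k x else x) ` L \<and>
      card ((carrier M - \<Gamma>3) \<inter> \<Delta>) = min_meet"
    if k: "ok \<Gamma>2 k" "\<And>x. x \<in> L \<Longrightarrow> k x \<in> \<Gamma>3 \<longleftrightarrow> x \<notin> \<Gamma>3" for k
  proof -
    have eq: "arr k1 k ` L = (\<lambda>x. if x \<in> \<Gamma>3 then k x else x) ` L"
      by (rule image_cong[OF refl]) (use k(2) k1' in \<open>auto simp: arr_def\<close>)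
    obtain \<Delta> where "\<Delta> \<in> halves" "(carrier M - \<Gamma>3) \<inter> \<Delta> = arr k1 k ` L" "card (arr k1 k ` L) = min_meet"
      using D[OF k1(1) k(1)] k(2)[OF a] a aP by blast
    then show ?thesis unfolding eq[symmetric] by (intro bexI[of _ \<Delta>] conjI) (simp_all only:)
  qed
  obtain k2 where k2: "ok \<Gamma>2 k2" "k2 a \<notin> \<Gamma>3" using any[of \<Gamma>2, OF _ a, of False] by blast
  have k2': "\<And>x. x \<in> L \<Longrightarrow> k2 x \<in> \<Gamma>3 \<longleftrightarrow> x \<notin> \<Gamma>3" using opp[OF k2(1) a] k2(2) aP by blast
  \<comment> \<open>Here \<open>card_S_gt\<close> enters: it leaves room for a rotation whose image
    of \<open>L\<close> differs from that of \<open>k2\<close>.\<close>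
  have "\<not> \<Gamma>2 \<subseteq> L \<union> k2 ` L"
  proof
    assume "\<Gamma>2 \<subseteq> L \<union> k2 ` L"
    then have "card \<Gamma>2 \<le> card (L \<union> k2 ` L)" using finL by (intro card_mono) auto
    also have "\<dots> \<le> card L + card (k2 ` L)" by (rule card_Un_le)
    also have "card (k2 ` L) = card L" using k2(1) H_card_image unfolding ok_def by blast
    finally show False using card_S_gt[OF w] half_card[OF \<Gamma>2(1)] finL by simp
  qed
  then obtain y where y: "y \<in> \<Gamma>2" "y \<notin> L" "y \<notin> k2 ` L" by blast
  \<comment> \<open>The point of \<open>L\<close> is chosen on the opposite side of
    \<open>\<Gamma>3\<close> from \<open>y\<close>, so that \<open>k3\<close> reverses membership as
    well.\<close>
  obtain x' where x': "x' \<in> L" "x' \<in> \<Gamma>3 \<longleftrightarrow> y \<notin> \<Gamma>3" using a aP a' a'P by blast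
  obtain k3 where k3: "ok \<Gamma>2 k3" "k3 x' = y" using mk2[OF x'(1)] y by blast
  have k3': "\<And>x. x \<in> L \<Longrightarrow> k3 x \<in> \<Gamma>3 \<longleftrightarrow> x \<notin> \<Gamma>3" using opp[OF k3(1) x'(1)] k3(2) x'(2) by blast
  obtain \<Delta>2 where \<Delta>2: "\<Delta>2 \<in> halves" "(carrier M - \<Gamma>3) \<inter> \<Delta>2 = (\<lambda>x. if x \<in> \<Gamma>3 then k2 x else x) ` L"
    "card ((carrier M - \<Gamma>3) \<inter> \<Delta>2) = min_meet" using arrL[OF k2(1) k2'] by blast
  obtain \<Delta>3 where \<Delta>3: "\<Delta>3 \<in> halves" "(carrier M - \<Gamma>3) \<inter> \<Delta>3 = (\<lambda>x. if x \<in> \<Gamma>3 then k3 x else x) ` L"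
    "card ((carrier M - \<Gamma>3) \<inter> \<Delta>3) = min_meet" using arrL[OF k3(1) k3'] by blast
  \<comment> \<open>The point \<open>a'\<close> lies in \<open>L\<close> outside
    \<open>\<Gamma>3\<close>, so it is its own arrival for \<open>k2\<close> as well as for
    \<open>k3\<close>.\<close>
  have mem: "a' \<in> (carrier M - \<Gamma>3) \<inter> \<Delta>2" "a' \<in> (carrier M - \<Gamma>3) \<inter> \<Delta>3"
    unfolding \<Delta>2(2) \<Delta>3(2) using a' a'P by (auto intro!: image_eqI[of a' _ a'])
  have "(carrier M - \<Gamma>3) \<inter> \<Delta>2 = (carrier M - \<Gamma>3) \<inter> \<Delta>3"
    by (rule min_meet_unique[OF half_compl[OF \<Gamma>3] \<Delta>2(1) \<Delta>3(1) \<Delta>2(3) \<Delta>3(3) mem])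
  moreover have "k3 a \<in> (\<lambda>x. if x \<in> \<Gamma>3 then k3 x else x) ` L" using a aP by (intro image_eqI[of _ _ a]) auto
  ultimately have "k3 a \<in> (\<lambda>x. if x \<in> \<Gamma>3 then k2 x else x) ` L" using \<Delta>2(2) \<Delta>3(2) by simp
  moreover have "k3 a \<notin> L" using k3(1) a unfolding ok_def by blast
  ultimately have "k3 a \<in> k2 ` L" by (auto split: if_splits)
  have kL: "k ` L = \<Gamma>2 \<inter> k ` S" if "ok \<Gamma>2 k" for k
  proof -
    have kH: "k \<in> H" using that unfolding ok_def by blast
    have "k z \<in> \<Gamma>2 \<longleftrightarrow> z \<in> \<Gamma>2" for z
    proof
      assume "k z \<in> \<Gamma>2"
      show "z \<in> \<Gamma>2"
      proof (rule ccontr)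
        assume "z \<notin> \<Gamma>2"
        then show False using that \<open>k z \<in> \<Gamma>2\<close> unfolding ok_def by auto
      qed
    next
      assume "z \<in> \<Gamma>2"
      show "k z \<in> \<Gamma>2"
      proof (rule ccontr)
        assume n: "k z \<notin> \<Gamma>2"
        then have "k (k z) = k z" using that unfolding ok_def by blast
        then have "k z = z" using H_inj[OF kH] by (auto dest: injD)
        then show False using n \<open>z \<in> \<Gamma>2\<close> by simp
      qed
    qed
    then show ?thesis unfolding L_def by auto
  qed
  have c2: "card (\<Gamma>2 \<inter> k ` S) = min_meet" "k ` S \<in> halves" if "ok \<Gamma>2 k" for k
    using kL[OF that] that H_card_image[of k L] finL half_image[OF S_half, of k] unfolding ok_def by auto
  \<comment> \<open>A second use of uniqueness: the images of \<open>L\<close> under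
    \<open>k2\<close> and \<open>k3\<close> are minimal intersections with \<open>\<Gamma>2\<close>
    that share the point \<open>k3 a\<close>. Their equality contradicts the choice of
    \<open>y\<close>.\<close>
  have "\<Gamma>2 \<inter> k2 ` S = \<Gamma>2 \<inter> k3 ` S"
    by (rule min_meet_unique[OF \<Gamma>2(1) c2(2)[OF k2(1)] c2(2)[OF k3(1)] c2(1)[OF k2(1)] c2(1)[OF k3(1)]])
      (use \<open>k3 a \<in> k2 ` L\<close> a kL[OF k2(1)] kL[OF k3(1)] in auto)
  then have "k3 ` L = k2 ` L" using kL[OF k2(1)] kL[OF k3(1)] by simp
  then show False using y(3) k3(2) x'(1) by blast
qed

lemma H_transitive:
  assumes "x \<in> carrier M" "y \<in> carrier M"
  shows "\<exists>\<sigma>\<in>H. \<sigma> x = y"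
proof -
  obtain \<gamma> where \<gamma>: "\<gamma> \<in> H" "\<gamma> ` S = carrier M - S" using swap by blast
  have to_S: "\<exists>\<sigma>\<in>H. \<sigma> z \<in> S" if "z \<in> carrier M" for z
  proof (cases "z \<in> S")
    case True
    then show ?thesis using H_id by (intro bexI[of _ id]) auto
  next
    case False
    then have "z \<in> \<gamma> ` S" unfolding \<gamma>(2) using that by simp
    then obtain s where "s \<in> S" "z = \<gamma> s" by (elim imageE)
    then have "perm_inv \<gamma> z \<in> S" by (simp only: H_inv_apply(2)[OF \<gamma>(1)])
    then show ?thesis using H_inv[OF \<gamma>(1)] by blast
  qed
  obtain \<sigma> where \<sigma>: "\<sigma> \<in> H" "\<sigma> x \<in> S" using to_S[OF assms(1)] by blast
  obtain \<tau> where \<tau>: "\<tau> \<in> H" "\<tau> y \<in> S" using to_S[OF assms(2)] by blast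
  define t where "t = \<tau> y \<otimes> inv (\<sigma> x)"
  have tS: "t \<in> S" unfolding t_def using \<sigma> \<tau> subgroup.m_closed[OF subgroup_S] subgroup.m_inv_closed[OF subgroup_S] by blast
  define r where "r = (\<lambda>x. if x \<in> S then t \<otimes> x else x)"
  have rH: "r \<in> H" unfolding r_def by (rule rotation[OF tS])
  have "\<sigma> x \<in> carrier M" "\<tau> y \<in> carrier M" using \<sigma>(2) \<tau>(2) S_sub by auto
  then have "r (\<sigma> x) = \<tau> y" unfolding r_def t_def using \<sigma>(2) by (simp add: m_assoc)
  then have "(perm_inv \<tau> \<circ> r \<circ> \<sigma>) x = y" using H_inv_apply(2)[OF \<tau>(1)] by simp
  moreover have "perm_inv \<tau> \<circ> r \<circ> \<sigma> \<in> H" using \<sigma>(1) \<tau>(1) rH H_comp H_inv by blast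
  ultimately show ?thesis by blast
qed

text \<open>With intersections of size one, the commutators are single 3-cycles. They give the even
  permutations, and the involution \<open>f\<close>, which is odd, supplies a transposition.\<close>

theorem contains_all_permutations:
  assumes f: "f \<in> H" "\<And>x. f (f x) = x" "card {x. f x \<noteq> x} = 4 * j + 2" and \<sigma>: "\<sigma> permutes carrier M"
  shows "\<sigma> \<in> H"
proof -
  obtain \<Gamma>2 where \<Gamma>2: "\<Gamma>2 \<in> halves" "card (S \<inter> \<Gamma>2) = 1" using min_meet_attained min_meet_eq_1 by auto
  then obtain x0 where x0: "S \<inter> \<Gamma>2 = {x0}" by (auto simp: card_1_singleton_iff)
  have fin2: "finite \<Gamma>2" using half_finite[OF \<Gamma>2(1)] .
  have "card (S \<union> \<Gamma>2) + 1 = 2 * card S"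
    using card_Un_Int[OF finite_S fin2] \<Gamma>2(2) half_card[OF \<Gamma>2(1)] by simp
  \<comment> \<open>Two halves sharing one point cover all but one of the \<open>2 * card S\<close>
    points. The point left out is the \<open>v\<close> of
    \<open>transpositions_equivalent\<close>.\<close>
  then have "card (carrier M - (S \<union> \<Gamma>2)) = 1"
    using card_carrier card_Diff_subset[of "S \<union> \<Gamma>2" "carrier M"] finite_S fin2 S_sub half_sub[OF \<Gamma>2(1)] by auto
  then obtain v where v: "carrier M - (S \<union> \<Gamma>2) = {v}" by (auto simp: card_1_singleton_iff)
  have nonempty: "\<Gamma> - {x0} \<noteq> {}" if "\<Gamma> \<in> halves" for \<Gamma>
  proof
    assume "\<Gamma> - {x0} = {}"
    then have "card \<Gamma> \<le> card {x0}" by (intro card_mono) auto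
    then show False using half_card[OF that] card_S by simp
  qed
  have cyc: "transpose x0 z \<circ> transpose x0 y \<in> H" if yz: "y \<in> S - {x0}" "z \<in> \<Gamma>2 - {x0}" for y z
  proof -
    obtain k1 where k1: "k1 \<in> H" "k1 x0 = y" "\<forall>z. z \<notin> S \<longrightarrow> k1 z = z" "k1 ` (S \<inter> \<Gamma>2) \<inter> (S \<inter> \<Gamma>2) = {}"
      using rotation_exists[OF S_half \<Gamma>2(1), of x0 y] x0 yz \<Gamma>2(2) min_meet_eq_1 by auto
    obtain k2 where k2: "k2 \<in> H" "k2 x0 = z" "\<forall>z. z \<notin> \<Gamma>2 \<longrightarrow> k2 z = z" "k2 ` (S \<inter> \<Gamma>2) \<inter> (S \<inter> \<Gamma>2) = {}"
      using rotation_exists[OF \<Gamma>2(1) S_half, of x0 z] x0 yz \<Gamma>2(2) min_meet_eq_1 by (auto simp: Int_commute)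
    define c where "c = k1 \<circ> k2 \<circ> perm_inv k1 \<circ> perm_inv k2"
    have cH: "c \<in> H" unfolding c_def using k1(1) k2(1) H_comp H_inv by blast
    have bij: "bij k1" "bij k2" using H_permutes[OF k1(1)] H_permutes[OF k2(1)] permutes_bij by blast+
    note comm = commutator_of_rotations[OF bij k1(3) k2(3) k1(4) k2(4), folded c_def, unfolded x0]
    have "y \<noteq> z" "y \<noteq> x0" "z \<noteq> x0" using yz x0 by auto
    then have "c = transpose x0 z \<circ> transpose x0 y"
      using comm(1-3)[of x0] comm(4) k1(2) k2(2) by (auto simp: fun_eq_iff transpose_def)
    then show ?thesis using cH by simp
  qed
  have eqv: "transp_eqv (transpose a b) (transpose c d)"
    if "a \<in> carrier M" "b \<in> carrier M" "c \<in> carrier M" "d \<in> carrier M" "a \<noteq> b" "c \<noteq> d" for a b c d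
  proof (rule transpositions_equivalent[of x0 "S - {x0}" "\<Gamma>2 - {x0}" v])
    show "insert x0 ((S - {x0}) \<union> (\<Gamma>2 - {x0})) = carrier M - {v}" "v \<in> carrier M"
      using v x0 S_sub half_sub[OF \<Gamma>2(1)] by blast+
    show "(S - {x0}) \<inter> (\<Gamma>2 - {x0}) = {}" using x0 by blast
    show "S - {x0} \<noteq> {}" "\<Gamma>2 - {x0} \<noteq> {}" using nonempty S_half \<Gamma>2(1) by auto
    show "card (carrier M) \<ge> 5" using card_carrier card_S by simp
  qed (use cyc H_transitive that in auto)
  obtain a b where "a \<in> carrier M" "b \<in> carrier M" "a \<noteq> b" "transpose a b \<in> H"
    using transposition_in_H[OF eqv f] by blast
  from H_full[OF eqv this \<sigma>] show ?thesis .
qed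

end

section \<open>Fields with \<open>p ^ 2\<close> elements\<close>

lemma (in cring) binomial_expansion:
  assumes x: "x \<in> carrier R" and y: "y \<in> carrier R"
  shows "(x \<oplus> y) [^] (n::nat) = (\<Oplus>k\<in>{..n}. [(n choose k)] \<cdot> (x [^] k \<otimes> y [^] (n - k)))"
proof (induction n)
  case 0
  then show ?case using x y by simp
next
  case (Suc n)
  define c where "c = (\<lambda>m k. [(m::nat)] \<cdot> (x [^] (k::nat) \<otimes> y [^] (Suc n - k)))"
  have c: "c m k \<in> carrier R" for m k unfolding c_def using x y by simp
  have 1: "[(n choose k)] \<cdot> (x [^] k \<otimes> y [^] (n - k)) \<otimes> x = c (n choose k) (Suc k)" for k
    unfolding c_def using x y by (subst add_pow_ldistr) (auto simp: m_ac)
  have 2: "[(n choose k)] \<cdot> (x [^] k \<otimes> y [^] (n - k)) \<otimes> y = c (n choose k) k" if "k \<in> {..n}" for k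
    unfolding c_def using x y that by (subst add_pow_ldistr) (auto simp: m_assoc Suc_diff_le)
  have "(x \<oplus> y) [^] Suc n = (x \<oplus> y) [^] n \<otimes> x \<oplus> (x \<oplus> y) [^] n \<otimes> y"
    using x y by (simp add: r_distr)
  also have "(x \<oplus> y) [^] n \<otimes> x = (\<Oplus>k\<in>{..n}. c (n choose k) (Suc k))"
    unfolding Suc.IH using x y 1 by (subst finsum_ldistr) auto
  also have "(x \<oplus> y) [^] n \<otimes> y = (\<Oplus>k\<in>{..n}. c (n choose k) k)"
    unfolding Suc.IH using x y by (subst finsum_ldistr) (auto intro!: finsum_cong' simp: 2 c)
  also have "(\<Oplus>k\<in>{..n}. c (n choose k) (Suc k)) = (\<Oplus>k\<in>{..Suc n}. c (if k = 0 then 0 else n choose (k - 1)) k)"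
  proof -
    have "c 0 0 = \<zero>" unfolding c_def using x y by simp
    then show ?thesis using c by (subst finsum_Suc2) auto
  qed
  also have "(\<Oplus>k\<in>{..n}. c (n choose k) k) = (\<Oplus>k\<in>{..Suc n}. c (n choose k) k)"
  proof -
    have "c 0 (Suc n) = \<zero>" unfolding c_def using x y by simp
    then show ?thesis using c by (subst finsum_Suc) (auto simp: binomial_eq_0)
  qed
  also have "(\<Oplus>k\<in>{..Suc n}. c (if k = 0 then 0 else n choose (k - 1)) k) \<oplus> (\<Oplus>k\<in>{..Suc n}. c (n choose k) k)
      = (\<Oplus>k\<in>{..Suc n}. c (if k = 0 then 0 else n choose (k - 1)) k \<oplus> c (n choose k) k)"
    using c by (subst finsum_addf) auto
  also have "\<dots> = (\<Oplus>k\<in>{..Suc n}. [(Suc n choose k)] \<cdot> (x [^] k \<otimes> y [^] (Suc n - k)))"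
  proof (rule finsum_cong')
    fix k assume "k \<in> {..Suc n}"
    have "c m k \<oplus> c m' k = c (m + m') k" for m m'
      unfolding c_def using x y by (simp add: add.nat_pow_mult)
    then show "c (if k = 0 then 0 else n choose (k - 1)) k \<oplus> c (n choose k) k
        = [(Suc n choose k)] \<cdot> (x [^] k \<otimes> y [^] (Suc n - k))"
      using x y by (cases k) (auto simp: c_def)
  qed (use x y in auto)
  finally show ?case .
qed

lemma (in cring) frobenius_add:
  assumes p: "prime (p::nat)" and char: "[p] \<cdot> \<one> = \<zero>" and x: "x \<in> carrier R" and y: "y \<in> carrier R"
  shows "(x \<oplus> y) [^] p = x [^] p \<oplus> y [^] p"
proof -
  have p0: "p > 0" using p prime_gt_0_nat by blast
  have zero: "[m] \<cdot> z = \<zero>" if dvd: "p dvd m" "z \<in> carrier R" for m z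
  proof -
    obtain k where m: "m = p * k" using dvd(1) by (elim dvdE)
    have "[m] \<cdot> z = [k] \<cdot> ([p] \<cdot> z)" unfolding m using that(2) by (simp add: add.nat_pow_pow mult.commute)
    also have "[p] \<cdot> z = ([p] \<cdot> \<one>) \<otimes> z" using that(2) by (subst add_pow_ldistr) auto
    finally show ?thesis using that(2) char by simp
  qed
  define f where "f = (\<lambda>k. [(p choose k)] \<cdot> (x [^] k \<otimes> y [^] (p - k)))"
  have f: "f k \<in> carrier R" for k unfolding f_def using x y by simp
  have f0: "f k = \<zero>" if "k \<noteq> 0" "k \<noteq> p" "k \<in> {..p}" for k
    unfolding f_def using that p x y by (intro zero dvd_choose_prime) auto
  obtain r where r: "p = Suc r" using p0 by (cases p) auto
  have "(x \<oplus> y) [^] p = (\<Oplus>k\<in>{..p}. f k)" unfolding f_def by (rule binomial_expansion[OF x y])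
  also have "\<dots> = f p \<oplus> (\<Oplus>k\<in>{..r}. f k)" unfolding r using f by (subst finsum_Suc) auto
  also have "(\<Oplus>k\<in>{..r}. f k) = (\<Oplus>k\<in>{..r}. if 0 = k then f k else \<zero>)"
    using f f0 r by (intro finsum_cong') auto
  also have "\<dots> = f 0"
    using f by (intro finsum_singleton) auto
  also have "f p \<oplus> f 0 = x [^] p \<oplus> y [^] p" unfolding f_def using x y by simp
  finally show ?thesis .
qed

section \<open>Arithmetic of the field\<close>

locale quadratic_field = field R for R (structure) +
  fixes p :: nat
  assumes finite_carrier: "finite (carrier R)" and card_carrier: "card (carrier R) = p ^ 2"
    and prime_p: "prime p" and p_gt_3: "p > 3"
begin

abbreviation U where "U \<equiv> units_set R"

abbreviation Fr where "Fr x \<equiv> x [^] p"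

lemma U_def': "x \<in> U \<longleftrightarrow> x \<in> carrier R \<and> x \<noteq> \<zero>" by (auto simp: units_set_def)

lemma U_carrier [simp, intro]: "x \<in> U \<Longrightarrow> x \<in> carrier R" by (simp add: U_def')

lemma U_mult_of: "carrier (mult_of R) = U" by (simp add: units_set_def)

lemma finite_U [simp, intro]: "finite U" using finite_carrier by (simp add: units_set_def)

lemma card_U: "card U = p ^ 2 - 1"
  unfolding units_set_def using finite_carrier card_carrier by simp

lemma U_mult [simp, intro]: "x \<in> U \<Longrightarrow> y \<in> U \<Longrightarrow> x \<otimes> y \<in> U"
  using integral by (auto simp: U_def')

lemma one_U [simp, intro]: "\<one> \<in> U" by (simp add: U_def')

lemma U_pow [simp, intro]: "x \<in> U \<Longrightarrow> x [^] (n::nat) \<in> U"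
  by (induction n) auto

lemma U_inv [simp, intro]: "x \<in> U \<Longrightarrow> inv x \<in> U"
  by (metis U_def' field_Units Units_inv_Units Units_closed DiffE DiffI singletonI singletonD)

lemma U_inv_r [simp]: "x \<in> U \<Longrightarrow> x \<otimes> inv x = \<one>" "x \<in> U \<Longrightarrow> inv x \<otimes> x = \<one>"
  by (simp_all add: U_def' field_Units)

lemma U_neg [simp, intro]: "x \<in> U \<Longrightarrow> \<ominus> x \<in> U"
  by (auto simp: U_def')

lemma U_pow_card: assumes "x \<in> U" shows "x [^] (p ^ 2 - 1) = \<one>"
proof -
  interpret M: group "mult_of R" by (rule field_mult_group)
  have "x [^]\<^bsub>mult_of R\<^esub> order (mult_of R) = \<one>\<^bsub>mult_of R\<^esub>"
    using assms by (intro M.pow_order_eq_1) (simp only: U_mult_of)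
  then show ?thesis unfolding order_def U_mult_of card_U by (simp add: Multiplicative_Group.nat_pow_mult_of)
qed

lemma p_square: "p ^ 2 = Suc (p ^ 2 - 1)" using p_gt_3 by simp

lemma p_square_gt: "p ^ 2 > 3 * p" unfolding power2_eq_square
  using p_gt_3 by (intro mult_strict_right_mono) auto

lemma odd_p: "odd p" using prime_p p_gt_3 prime_odd_nat by auto

lemma pow_p_square: assumes "x \<in> carrier R" shows "x [^] (p ^ 2) = x"
proof (cases "x = \<zero>")
  case False
  then have "x \<in> U" using assms by (simp add: U_def')
  then show ?thesis by (subst p_square) (simp only: nat_pow_Suc U_pow_card l_one U_carrier)
next
  case True
  then show ?thesis using p_gt_3 by (simp add: nat_pow_zero)
qed

text \<open>By Lagrange the additive group has exponent dividing \<open>p ^ 2\<close>, and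
  \<open>p ^ 2\<close> times the unit is the square of \<open>p\<close> times the unit.\<close>

lemma char_p: "[p] \<cdot> \<one> = \<zero>"
proof -
  have "[order (add_monoid R)] \<cdot> \<one> = \<zero>" using add.pow_order_eq_1[of \<one>] by simp
  then have "[(p ^ 2)] \<cdot> \<one> = \<zero>" unfolding order_def by (simp add: card_carrier)
  then have "[(p * p)] \<cdot> \<one> = \<zero>" unfolding power2_eq_square .
  then have "([p] \<cdot> \<one>) \<otimes> ([p] \<cdot> \<one>) = \<zero>"
    by (subst add_pow_ldistr, simp, simp, subst add_pow_rdistr) (auto simp: add.nat_pow_pow)
  then show ?thesis using integral by blast
qed

lemma char_coprime:
  assumes "0 < D" "D < p" shows "[(D::nat)] \<cdot> \<one> \<in> U"
proof (rule ccontr)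
  assume "[D] \<cdot> \<one> \<notin> U"
  then have D0: "[D] \<cdot> \<one> = \<zero>" by (simp add: U_def')
  have "\<not> p dvd D" using assms by (auto dest: dvd_imp_le)
  then have "gcd D p = 1" using prime_p by (metis prime_imp_coprime coprime_commute coprime_imp_gcd_eq_1)
  then obtain a b where ab: "D * a = p * b + 1" using bezout_nat[of D p] assms by auto
  have mult: "[(m * k)] \<cdot> \<one> = \<zero>" if "[(m::nat)] \<cdot> \<one> = \<zero>" for m k
  proof -
    have "[(m * k)] \<cdot> \<one> = [k] \<cdot> ([m] \<cdot> \<one>)" by (simp add: add.nat_pow_pow)
    then show ?thesis using that by simp
  qed
  have "[(D * a)] \<cdot> \<one> = \<zero>" "[(p * b)] \<cdot> \<one> = \<zero>" using mult D0 char_p by blast+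
  then have "\<zero> = \<zero> \<oplus> \<one>" unfolding ab by simp
  then show False by simp
qed

lemma Fr_add: "x \<in> carrier R \<Longrightarrow> y \<in> carrier R \<Longrightarrow> Fr (x \<oplus> y) = Fr x \<oplus> Fr y"
  using frobenius_add[OF prime_p char_p] .

lemma Fr_mult: "x \<in> carrier R \<Longrightarrow> y \<in> carrier R \<Longrightarrow> Fr (x \<otimes> y) = Fr x \<otimes> Fr y"
  by (rule nat_pow_distrib)

lemma Fr_zero: "Fr \<zero> = \<zero>" using p_gt_3 by (simp add: nat_pow_zero)

lemma Fr_neg: assumes "x \<in> carrier R" shows "Fr (\<ominus> x) = \<ominus> Fr x"
proof -
  have "Fr x \<oplus> Fr (\<ominus> x) = \<zero>" using Fr_add[of x "\<ominus> x"] assms by (simp add: r_neg Fr_zero)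
  then show ?thesis using assms by (metis minus_equality add.m_comm nat_pow_closed a_inv_closed)
qed

lemma Fr_diff: "x \<in> carrier R \<Longrightarrow> y \<in> carrier R \<Longrightarrow> Fr (x \<ominus> y) = Fr x \<ominus> Fr y"
  by (simp add: minus_eq Fr_add Fr_neg)

lemma Fr_Fr: "x \<in> carrier R \<Longrightarrow> Fr (Fr x) = x"
  using pow_p_square by (simp add: nat_pow_pow power2_eq_square)

lemma two_U: "\<one> \<oplus> \<one> \<in> U"
proof -
  have "[(2::nat)] \<cdot> \<one> \<in> U" using p_gt_3 by (intro char_coprime) auto
  then show ?thesis by (simp add: numeral_2_eq_2)
qed

lemma neg_one_neq: "x \<in> U \<Longrightarrow> \<ominus> x \<noteq> x"
proof
  assume x: "x \<in> U" "\<ominus> x = x"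
  have "(\<one> \<oplus> \<one>) \<otimes> x = x \<ominus> \<ominus> x" using x(1) by (simp add: l_distr minus_eq)
  also have "\<dots> = \<zero>" using x by (simp add: r_right_minus_eq)
  finally have "(\<one> \<oplus> \<one>) \<otimes> x = \<zero>" .
  moreover have "(\<one> \<oplus> \<one>) \<otimes> x \<in> U" using two_U x(1) by blast
  ultimately show False by (simp add: U_def')
qed

lemma square_eq:
  assumes "x \<in> carrier R" "y \<in> carrier R" "x \<otimes> x = y \<otimes> y"
  shows "x = y \<or> x = \<ominus> y"
proof -
  have "(x \<ominus> y) \<otimes> (x \<oplus> y) = x \<otimes> x \<ominus> y \<otimes> y" using assms(1,2) by algebra
  also have "\<dots> = \<zero>" using assms by (simp add: r_right_minus_eq)
  finally have "x \<ominus> y = \<zero> \<or> x \<oplus> y = \<zero>" by (rule integral) (use assms in auto)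
  then show ?thesis
  proof
    assume "x \<oplus> y = \<zero>"
    then show ?thesis using assms by (metis minus_equality)
  qed (use assms in \<open>simp add: r_right_minus_eq\<close>)
qed

lemma card_roots_le: assumes "(n::nat) > 0" shows "card {x \<in> U. x [^] n = \<one>} \<le> n"
proof -
  have "card {x \<in> U. x [^] n = \<one>} \<le> card {x \<in> carrier R. x [^] n = \<one>}"
    using finite_carrier by (intro card_mono) auto
  also have "\<dots> \<le> n" using num_roots_le_deg[OF finite_carrier] assms by simp
  finally show ?thesis .
qed

text \<open>Does the work of a primitive root: it provides an element of norm different from one, a
  nonsquare and a nontrivial cube root of unity.\<close>

lemma non_root_exists:
  assumes "0 < (n::nat)" "n < p ^ 2 - 1"
  shows "\<exists>x\<in>U. x [^] n \<noteq> \<one>"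
proof (rule ccontr)
  assume "\<not> ?thesis"
  then have "{x \<in> U. x [^] n = \<one>} = U" by blast
  then show False using card_roots_le[OF assms(1)] card_U assms(2) by simp
qed

lemma p_square_mod_8: "\<exists>k. p ^ 2 - 1 = 8 * k"
proof -
  obtain m where "p = 2 * m + 1" using odd_p by (auto elim: oddE)
  then have eq: "p ^ 2 - 1 = 4 * (m * (m + 1))" by (simp add: power2_eq_square algebra_simps)
  have "even (m * (m + 1))" by simp
  then obtain k where k: "m * (m + 1) = 2 * k" by (elim evenE)
  show ?thesis unfolding eq k by (rule exI[of _ k]) simp
qed

lemma inj_imp_bij_U:
  assumes "\<And>x. x \<in> U \<Longrightarrow> f x \<in> U" "\<And>x y. x \<in> U \<Longrightarrow> y \<in> U \<Longrightarrow> f x = f y \<Longrightarrow> x = y"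
  shows "bij_betw f U U"
proof -
  have "inj_on f U" using assms(2) by (rule inj_onI)
  moreover have "f ` U = U" using assms(1) \<open>inj_on f U\<close> by (intro endo_inj_surj) auto
  ultimately show ?thesis by (simp add: bij_betw_def)
qed

section \<open>The group \<open>G(q)\<close> in terms of total functions\<close>

definition ext :: "('a \<Rightarrow> 'a) \<Rightarrow> 'a \<Rightarrow> 'a" where
  "ext f = (\<lambda>x. if x \<in> U then f x else x)"

text \<open>Elements of \<open>G_group R\<close> are \<open>undefined\<close> outside
  \<open>U\<close>. \<open>H\<close> holds the same permutations extended by the identity, so that
  \<open>permutes\<close>, composition and \<open>transpose\<close> apply.\<close>

definition H :: "('a \<Rightarrow> 'a) set" where
  "H = {\<phi>. \<phi> permutes U \<and> restrict \<phi> U \<in> G_group R}"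

lemma ext_permutes: "bij_betw f U U \<Longrightarrow> ext f permutes U"
  unfolding ext_def by (rule bij_imp_permutes) (auto cong: bij_betw_cong)

lemma binom_perms_Bij: "binom_perms R \<subseteq> carrier (BijGroup U)"
  unfolding binom_perms_def BijGroup_def Bij_def by (auto cong: bij_betw_cong)

lemma H_comp: assumes "\<phi> \<in> H" "\<psi> \<in> H" shows "\<phi> \<circ> \<psi> \<in> H"
proof -
  have perm: "\<phi> permutes U" "\<psi> permutes U" using assms by (auto simp: H_def)
  have Bij: "restrict \<chi> U \<in> Bij U" if "\<chi> permutes U" for \<chi>
    using permutes_imp_bij[OF that] by (auto simp: Bij_def cong: bij_betw_cong)
  have "restrict (\<phi> \<circ> \<psi>) U = restrict \<phi> U \<otimes>\<^bsub>BijGroup U\<^esub> restrict \<psi> U"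
    using perm Bij by (auto simp: BijGroup_def compose_def fun_eq_iff permutes_in_image)
  moreover have "restrict \<phi> U \<otimes>\<^bsub>BijGroup U\<^esub> restrict \<psi> U \<in> G_group R"
    using assms unfolding H_def G_group_def by (auto intro: generate.eng)
  ultimately show ?thesis using perm permutes_compose[of \<psi> U \<phi>] unfolding H_def by simp
qed

lemma H_inv: assumes "\<phi> \<in> H" shows "inv_into UNIV \<phi> \<in> H"
proof -
  have perm: "\<phi> permutes U" using assms by (auto simp: H_def)
  have Bij: "restrict \<phi> U \<in> Bij U"
    using permutes_imp_bij[OF perm] by (auto simp: Bij_def cong: bij_betw_cong)
  have "restrict (inv_into UNIV \<phi>) U = m_inv (BijGroup U) (restrict \<phi> U)"
  proof -
    have "inv_into UNIV \<phi> x = inv_into U (restrict \<phi> U) x" if "x \<in> U" for x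
    proof -
      define z where "z = inv_into UNIV \<phi> x"
      have z: "\<phi> z = x" "z \<in> U" unfolding z_def
        using permutes_inverses(1)[OF perm] permutes_in_image[OF permutes_inv[OF perm]] that by auto
      have "inv_into U (restrict \<phi> U) (restrict \<phi> U z) = z"
        using Bij z(2) by (intro inv_into_f_f) (auto simp: Bij_def bij_betw_def)
      then show ?thesis using z unfolding z_def by simp
    qed
    then show ?thesis unfolding inv_BijGroup[OF Bij] by (auto simp: fun_eq_iff)
  qed
  moreover have "m_inv (BijGroup U) (restrict \<phi> U) \<in> G_group R"
    using assms group.generate_m_inv_closed[OF group_BijGroup binom_perms_Bij]
    unfolding H_def G_group_def by blast
  ultimately show ?thesis using permutes_inv[OF perm] unfolding H_def by simp
qed

lemma H_id: "id \<in> H"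
proof -
  have "restrict id U = \<one>\<^bsub>BijGroup U\<^esub>" by (simp add: BijGroup_def fun_eq_iff)
  moreover have "\<one>\<^bsub>BijGroup U\<^esub> \<in> G_group R" unfolding G_group_def by (rule generate.one)
  ultimately show ?thesis unfolding H_def by (simp add: permutes_id)
qed

lemma binom_in_H:
  assumes "a \<in> U" "b \<in> U" "0 < m" "m < n" "n < p ^ 2"
    and "\<And>x. x \<in> U \<Longrightarrow> f x = a \<otimes> x [^] m \<oplus> b \<otimes> x [^] n" and "bij_betw f U U"
  shows "ext f \<in> H"
proof -
  have eq: "\<And>x. x \<in> U \<Longrightarrow> binom_map R a b m n x = f x" using assms(6) by (simp add: binom_map_def)
  then have "bij_betw (binom_map R a b m n) U U" using assms(7) by (simp cong: bij_betw_cong)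
  moreover have "restrict (ext f) U = restrict (binom_map R a b m n) U"
    using eq by (auto simp: ext_def fun_eq_iff)
  ultimately have "restrict (ext f) U \<in> binom_perms R"
    unfolding binom_perms_def using assms card_carrier by auto
  then show ?thesis
    using ext_permutes[OF assms(7)] unfolding H_def G_group_def by (auto intro: generate.incl)
qed

lemma H_apply_U: "\<phi> \<in> H \<Longrightarrow> x \<in> U \<Longrightarrow> \<phi> x \<in> U"
  unfolding H_def by (auto simp: permutes_in_image)

text \<open>Together with the next lemma, division in the group: a map that is no binomial itself
  enters as a quotient of known elements.\<close>

lemma ext_comp_left_inverse:
  assumes "ext f \<in> H" "ext g \<in> H" "\<And>x. x \<in> U \<Longrightarrow> h x \<in> U \<and> f (h x) = g x"
  shows "ext h \<in> H"
proof -
  have perm: "ext f permutes U" using assms(1) by (simp add: H_def)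
  have "ext h x = (inv_into UNIV (ext f) \<circ> ext g) x" for x
  proof (cases "x \<in> U")
    case True
    then have "ext g x = ext f (ext h x)" using assms(3)[of x] by (simp add: ext_def)
    then show ?thesis using permutes_inverses(2)[OF perm] by simp
  next
    case False
    then have "ext f x = x" by (simp add: ext_def)
    then have "inv_into UNIV (ext f) x = x" using permutes_inverses(2)[OF perm, of x] by simp
    then show ?thesis using False by (simp add: ext_def)
  qed
  then have "ext h = inv_into UNIV (ext f) \<circ> ext g" by blast
  then show ?thesis using H_comp H_inv assms by metis
qed

lemma ext_comp_right_inverse:
  assumes "ext f \<in> H" "ext g \<in> H" "\<And>x. x \<in> U \<Longrightarrow> h (f x) = g x"
  shows "ext h \<in> H"
proof -
  have perm: "ext f permutes U" using assms(1) by (simp add: H_def)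
  have "ext h x = (ext g \<circ> inv_into UNIV (ext f)) x" for x
  proof (cases "x \<in> U")
    case True
    define z where "z = inv_into UNIV (ext f) x"
    have z: "ext f z = x" "z \<in> U" unfolding z_def
      using permutes_inverses(1)[OF perm] permutes_in_image[OF permutes_inv[OF perm]] True by auto
    then have "h x = g z" using assms(3)[of z] by (simp add: ext_def)
    then have "ext h x = ext g z" using True z(2) by (simp add: ext_def)
    then show ?thesis by (simp add: z_def)
  next
    case False
    then have "ext f x = x" by (simp add: ext_def)
    then have "inv_into UNIV (ext f) x = x" using permutes_inverses(2)[OF perm, of x] by simp
    then show ?thesis using False by (simp add: ext_def)
  qed
  then have "ext h = ext g \<circ> inv_into UNIV (ext f)" by blast
  then show ?thesis using H_comp H_inv assms by metis
qed

lemma U_cancel: "a \<in> carrier R \<Longrightarrow> b \<in> carrier R \<Longrightarrow> c \<in> U \<Longrightarrow> a \<otimes> c = b \<otimes> c \<Longrightarrow> a = b"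
  by (simp add: U_def' m_rcancel)

lemma U_cancel_left: "a \<in> carrier R \<Longrightarrow> b \<in> carrier R \<Longrightarrow> c \<in> U \<Longrightarrow> c \<otimes> a = c \<otimes> b \<Longrightarrow> a = b"
  by (simp add: U_def' m_lcancel)

lemma diff_U: "x \<in> carrier R \<Longrightarrow> y \<in> carrier R \<Longrightarrow> x \<noteq> y \<Longrightarrow> x \<ominus> y \<in> U"
  by (simp add: U_def' r_right_minus_eq)

section \<open>Additive binomials, multiplications and inversion\<close>

definition lin :: "'a \<Rightarrow> 'a \<Rightarrow> 'a \<Rightarrow> 'a" where
  "lin \<alpha> \<beta> x = \<alpha> \<otimes> x \<oplus> \<beta> \<otimes> Fr x"

lemma lin_closed [simp]: "\<alpha> \<in> carrier R \<Longrightarrow> \<beta> \<in> carrier R \<Longrightarrow> x \<in> carrier R \<Longrightarrow> lin \<alpha> \<beta> x \<in> carrier R"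
  by (simp add: lin_def)

lemma lin_diff:
  assumes "\<alpha> \<in> carrier R" "\<beta> \<in> carrier R" "x \<in> carrier R" "y \<in> carrier R"
  shows "lin \<alpha> \<beta> (x \<ominus> y) = lin \<alpha> \<beta> x \<ominus> lin \<alpha> \<beta> y"
proof -
  have "\<alpha> \<otimes> (x \<ominus> y) \<oplus> \<beta> \<otimes> (x' \<ominus> y') = \<alpha> \<otimes> x \<oplus> \<beta> \<otimes> x' \<ominus> (\<alpha> \<otimes> y \<oplus> \<beta> \<otimes> y')"
    if "x' \<in> carrier R" "y' \<in> carrier R" for x' y' using assms that by algebra
  then show ?thesis unfolding lin_def using assms by (simp add: Fr_diff)
qed

text \<open>At a zero, \<open>\<alpha> \<otimes> z\<close> is the negative of
  \<open>\<beta> \<otimes> Fr z\<close>. Taking norms and cancelling the norm of \<open>z\<close>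
  leaves equal norms of \<open>\<alpha>\<close> and \<open>\<beta>\<close>.\<close>

lemma lin_nonzero:
  assumes ab: "\<alpha> \<in> carrier R" "\<beta> \<in> carrier R" "\<alpha> \<otimes> Fr \<alpha> \<noteq> \<beta> \<otimes> Fr \<beta>" and z: "z \<in> U"
  shows "lin \<alpha> \<beta> z \<in> U"
proof (rule ccontr)
  assume "lin \<alpha> \<beta> z \<notin> U"
  then have "\<alpha> \<otimes> z \<oplus> \<beta> \<otimes> Fr z = \<zero>" using ab z unfolding lin_def U_def' by simp
  then have eq: "\<alpha> \<otimes> z = \<ominus> (\<beta> \<otimes> Fr z)" using ab z by (intro minus_equality[symmetric]) auto
  have "(\<alpha> \<otimes> Fr \<alpha>) \<otimes> (z \<otimes> Fr z) = (\<alpha> \<otimes> z) \<otimes> Fr (\<alpha> \<otimes> z)"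
    using ab z by (simp add: Fr_mult m_ac)
  also have "\<dots> = (\<beta> \<otimes> Fr z) \<otimes> Fr (\<beta> \<otimes> Fr z)"
    unfolding eq using ab z by (simp add: Fr_neg l_minus r_minus)
  also have "\<dots> = (\<beta> \<otimes> Fr \<beta>) \<otimes> (z \<otimes> Fr z)"
    using ab z by (simp only: Fr_mult Fr_Fr U_carrier nat_pow_closed) (simp add: m_ac)
  finally have "\<alpha> \<otimes> Fr \<alpha> = \<beta> \<otimes> Fr \<beta>"
    by (rule U_cancel[rotated -1]) (use ab z in auto)
  then show False using ab(3) by simp
qed

lemma lin_bij:
  assumes "\<alpha> \<in> carrier R" "\<beta> \<in> carrier R" "\<alpha> \<otimes> Fr \<alpha> \<noteq> \<beta> \<otimes> Fr \<beta>"
  shows "bij_betw (lin \<alpha> \<beta>) U U"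
proof (rule inj_imp_bij_U)
  fix x y assume xy: "x \<in> U" "y \<in> U" "lin \<alpha> \<beta> x = lin \<alpha> \<beta> y"
  show "x = y"
  proof (rule ccontr)
    assume "x \<noteq> y"
    then have "lin \<alpha> \<beta> (x \<ominus> y) \<in> U" using assms xy by (intro lin_nonzero diff_U) auto
    moreover have "lin \<alpha> \<beta> (x \<ominus> y) = \<zero>" using assms xy by (simp add: lin_diff r_right_minus_eq)
    ultimately show False by (simp add: U_def')
  qed
qed (rule lin_nonzero[OF assms])

lemma lin_H:
  assumes "\<alpha> \<in> U" "\<beta> \<in> U" "\<alpha> \<otimes> Fr \<alpha> \<noteq> \<beta> \<otimes> Fr \<beta>"
  shows "ext (lin \<alpha> \<beta>) \<in> H"
proof (rule binom_in_H[of \<alpha> \<beta> 1 p])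
  show "p < p ^ 2" using p_square_gt by simp
qed (use assms p_gt_3 lin_bij in \<open>auto simp: lin_def\<close>)

lemma lin_exists: "\<exists>\<alpha>\<in>U. \<alpha> \<otimes> Fr \<alpha> \<noteq> \<one> \<otimes> Fr \<one>"
proof -
  have "p + 1 < p ^ 2 - 1" using p_square_gt p_gt_3 by linarith
  then obtain \<alpha> where \<alpha>: "\<alpha> \<in> U" "\<alpha> [^] (p + 1) \<noteq> \<one>" using non_root_exists[of "p + 1"] by auto
  then have "\<alpha> \<otimes> Fr \<alpha> \<noteq> \<one> \<otimes> Fr \<one>" by (simp add: m_comm)
  then show ?thesis using \<alpha> by blast
qed

text \<open>A multiplication has only one term. It is the quotient of an additive binomial scaled by
  \<open>\<gamma>\<close> and the unscaled one.\<close>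

lemma scalar_H: assumes g: "\<gamma> \<in> U" shows "ext (\<lambda>x. \<gamma> \<otimes> x) \<in> H"
proof -
  obtain \<alpha> where \<alpha>: "\<alpha> \<in> U" "\<alpha> \<otimes> Fr \<alpha> \<noteq> \<one> \<otimes> Fr \<one>" using lin_exists by blast
  have "(\<gamma> \<otimes> \<alpha>) \<otimes> Fr (\<gamma> \<otimes> \<alpha>) \<noteq> (\<gamma> \<otimes> \<one>) \<otimes> Fr (\<gamma> \<otimes> \<one>)"
  proof
    assume "(\<gamma> \<otimes> \<alpha>) \<otimes> Fr (\<gamma> \<otimes> \<alpha>) = (\<gamma> \<otimes> \<one>) \<otimes> Fr (\<gamma> \<otimes> \<one>)"
    then have "(\<gamma> \<otimes> Fr \<gamma>) \<otimes> (\<alpha> \<otimes> Fr \<alpha>) = (\<gamma> \<otimes> Fr \<gamma>) \<otimes> (\<one> \<otimes> Fr \<one>)"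
      using g \<alpha>(1) by (simp add: Fr_mult m_ac)
    then have "\<alpha> \<otimes> Fr \<alpha> = \<one> \<otimes> Fr \<one>" by (rule U_cancel_left[rotated -1]) (use g \<alpha>(1) in auto)
    then show False using \<alpha>(2) by simp
  qed
  then have 2: "ext (lin (\<gamma> \<otimes> \<alpha>) (\<gamma> \<otimes> \<one>)) \<in> H" using g \<alpha>(1) by (intro lin_H) auto
  have 1: "ext (lin \<alpha> \<one>) \<in> H" using \<alpha> by (intro lin_H) auto
  show ?thesis
    by (rule ext_comp_right_inverse[OF 1 2]) (use g \<alpha>(1) in \<open>simp add: lin_def r_distr m_assoc\<close>)
qed

lemma inverse_pow: assumes x: "x \<in> U" "m + n = p ^ 2 - 1" shows "x [^] (m::nat) = inv (x [^] (n::nat))"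
proof (rule U_cancel)
  show "x [^] m \<otimes> x [^] n = inv (x [^] n) \<otimes> x [^] n"
  proof -
    have "x [^] m \<otimes> x [^] n = x [^] (m + n)" using x by (simp add: nat_pow_mult)
    also have "\<dots> = \<one>" unfolding x(2) by (rule U_pow_card[OF x(1)])
    finally show ?thesis using x by simp
  qed
qed (use x in auto)

lemma U_inv_inv: assumes "x \<in> U" shows "inv (inv x) = x"
  by (rule U_cancel[of _ _ "inv x"]) (use assms in auto)

lemma inverse_bij: "bij_betw (\<lambda>x. inv x) U U"
proof (rule inj_imp_bij_U)
  fix x y assume "x \<in> U" "y \<in> U" "inv x = inv y"
  then show "x = y" using U_inv_inv by metis
qed auto

text \<open>An additive binomial after inversion is again a binomial, with exponents
  \<open>q - 1 - p\<close> and \<open>q - 2\<close>; dividing by the additive binomial leaves the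
  inversion.\<close>

lemma inverse_H: "ext (\<lambda>x. inv x) \<in> H"
proof -
  obtain \<alpha> where \<alpha>: "\<alpha> \<in> U" "\<alpha> \<otimes> Fr \<alpha> \<noteq> \<one> \<otimes> Fr \<one>" using lin_exists by blast
  define g where "g = (\<lambda>x. lin \<alpha> \<one> (inv x))"
  have bij: "bij_betw g U U"
    using bij_betw_trans[OF inverse_bij lin_bij[of \<alpha> \<one>]] \<alpha> by (simp add: g_def comp_def)
  have gH: "ext g \<in> H"
  proof (rule binom_in_H[of \<one> \<alpha> "p ^ 2 - 1 - p" "p ^ 2 - 2"])
    fix x assume x: "x \<in> U"
    have "x [^] (p ^ 2 - 2) = inv (x [^] (1::nat))" using x p_square_gt p_gt_3 by (intro inverse_pow) auto
    then have 1: "x [^] (p ^ 2 - 2) = inv x" using x by simp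
    have 2: "x [^] (p ^ 2 - 1 - p) = inv (Fr x)" using x p_square_gt p_gt_3 by (intro inverse_pow) auto
    have 3: "inv (Fr x) = Fr (inv x)"
    proof (rule U_cancel)
      have "Fr (inv x) \<otimes> Fr x = Fr (inv x \<otimes> x)" using x by (simp only: Fr_mult U_inv U_carrier)
      then show "inv (Fr x) \<otimes> Fr x = Fr (inv x) \<otimes> Fr x" using x by simp
    qed (use x in auto)
    show "g x = \<one> \<otimes> x [^] (p ^ 2 - 1 - p) \<oplus> \<alpha> \<otimes> x [^] (p ^ 2 - 2)"
      unfolding 1 2 3 g_def lin_def using x \<alpha> by (simp add: a_comm)
  qed (use bij \<alpha> p_square_gt p_gt_3 in auto)
  have "ext (lin \<alpha> \<one>) \<in> H" using \<alpha> by (intro lin_H) auto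
  then show ?thesis
    by (rule ext_comp_left_inverse[OF _ gH]) (simp add: g_def)
qed

section \<open>Squares and half rotations\<close>

definition half :: nat where "half = (p ^ 2 - 1) div 2"

definition S :: "'a set" where "S = {x \<in> U. x [^] half = \<one>}"

lemma half: "2 * half = p ^ 2 - 1" "even half" "half > 0" "half < p ^ 2 - 1"
proof -
  obtain k where k: "p ^ 2 - 1 = 8 * k" using p_square_mod_8 by blast
  then have h: "half = 4 * k" unfolding half_def by simp
  have "k > 0" using k p_square_gt p_gt_3 by (intro Nat.gr0I) auto
  then show "2 * half = p ^ 2 - 1" "even half" "half > 0" "half < p ^ 2 - 1" using h k by auto
qed

lemma S_U: "x \<in> S \<Longrightarrow> x \<in> U" by (simp add: S_def)

lemma pow_half: assumes "x \<in> U" shows "x [^] half = \<one> \<or> x [^] half = \<ominus> \<one>"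
proof (rule square_eq)
  have "x [^] half \<otimes> x [^] half = x [^] (2 * half)" using assms by (simp add: nat_pow_mult mult_2)
  then show "x [^] half \<otimes> x [^] half = \<one> \<otimes> \<one>" using assms half(1) U_pow_card by simp
qed (use assms in auto)

lemma not_S: "x \<in> U \<Longrightarrow> x \<notin> S \<Longrightarrow> x [^] half = \<ominus> \<one>"
  using pow_half by (auto simp: S_def)

lemma S_mult_iff: assumes "x \<in> U" "y \<in> U" shows "x \<otimes> y \<in> S \<longleftrightarrow> (x \<in> S \<longleftrightarrow> y \<in> S)"
proof -
  have e: "(x \<otimes> y) [^] half = x [^] half \<otimes> y [^] half" using assms by (simp add: nat_pow_distrib)
  have n: "\<ominus> \<one> \<noteq> \<one>" using neg_one_neq by blast
  show ?thesis
    using pow_half[OF assms(1)] pow_half[OF assms(2)] assms n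
    unfolding S_def by (auto simp: e l_minus r_minus)
qed

lemma one_S [simp, intro]: "\<one> \<in> S" by (simp add: S_def)

lemma S_inv: assumes "x \<in> S" shows "inv x \<in> S"
  using S_mult_iff[of x "inv x"] assms S_U[OF assms] by simp

lemma neg_one_pow_even: "even (n::nat) \<Longrightarrow> (\<ominus> \<one>) [^] n = \<one>"
proof (elim evenE)
  fix k assume n: "n = 2 * k"
  have "(\<ominus> \<one>) [^] n = ((\<ominus> \<one>) [^] (2::nat)) [^] k" unfolding n by (simp add: nat_pow_pow)
  also have "(\<ominus> \<one>) [^] (2::nat) = \<one>" by (simp add: numeral_2_eq_2 l_minus r_minus)
  finally show ?thesis by simp
qed

lemma nonsquare_exists: "\<exists>\<nu>\<in>U. \<nu> \<notin> S"
  using non_root_exists[OF half(3,4)] by (auto simp: S_def)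

text \<open>The order divides \<open>p - 1\<close>, and \<open>half\<close> is a multiple of it
  since \<open>p + 1\<close> is even.\<close>

lemma prime_field_S: assumes "x \<in> U" "Fr x = x" shows "x \<in> S"
proof -
  have "x [^] (p - 1) = \<one>"
  proof (rule U_cancel[OF _ _ assms(1)])
    have "x [^] (p - 1) \<otimes> x = x [^] Suc (p - 1)" by simp
    also have "Suc (p - 1) = p" using p_gt_3 by simp
    finally show "x [^] (p - 1) \<otimes> x = \<one> \<otimes> x" using assms by simp
  qed (use assms in auto)
  moreover have "half = (p - 1) * ((p + 1) div 2)"
  proof -
    obtain m where "p = 2 * m + 1" using odd_p by (auto elim: oddE)
    then have "2 * half = 2 * ((p - 1) * ((p + 1) div 2))"
      unfolding half(1) by (simp add: power2_eq_square algebra_simps)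
    then show ?thesis by simp
  qed
  ultimately have "x [^] half = \<one>" using assms(1) by (simp flip: nat_pow_pow)
  then show ?thesis using assms(1) by (simp add: S_def)
qed

lemma nonsquare_scaling: assumes "\<nu> \<in> U" "\<nu> \<notin> S" shows "(\<lambda>x. \<nu> \<otimes> x) ` S = U - S"
proof (intro equalityI subsetI)
  fix x assume "x \<in> (\<lambda>x. \<nu> \<otimes> x) ` S"
  then show "x \<in> U - S" using assms S_mult_iff S_U by auto
next
  fix x assume x: "x \<in> U - S"
  have "x = \<nu> \<otimes> (inv \<nu> \<otimes> x)" using assms x by (simp add: m_assoc[symmetric])
  moreover have "inv \<nu> \<notin> S" using S_inv[of "inv \<nu>"] U_inv_inv assms by auto
  then have "inv \<nu> \<otimes> x \<in> S" using S_mult_iff[of "inv \<nu>" x] assms x by auto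
  ultimately show "x \<in> (\<lambda>x. \<nu> \<otimes> x) ` S" by blast
qed

lemma finite_S [simp, intro]: "finite S" unfolding S_def using finite_U by simp

lemma card_nonsquares: "card (U - S) = card S" and card_S: "card S = half"
proof -
  obtain \<nu> where \<nu>: "\<nu> \<in> U" "\<nu> \<notin> S" using nonsquare_exists by blast
  have "inj_on (\<lambda>x. \<nu> \<otimes> x) S" using \<nu>(1) S_U U_cancel_left U_carrier by (intro inj_onI) metis
  from card_image[OF this] show 1: "card (U - S) = card S" using nonsquare_scaling[OF \<nu>] by simp
  have "card (U - S) = card U - card S" by (rule card_Diff_subset) (auto simp: S_U)
  moreover have "card S \<le> card U" by (rule card_mono) (auto simp: S_U)
  ultimately show "card S = half" using 1 card_U half(1) by linarith
qed

lemma half_ge_12: "half \<ge> 12"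
proof -
  have "p \<ge> 5" using p_gt_3 odd_p by (cases "p = 4") auto
  then have "5 * 5 \<le> p * p" by (intro mult_mono) auto
  then show ?thesis using half(1) by (simp add: power2_eq_square)
qed

definition rot :: "'a \<Rightarrow> 'a \<Rightarrow> 'a" where
  "rot t x = (if x \<in> S then t \<otimes> x else x)"

lemma rot_bij: assumes "t \<in> S" shows "bij_betw (rot t) U U"
proof (rule inj_imp_bij_U)
  fix x y assume xy: "x \<in> U" "y \<in> U" "rot t x = rot t y"
  have S: "t \<otimes> z \<in> S" if "z \<in> S" for z using S_mult_iff[of t z] that assms S_U by blast
  have c: "t \<otimes> x = t \<otimes> y \<Longrightarrow> x = y" using U_cancel_left[OF _ _ S_U[OF assms]] xy(1,2) by blast
  show "x = y"
    using xy(3) S[of x] S[of y] c unfolding rot_def by (metis (full_types))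
qed (use S_U[OF assms] in \<open>simp add: rot_def\<close>)

text \<open>The binomial multiplies squares by \<open>a + 1\<close> and nonsquares by
  \<open>a - 1\<close>. The quotient is \<open>t\<close> for \<open>a = (t + 1) / (t - 1)\<close>.
  This fails for \<open>t = 1\<close>, and \<open>t = -1\<close> would give \<open>a = 0\<close>,
  which is no binomial.\<close>

lemma rot_H_generic:
  assumes t: "t \<in> S" "t \<noteq> \<one>" "t \<noteq> \<ominus> \<one>"
  shows "ext (rot t) \<in> H"
proof -
  have tU: "t \<in> U" using S_U[OF t(1)] .
  then have tU: "t \<in> U" "t \<ominus> \<one> \<in> U" using t diff_U by auto
  define a where "a = (t \<oplus> \<one>) \<otimes> inv (t \<ominus> \<one>)"
  have aR: "a \<in> carrier R" unfolding a_def using tU by auto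
  have "a \<otimes> (t \<ominus> \<one>) = (t \<oplus> \<one>) \<otimes> (inv (t \<ominus> \<one>) \<otimes> (t \<ominus> \<one>))"
    unfolding a_def using tU by (intro m_assoc) auto
  then have a1: "a \<otimes> (t \<ominus> \<one>) = t \<oplus> \<one>" using tU by simp
  have a2: "a \<oplus> \<one> = t \<otimes> (a \<ominus> \<one>)"
  proof -
    have "t \<otimes> (a \<ominus> \<one>) = a \<otimes> (t \<ominus> \<one>) \<ominus> (t \<oplus> \<one>) \<oplus> (a \<oplus> \<one>)"
      using aR U_carrier[OF tU(1)] by algebra
    also have "\<dots> = a \<oplus> \<one>" unfolding a1 using aR tU by (simp add: r_right_minus_eq)
    finally show ?thesis by simp
  qed
  have aU: "a \<in> U"
  proof (rule ccontr)
    assume "a \<notin> U"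
    then have "a = \<zero>" using aR by (simp add: U_def')
    then have "\<one> = t \<otimes> (\<ominus> \<one>)" using a2 by (simp add: minus_eq)
    then have "\<one> = \<ominus> t" using tU by (simp add: r_minus)
    then have "t = \<ominus> \<one>" using tU minus_minus[of t] by simp
    then show False using t by simp
  qed
  have cU: "a \<ominus> \<one> \<in> U"
  proof (rule diff_U[OF aR])
    show "a \<noteq> \<one>"
    proof
      assume "a = \<one>"
      then have "\<one> \<oplus> \<one> = t \<otimes> (\<one> \<ominus> \<one>)" using a2 by simp
      also have "\<dots> = \<zero>" using tU by (simp add: minus_eq r_neg)
      finally show False using two_U by (simp add: U_def')
    qed
  qed simp
  define f where "f = (\<lambda>x. a \<otimes> x \<oplus> \<one> \<otimes> x [^] (1 + half))"
  have f: "(a \<ominus> \<one>) \<otimes> rot t x = f x" if x: "x \<in> U" for x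
  proof -
    have e: "f x = a \<otimes> x \<oplus> x [^] half \<otimes> x" unfolding f_def using x by simp
    show ?thesis
    proof (cases "x \<in> S")
      case True
      then have "f x = (a \<oplus> \<one>) \<otimes> x" unfolding e using x aR by (simp add: S_def l_distr)
      then show ?thesis unfolding a2 rot_def using True x tU aR by (simp add: m_ac)
    next
      case False
      then have "f x = (a \<ominus> \<one>) \<otimes> x" unfolding e using x aR not_S[OF x False] by (simp add: minus_eq l_distr)
      then show ?thesis unfolding rot_def using False by simp
    qed
  qed
  have "bij_betw (\<lambda>x. (a \<ominus> \<one>) \<otimes> x) U U"
    using cU U_cancel_left[OF _ _ cU] by (intro inj_imp_bij_U) auto
  from bij_betw_trans[OF rot_bij[OF t(1)] this] have "bij_betw f U U"
    using f by (simp add: comp_def cong: bij_betw_cong)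
  then have "ext f \<in> H"
    by (intro binom_in_H[of a \<one> 1 "1 + half"]) (use aU half p_square in \<open>auto simp: f_def\<close>)
  from scalar_H[OF cU] this show ?thesis
    by (rule ext_comp_left_inverse) (use f bij_betwE[OF rot_bij[OF t(1)]] in auto)
qed

text \<open>The two excluded values are products of two generic ones: if \<open>t\<close> is 1 or -1
  and \<open>s\<close> is neither, then the quotient of \<open>t\<close> by \<open>s\<close> is
  neither.\<close>

lemma rot_H: assumes t: "t \<in> S" shows "ext (rot t) \<in> H"
proof (cases "t = \<one> \<or> t = \<ominus> \<one>")
  case False
  then show ?thesis using t rot_H_generic by blast
next
  case True
  have "\<not> S \<subseteq> {\<one>, \<ominus> \<one>}"
    using card_mono[of "{\<one>, \<ominus> \<one>}" S] card_S half_ge_12 by (auto simp: card_insert_if split: if_splits)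
  then obtain s where s: "s \<in> S" "s \<noteq> \<one>" "s \<noteq> \<ominus> \<one>" by blast
  have U: "t \<in> U" "s \<in> U" using t s S_U by auto
  define u where "u = t \<otimes> inv s"
  have us: "u \<otimes> s = t" unfolding u_def using U by (simp add: m_assoc)
  have uS: "u \<in> S" unfolding u_def using S_mult_iff[of t "inv s"] S_inv t s U by auto
  have uU: "u \<in> U" using uS S_U by blast
  have "u \<noteq> \<one>" using us s True U by auto
  moreover have "u \<noteq> \<ominus> \<one>"
  proof
    assume "u = \<ominus> \<one>"
    then have "\<ominus> s = t" using us U by (simp add: l_minus)
    then have "s = \<ominus> t" using U minus_minus[of s] by simp
    then show False using s True by auto
  qed
  ultimately have "ext (rot u) \<circ> ext (rot s) \<in> H" using uS s rot_H_generic H_comp by blast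
  moreover have "ext (rot u) \<circ> ext (rot s) = ext (rot t)"
  proof
    fix x
    show "(ext (rot u) \<circ> ext (rot s)) x = ext (rot t) x"
      using us s U uU S_mult_iff[of s x] by (auto simp: ext_def rot_def m_assoc[symmetric])
  qed
  ultimately show ?thesis by simp
qed

end

section \<open>Separation of points\<close>

context quadratic_field
begin

text \<open>Cramer's rule for the additive map sending \<open>x\<close> to the unit and
  \<open>y\<close> to \<open>\<nu>\<close>. The primed variables are to be the conjugates, and
  \<open>i\<close> the inverse of the determinant.\<close>

lemma fixed_two_vectors:
  assumes c: "x \<in> carrier R" "y \<in> carrier R" "x' \<in> carrier R" "y' \<in> carrier R" "\<nu> \<in> carrier R" "i \<in> carrier R"
  shows "(y' \<ominus> \<nu> \<otimes> x') \<otimes> i \<otimes> x \<oplus> (\<nu> \<otimes> x \<ominus> y) \<otimes> i \<otimes> x' = (x \<otimes> y' \<ominus> x' \<otimes> y) \<otimes> i"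
    and "(y' \<ominus> \<nu> \<otimes> x') \<otimes> i \<otimes> y \<oplus> (\<nu> \<otimes> x \<ominus> y) \<otimes> i \<otimes> y' = \<nu> \<otimes> ((x \<otimes> y' \<ominus> x' \<otimes> y) \<otimes> i)"
  using c by algebra+

text \<open>The last factor vanishes iff \<open>x\<close> and \<open>y\<close> are dependent over
  the prime field. An additive map scales it by its determinant, the difference of the norms of its
  coefficients.\<close>

lemma wedge_lin:
  assumes c: "\<alpha> \<in> carrier R" "\<beta> \<in> carrier R" "x \<in> carrier R" "y \<in> carrier R"
  shows "lin \<alpha> \<beta> x \<otimes> Fr (lin \<alpha> \<beta> y) \<ominus> Fr (lin \<alpha> \<beta> x) \<otimes> lin \<alpha> \<beta> y =
    (\<alpha> \<otimes> Fr \<alpha> \<ominus> \<beta> \<otimes> Fr \<beta>) \<otimes> (x \<otimes> Fr y \<ominus> Fr x \<otimes> y)"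
proof -
  have id: "(\<alpha> \<otimes> x \<oplus> \<beta> \<otimes> x') \<otimes> (\<alpha>' \<otimes> y' \<oplus> \<beta>' \<otimes> y) \<ominus> (\<alpha>' \<otimes> x' \<oplus> \<beta>' \<otimes> x) \<otimes> (\<alpha> \<otimes> y \<oplus> \<beta> \<otimes> y')
      = (\<alpha> \<otimes> \<alpha>' \<ominus> \<beta> \<otimes> \<beta>') \<otimes> (x \<otimes> y' \<ominus> x' \<otimes> y)"
    if c': "\<alpha>' \<in> carrier R" "\<beta>' \<in> carrier R" "x' \<in> carrier R" "y' \<in> carrier R" for \<alpha>' \<beta>' x' y'
    using c c' by algebra
  have "Fr (lin \<alpha> \<beta> z) = Fr \<alpha> \<otimes> Fr z \<oplus> Fr \<beta> \<otimes> z" if "z \<in> carrier R" for z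
    unfolding lin_def using c that by (simp add: Fr_add Fr_mult Fr_Fr)
  then show ?thesis unfolding lin_def[of \<alpha> \<beta>] using id[of "Fr \<alpha>" "Fr \<beta>" "Fr x" "Fr y"] c
    by (simp add: lin_def)
qed

text \<open>Independent vectors can be sent by a linear map to the square 1 and to a nonsquare
  \<open>\<nu>\<close>.\<close>

lemma separate_independent:
  assumes x: "x \<in> U" and y: "y \<in> U" and D: "x \<otimes> Fr y \<noteq> Fr x \<otimes> y"
  shows "\<exists>g\<in>H. g x \<in> S \<and> g y \<notin> S"
proof -
  \<comment> \<open>The two values excluded for \<open>\<nu>\<close> are those that make a
    coefficient of the linear map zero, so that it would not be a binomial.\<close>
  have "\<not> U - S \<subseteq> {y \<otimes> inv x, Fr y \<otimes> inv (Fr x)}"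
  proof
    assume "U - S \<subseteq> {y \<otimes> inv x, Fr y \<otimes> inv (Fr x)}"
    then have "card (U - S) \<le> card {y \<otimes> inv x, Fr y \<otimes> inv (Fr x)}" by (intro card_mono) auto
    also have "\<dots> \<le> 2" by (simp add: card_insert_if)
    finally show False using card_nonsquares card_S half_ge_12 by simp
  qed
  then obtain \<nu> where \<nu>: "\<nu> \<in> U" "\<nu> \<notin> S" "\<nu> \<noteq> y \<otimes> inv x" "\<nu> \<noteq> Fr y \<otimes> inv (Fr x)" by blast
  define D where "D = x \<otimes> Fr y \<ominus> Fr x \<otimes> y"
  have DU: "D \<in> U" unfolding D_def using x y assms(3) by (intro diff_U) auto
  have ne: "\<nu> \<otimes> u \<noteq> v" if "\<nu> \<noteq> v \<otimes> inv u" "u \<in> U" for u v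
    using that \<nu>(1) by (auto simp: m_assoc)
  define \<alpha> where "\<alpha> = (Fr y \<ominus> \<nu> \<otimes> Fr x) \<otimes> inv D"
  define \<beta> where "\<beta> = (\<nu> \<otimes> x \<ominus> y) \<otimes> inv D"
  have ab: "\<alpha> \<in> U" "\<beta> \<in> U" unfolding \<alpha>_def \<beta>_def
    using DU x y \<nu> ne[of y x] ne[of "Fr y" "Fr x"] by (auto intro!: U_mult diff_U)
  have lx: "lin \<alpha> \<beta> x = \<one>"
  proof -
    have "lin \<alpha> \<beta> x = D \<otimes> inv D"
      unfolding lin_def \<alpha>_def \<beta>_def using fixed_two_vectors(1)[of x y "Fr x" "Fr y" \<nu> "inv D"] x y \<nu> DU
      by (simp add: D_def)
    then show ?thesis using DU by simp
  qed
  have ly: "lin \<alpha> \<beta> y = \<nu>"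
  proof -
    have "lin \<alpha> \<beta> y = \<nu> \<otimes> (D \<otimes> inv D)"
      unfolding lin_def \<alpha>_def \<beta>_def using fixed_two_vectors(2)[of x y "Fr x" "Fr y" \<nu> "inv D"] x y \<nu> DU
      by (simp add: D_def)
    then show ?thesis using DU \<nu> by simp
  qed
  \<comment> \<open>With determinant zero the images 1 and \<open>\<nu>\<close> would be dependent,
    so \<open>\<nu>\<close> would lie in the prime field and be a square.\<close>
  have "\<alpha> \<otimes> Fr \<alpha> \<noteq> \<beta> \<otimes> Fr \<beta>"
  proof
    assume "\<alpha> \<otimes> Fr \<alpha> = \<beta> \<otimes> Fr \<beta>"
    then have "\<alpha> \<otimes> Fr \<alpha> \<ominus> \<beta> \<otimes> Fr \<beta> = \<zero>" using ab by (simp add: r_right_minus_eq)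
    from wedge_lin[of \<alpha> \<beta> x y, unfolded lx ly this]
    have "Fr \<nu> \<ominus> \<nu> = \<zero>" using ab x y \<nu>(1) by simp
    then have "Fr \<nu> = \<nu>" using \<nu>(1) by (simp add: r_right_minus_eq)
    then show False using prime_field_S \<nu> by blast
  qed
  then have "ext (lin \<alpha> \<beta>) \<in> H" using ab by (intro lin_H)
  then show ?thesis using lx ly x y \<nu> one_S by (intro bexI[of _ "ext (lin \<alpha> \<beta>)"]) (auto simp: ext_def)
qed

section \<open>Points whose ratio lies in the prime field\<close>

lemma cube_inj_prime_field:
  assumes p3: "p mod 3 = 2" and u: "u \<in> carrier R" "Fr u = u" and v: "v \<in> carrier R" "Fr v = v"
    and eq: "u [^] (3::nat) = v [^] (3::nat)"
  shows "u = v"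
proof -
  \<comment> \<open>On the prime field the exponent \<open>2 * p - 1\<close> acts as the identity.
    Being a multiple of 3, it shows that \<open>w\<close> is a function of its cube.\<close>
  have p: "2 * p - 1 = 3 * (2 * (p div 3) + 1)" using p3 by presburger
  have "w [^] (2 * p - 1) = w" if w: "w \<in> carrier R" "Fr w = w" for w
  proof -
    have "w [^] (2 * p - 1) = w [^] p \<otimes> w [^] (p - 1)"
    proof -
      have "2 * p - 1 = p + (p - 1)" using p_gt_3 by simp
      then show ?thesis using w(1) by (simp only: nat_pow_mult)
    qed
    also have "\<dots> = w [^] (p - 1) \<otimes> w" using w by (simp add: m_comm)
    also have "\<dots> = w [^] Suc (p - 1)" by simp
    also have "Suc (p - 1) = p" using p_gt_3 by simp
    finally show ?thesis using w by simp
  qed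
  then show ?thesis using u v eq unfolding p by (metis nat_pow_pow)
qed

text \<open>As \<open>p\<close> is 2 modulo 3, a nontrivial cube root of unity is not in the prime
  field, and the Frobenius map squares it.\<close>

lemma cube_root_of_unity:
  assumes p3: "p mod 3 = 2"
  shows "\<exists>\<omega>\<in>U. Fr \<omega> = \<omega> \<otimes> \<omega> \<and> \<omega> \<otimes> \<omega> \<oplus> \<omega> \<oplus> \<one> = \<zero> \<and> \<omega> \<noteq> \<one>"
proof -
  obtain k where k: "p = 3 * k + 2" using p3 by (metis mult_div_mod_eq)
  have "p ^ 2 - 1 = 3 * (3 * k * k + 4 * k + 1)"
    unfolding k by (simp add: monoid_mult_class.power2_eq_square algebra_simps)
  then obtain m where m: "p ^ 2 - 1 = 3 * m" by blast
  have "0 < m" "m < p ^ 2 - 1" using m p_square_gt p_gt_3 by linarith+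
  then obtain g where g: "g \<in> U" "g [^] m \<noteq> \<one>" using non_root_exists by blast
  define \<omega> where "\<omega> = g [^] m"
  have w: "\<omega> \<in> U" "\<omega> \<noteq> \<one>" unfolding \<omega>_def using g by auto
  have "\<omega> [^] (3::nat) = g [^] (3 * m)" unfolding \<omega>_def using g by (simp add: nat_pow_pow mult.commute)
  also have "\<dots> = \<one>" unfolding m[symmetric] by (rule U_pow_card[OF g(1)])
  finally have w3: "\<omega> [^] (3::nat) = \<one>" .
  have wR: "\<omega> \<in> carrier R" using w by blast
  have "(\<omega> \<ominus> \<one>) \<otimes> (\<omega> \<otimes> \<omega> \<oplus> \<omega> \<oplus> \<one>) = \<omega> \<otimes> \<omega> \<otimes> \<omega> \<ominus> \<one>" using wR by algebra
  also have "\<omega> \<otimes> \<omega> \<otimes> \<omega> = \<one>" using w3 wR by (simp add: numeral_3_eq_3)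
  finally have "(\<omega> \<ominus> \<one>) \<otimes> (\<omega> \<otimes> \<omega> \<oplus> \<omega> \<oplus> \<one>) = \<zero>" by (simp add: r_right_minus_eq)
  then have "\<omega> \<ominus> \<one> = \<zero> \<or> \<omega> \<otimes> \<omega> \<oplus> \<omega> \<oplus> \<one> = \<zero>" by (rule integral) (use wR in auto)
  then have sum: "\<omega> \<otimes> \<omega> \<oplus> \<omega> \<oplus> \<one> = \<zero>" using w wR by (simp add: r_right_minus_eq)
  have "Fr \<omega> = (\<omega> [^] (3::nat)) [^] k \<otimes> \<omega> [^] (2::nat)"
    unfolding k using wR by (simp add: nat_pow_pow nat_pow_mult)
  also have "\<dots> = \<omega> \<otimes> \<omega>" using w3 wR by (simp add: numeral_2_eq_2)
  finally show ?thesis using w sum by blast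
qed

text \<open>The binomial \<open>a x + x ^ (p + 2)\<close> with \<open>a = 1 - \<omega>\<close>: it multiplies \<open>x\<close> by \<open>a + N x\<close>, and on norms it
  induces \<open>n \<mapsto> (n + 1) ^ 3 - 1\<close>.\<close>
lemma norm_binomial:
  assumes p3: "p mod 3 = 2"
  shows "\<exists>a\<in>U. Fr a \<noteq> a \<and> ext (\<lambda>x. x \<otimes> (a \<oplus> x \<otimes> Fr x)) \<in> H \<and>
     (\<forall>x\<in>U. x \<otimes> (a \<oplus> x \<otimes> Fr x) \<in> U)"
proof -
  obtain \<omega> where w: "\<omega> \<in> U" "Fr \<omega> = \<omega> \<otimes> \<omega>" "\<omega> \<otimes> \<omega> \<oplus> \<omega> \<oplus> \<one> = \<zero>" "\<omega> \<noteq> \<one>"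
    using cube_root_of_unity[OF p3] by blast
  have wR: "\<omega> \<in> carrier R" using w by blast
  \<comment> \<open>This element and its conjugate have sum 3 and product 3, so the norm
    \<open>n (n + a) (n + a')\<close> of the image becomes \<open>(n + 1) ^ 3 - 1\<close>, and
    cubing is injective on the prime field.\<close>
  define a where "a = \<one> \<ominus> \<omega>"
  have aU: "a \<in> U" unfolding a_def using w by (intro diff_U) auto
  then have aR: "a \<in> carrier R" by blast
  have a': "Fr a = \<one> \<ominus> \<omega> \<otimes> \<omega>" unfolding a_def using wR by (simp add: Fr_diff w(2))
  have Fa: "Fr a \<noteq> a"
  proof
    assume "Fr a = a"
    have "(\<omega> \<otimes> \<omega>) \<ominus> \<omega> = (\<one> \<ominus> \<omega>) \<ominus> (\<one> \<ominus> \<omega> \<otimes> \<omega>)" using wR by algebra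
    also have "\<dots> = \<zero>" unfolding a'[symmetric] a_def[symmetric]
      using \<open>Fr a = a\<close> aR by (simp add: r_right_minus_eq)
    finally have "(\<omega> \<otimes> \<omega>) \<ominus> \<omega> = \<zero>" .
    then have "\<omega> \<otimes> \<omega> = \<one> \<otimes> \<omega>" using wR by (simp add: r_right_minus_eq)
    then have "\<omega> = \<one>" by (rule U_cancel[rotated -1]) (use w in auto)
    then show False using w by simp
  qed
  define f where "f = (\<lambda>x. x \<otimes> (a \<oplus> x \<otimes> Fr x))"
  have N: "Fr (x \<otimes> Fr x) = x \<otimes> Fr x" if "x \<in> carrier R" for x
    using that by (simp add: Fr_mult Fr_Fr m_comm)
  \<comment> \<open>Norms lie in the prime field, and \<open>a\<close> does not.\<close>
  have gU: "a \<oplus> x \<otimes> Fr x \<in> U" if x: "x \<in> U" for x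
    proof (rule ccontr)
      assume "a \<oplus> x \<otimes> Fr x \<notin> U"
      moreover have "a \<oplus> x \<otimes> Fr x \<in> carrier R" using x aR by auto
      ultimately have "a \<oplus> x \<otimes> Fr x = \<zero>" using U_def' by blast
      then have neg: "\<ominus> (x \<otimes> Fr x) = a" by (rule minus_equality) (use x aR in auto)
      have "Fr (\<ominus> (x \<otimes> Fr x)) = \<ominus> (x \<otimes> Fr x)" using x N[of x] by (simp only: Fr_neg m_closed nat_pow_closed U_carrier)
      then have "Fr a = a" unfolding neg .
      then show False using Fa by simp
    qed
  have fU: "f x \<in> U" if x: "x \<in> U" for x
    unfolding f_def using gU[OF x] x by blast
  have norm: "(f x \<otimes> Fr (f x)) \<oplus> \<one> = (x \<otimes> Fr x \<oplus> \<one>) [^] (3::nat)" if x: "x \<in> carrier R" for x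
  proof -
    define n where "n = x \<otimes> Fr x"
    have nR: "n \<in> carrier R" unfolding n_def using x by simp
    have "Fr (f x) = Fr x \<otimes> ((\<one> \<ominus> \<omega> \<otimes> \<omega>) \<oplus> n)"
      unfolding f_def a'[symmetric] using x aR N[OF x] by (simp add: Fr_mult Fr_add n_def)
    then have "f x \<otimes> Fr (f x) = n \<otimes> ((\<one> \<ominus> \<omega> \<oplus> n) \<otimes> (\<one> \<ominus> \<omega> \<otimes> \<omega> \<oplus> n))"
      unfolding f_def n_def[symmetric] a_def using x wR nR by (simp add: n_def m_ac)
    moreover have "(\<one> \<ominus> \<omega> \<oplus> n) \<otimes> (\<one> \<ominus> \<omega> \<otimes> \<omega> \<oplus> n) =
        n \<otimes> n \<oplus> ((\<one> \<ominus> \<omega>) \<oplus> (\<one> \<ominus> \<omega> \<otimes> \<omega>)) \<otimes> n \<oplus> (\<one> \<ominus> \<omega>) \<otimes> (\<one> \<ominus> \<omega> \<otimes> \<omega>)"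
      using wR nR by algebra
    moreover have "(\<one> \<ominus> \<omega>) \<oplus> (\<one> \<ominus> \<omega> \<otimes> \<omega>) = (\<one> \<oplus> \<one> \<oplus> \<one>) \<ominus> (\<omega> \<otimes> \<omega> \<oplus> \<omega> \<oplus> \<one>)"
      "(\<one> \<ominus> \<omega>) \<otimes> (\<one> \<ominus> \<omega> \<otimes> \<omega>) = (\<one> \<oplus> \<one> \<oplus> \<one>) \<oplus> (\<omega> \<ominus> \<one> \<ominus> \<one>) \<otimes> (\<omega> \<otimes> \<omega> \<oplus> \<omega> \<oplus> \<one>)"
      using wR by algebra+
    ultimately have "f x \<otimes> Fr (f x) \<oplus> \<one> = n \<otimes> (n \<otimes> n \<oplus> (\<one> \<oplus> \<one> \<oplus> \<one>) \<otimes> n \<oplus> (\<one> \<oplus> \<one> \<oplus> \<one>)) \<oplus> \<one>"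
      unfolding w(3) using nR wR by (simp add: minus_eq)
    also have "\<dots> = (n \<oplus> \<one>) \<otimes> (n \<oplus> \<one>) \<otimes> (n \<oplus> \<one>)" using nR by algebra
    also have "\<dots> = (n \<oplus> \<one>) [^] (3::nat)" using nR by (simp add: numeral_3_eq_3)
    finally show ?thesis unfolding n_def .
  qed
  have bij: "bij_betw f U U"
  proof (rule inj_imp_bij_U[OF fU])
    fix x y assume xy: "x \<in> U" "y \<in> U" "f x = f y"
    have cube: "(x \<otimes> Fr x \<oplus> \<one>) [^] (3::nat) = (y \<otimes> Fr y \<oplus> \<one>) [^] (3::nat)"
      using norm[of x] norm[of y] xy by simp
    have "x \<otimes> Fr x \<oplus> \<one> = y \<otimes> Fr y \<oplus> \<one>"
      by (rule cube_inj_prime_field[OF p3 _ _ _ _ cube]) (use xy N in \<open>auto simp: Fr_add\<close>)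
    then have n: "x \<otimes> Fr x = y \<otimes> Fr y" using xy by simp
    then have "x \<otimes> (a \<oplus> x \<otimes> Fr x) = y \<otimes> (a \<oplus> x \<otimes> Fr x)" using xy(3) unfolding f_def by simp
    then show "x = y"
    proof (rule U_cancel[rotated -1])
      show "a \<oplus> x \<otimes> Fr x \<in> U"
        by (rule gU[OF xy(1)])
    qed (use xy in auto)
  qed
  have "ext f \<in> H"
  proof (rule binom_in_H[of a \<one> 1 "p + 2"])
    show "p + 2 < p ^ 2" using p_square_gt p_gt_3 by linarith
    fix x assume x: "x \<in> U"
    have "x [^] (p + 2) = Fr x \<otimes> (x \<otimes> x)" using x by (simp add: nat_pow_mult[symmetric] numeral_2_eq_2 m_assoc)
    then show "f x = a \<otimes> x [^] (1::nat) \<oplus> \<one> \<otimes> x [^] (p + 2)"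
      unfolding f_def using x aR by (simp add: r_distr m_ac)
  qed (use aU bij in auto)
  then show ?thesis using aU Fa fU unfolding f_def by blast
qed

text \<open>The norm binomial makes the two points independent: the determinant of their images is
  \<open>b n^2 (b^2 - 1) (a - Fr a)\<close>. It vanishes only for ratio 1 or -1.\<close>

lemma separate_prime_field_ratio:
  assumes p3: "p mod 3 = 2" and x: "x \<in> U" and b: "b \<in> U" "Fr b = b" "b \<otimes> b \<noteq> \<one>"
  shows "\<exists>g\<in>H. g x \<in> S \<and> g (b \<otimes> x) \<notin> S"
proof -
  obtain a where a: "a \<in> U" "Fr a \<noteq> a" "ext (\<lambda>x. x \<otimes> (a \<oplus> x \<otimes> Fr x)) \<in> H"
    "\<forall>x\<in>U. x \<otimes> (a \<oplus> x \<otimes> Fr x) \<in> U" using norm_binomial[OF p3] by blast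
  define f where "f = (\<lambda>x. x \<otimes> (a \<oplus> x \<otimes> Fr x))"
  define y where "y = b \<otimes> x"
  have y: "y \<in> U" unfolding y_def using x b by blast
  have fU: "f x \<in> U" "f y \<in> U" using a(4) x y unfolding f_def by auto
  have id: "(a \<oplus> n) \<otimes> (a' \<oplus> c \<otimes> n) \<ominus> (a' \<oplus> n) \<otimes> (a \<oplus> c \<otimes> n) = n \<otimes> (c \<ominus> \<one>) \<otimes> (a \<ominus> a')"
    if "n \<in> carrier R" "a' \<in> carrier R" "c \<in> carrier R" for n a' c
    using that U_carrier[OF a(1)] by algebra
  have Ff: "Fr (f z) = Fr z \<otimes> (Fr a \<oplus> z \<otimes> Fr z)" if "z \<in> U" for z
    unfolding f_def using that a(1) by (simp add: Fr_mult Fr_add Fr_Fr m_comm)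
  have Fy: "Fr y = b \<otimes> Fr x" unfolding y_def using x b by (simp add: Fr_mult)
  define n where "n = x \<otimes> Fr x"
  have nU: "n \<in> U" unfolding n_def using x by blast
  have ny: "y \<otimes> Fr y = (b \<otimes> b) \<otimes> n" unfolding Fy unfolding n_def y_def
    using x b by (simp add: m_ac)
  define W where "W = (b \<otimes> n) \<otimes> (n \<otimes> (b \<otimes> b \<ominus> \<one>) \<otimes> (a \<ominus> Fr a))"
  have WU: "W \<in> U" unfolding W_def using nU a b by (intro U_mult diff_U U_pow) auto
  have "f x \<otimes> Fr (f y) = (b \<otimes> n) \<otimes> ((a \<oplus> n) \<otimes> (Fr a \<oplus> (b \<otimes> b) \<otimes> n))"
    unfolding Ff[OF y] ny unfolding Fy f_def n_def[symmetric] using x a(1) b(1) nU by (simp add: n_def m_ac)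
  moreover have "Fr (f x) \<otimes> f y = (b \<otimes> n) \<otimes> ((Fr a \<oplus> n) \<otimes> (a \<oplus> (b \<otimes> b) \<otimes> n))"
    unfolding Ff[OF x] unfolding f_def ny n_def[symmetric] unfolding y_def
    using x a(1) b(1) nU by (simp add: n_def m_ac)
  ultimately have "f x \<otimes> Fr (f y) \<ominus> Fr (f x) \<otimes> f y =
      (b \<otimes> n) \<otimes> ((a \<oplus> n) \<otimes> (Fr a \<oplus> (b \<otimes> b) \<otimes> n) \<ominus> (Fr a \<oplus> n) \<otimes> (a \<oplus> (b \<otimes> b) \<otimes> n))"
    using nU a(1) b(1) by (simp add: minus_eq r_distr r_minus)
  also have "\<dots> = W" unfolding W_def using id[of n "Fr a" "b \<otimes> b"] nU a(1) b(1) by simp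
  finally have "f x \<otimes> Fr (f y) \<ominus> Fr (f x) \<otimes> f y = W" .
  then have "f x \<otimes> Fr (f y) \<ominus> Fr (f x) \<otimes> f y \<noteq> \<zero>" using WU U_def' by metis
  then have "f x \<otimes> Fr (f y) \<noteq> Fr (f x) \<otimes> f y"
    using fU r_right_minus_eq[of "f x \<otimes> Fr (f y)" "Fr (f x) \<otimes> f y"] by auto
  from separate_independent[OF fU this] obtain g where g: "g \<in> H" "g (f x) \<in> S" "g (f y) \<notin> S" by blast
  have "g \<circ> ext f \<in> H" using H_comp[OF g(1)] a(3) unfolding f_def by blast
  then show ?thesis using g x y unfolding y_def[symmetric] by (intro bexI[of _ "g \<circ> ext f"]) (auto simp: ext_def)
qed

text \<open>The pair \<open>x\<close>, \<open>-x\<close> is first mapped by \<open>f\<close> to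
  points that are neither equal nor opposite; the other cases then apply.\<close>

lemma separation:
  assumes p3: "p mod 3 = 2"
    and f: "ext f \<in> H" "\<And>x. x \<in> U \<Longrightarrow> f (\<ominus> x) \<noteq> \<ominus> f x"
    and xy: "x \<in> U" "y \<in> U" "x \<noteq> y"
  shows "\<exists>g\<in>H. g x \<in> S \<and> g y \<notin> S"
proof -
  have generic: "\<exists>g\<in>H. g x \<in> S \<and> g y \<notin> S" if xy: "x \<in> U" "y \<in> U" "x \<noteq> y" "y \<noteq> \<ominus> x" for x y
  proof (cases "x \<otimes> Fr y = Fr x \<otimes> y")
    case False
    then show ?thesis using separate_independent xy by blast
  next
    case True
    define b where "b = y \<otimes> inv x"
    have b: "b \<in> U" "y = b \<otimes> x" unfolding b_def using xy by (auto simp: m_assoc)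
    have "Fr b \<otimes> (x \<otimes> Fr x) = b \<otimes> (x \<otimes> Fr x)"
      using True b xy by (simp add: Fr_mult m_ac)
    then have Fb: "Fr b = b" by (rule U_cancel[rotated -1]) (use b xy in auto)
    have "b \<otimes> b \<noteq> \<one>"
    proof
      assume "b \<otimes> b = \<one>"
      then have "b = \<one> \<or> b = \<ominus> \<one>" using b by (intro square_eq) auto
      then show False using xy b by (auto simp: l_minus)
    qed
    then show ?thesis using separate_prime_field_ratio[OF p3 xy(1) b(1) Fb] b(2) by blast
  qed
  show ?thesis
  proof (cases "y = \<ominus> x")
    case False
    then show ?thesis using generic xy by blast
  next
    case True
    have fU: "f z \<in> U" if "z \<in> U" for z
      using H_apply_U[OF f(1) that] that by (simp add: ext_def)
    have "f x \<noteq> f y"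
    proof -
      have "ext f x \<noteq> ext f y" using f(1) xy(3) permutes_inj unfolding H_def by (auto dest: injD)
      then show ?thesis using xy by (simp add: ext_def)
    qed
    moreover have "f y \<noteq> \<ominus> f x" using f(2)[OF xy(1)] True by simp
    ultimately obtain g where g: "g \<in> H" "g (f x) \<in> S" "g (f y) \<notin> S"
      using generic[of "f x" "f y"] fU xy by blast
    then show ?thesis using H_comp[OF g(1) f(1)] xy by (intro bexI[of _ "g \<circ> ext f"]) (auto simp: ext_def)
  qed
qed

text \<open>If \<open>(a + y) ^ s\<close> has the same value \<open>c\<close> for all
  \<open>y\<close> in \<open>\<mu>\<close>, then the \<open>s\<close>-th power of
  \<open>x (a + x ^ s)\<close> is \<open>c x ^ s\<close>. This determines \<open>x ^ s\<close> and
  then \<open>x\<close>. To find \<open>a\<close>, colour an integer vector \<open>v\<close> by the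
  \<open>s\<close>-th power of the combination of the elements of \<open>\<mu>\<close> with
  coefficients \<open>v\<close>. A monochromatic copy with dilation \<open>D\<close> gives the
  combinations \<open>ev v + D y\<close>, and dividing by \<open>D\<close>, which is nonzero as
  \<open>D < p\<close>, yields \<open>a = ev v / D\<close>.\<close>

lemma odd_binomial:
  assumes sd: "s * d = p ^ 2 - 1" "odd s" "even d" "d \<le> K"
    and N: "\<And>\<chi> :: (nat \<Rightarrow> nat) \<Rightarrow> nat. finite (range \<chi>) \<Longrightarrow> card (range \<chi>) \<le> Suc K \<Longrightarrow>
      \<exists>v\<in>box K N. \<exists>D. 1 \<le> D \<and> D \<le> N \<and> (\<forall>i<K. \<chi> (v + axis D i) = \<chi> (v + axis D 0))"
    and p: "N < p"
  shows "\<exists>f. ext f \<in> H \<and> (\<forall>x\<in>U. f (\<ominus> x) \<noteq> \<ominus> f x)"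
proof -
  have pos: "0 < s" "0 < d" using sd p_square_gt p_gt_3 by (auto intro!: Nat.gr0I)
  define \<mu> where "\<mu> = {y \<in> U. y [^] d = \<one>}"
  have fin\<mu>: "finite \<mu>" and card\<mu>: "card \<mu> \<le> K"
    using card_roots_le[OF pos(2)] sd(4) unfolding \<mu>_def by auto
  have \<mu>U: "y \<in> U" if "y \<in> \<mu>" for y using that by (simp add: \<mu>_def)
  have one\<mu>: "\<one> \<in> \<mu>" "\<ominus> \<one> \<in> \<mu>" using neg_one_pow_even[OF sd(3)] by (auto simp: \<mu>_def)
  obtain h where h: "bij_betw h {0..<card \<mu>} \<mu>" using ex_bij_betw_nat_finite[OF fin\<mu>] by blast
  \<comment> \<open>The list is padded to length \<open>K\<close> with the unit, so that one bound
    \<open>N\<close> serves all \<open>d\<close> up to \<open>K\<close>.\<close>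
  define \<zeta> where "\<zeta> = (\<lambda>i. if i < card \<mu> then h i else \<one>)"
  have \<zeta>\<mu>: "\<zeta> i \<in> \<mu>" for i using h one\<mu> unfolding \<zeta>_def bij_betw_def by auto
  then have \<zeta>R: "\<zeta> i \<in> carrier R" for i using \<mu>U by blast
  have \<zeta>_surj: "\<exists>i<K. \<zeta> i = y" if "y \<in> \<mu>" for y
  proof -
    have "y \<in> h ` {0..<card \<mu>}" using h \<open>y \<in> \<mu>\<close> by (simp add: bij_betw_def)
    then obtain i where "i < card \<mu>" "h i = y" by auto
    then show ?thesis using card\<mu> by (intro exI[of _ i]) (auto simp: \<zeta>_def)
  qed
  define ev where "ev = (\<lambda>v::nat \<Rightarrow> nat. \<Oplus>i\<in>{..<K}. [v i] \<cdot> \<zeta> i)"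
  have evR: "ev v \<in> carrier R" for v unfolding ev_def using \<zeta>R by (intro finsum_closed) auto
  have ev_add: "ev (v + axis D i) = ev v \<oplus> [D] \<cdot> \<zeta> i" if "i < K" for v D i
  proof -
    have "ev (v + axis D i) = (\<Oplus>j\<in>{..<K}. [v j] \<cdot> \<zeta> j \<oplus> (if i = j then [D] \<cdot> \<zeta> j else \<zero>))"
      unfolding ev_def using \<zeta>R by (intro finsum_cong') (auto simp: axis_def add.nat_pow_mult[symmetric])
    also have "\<dots> = ev v \<oplus> (\<Oplus>j\<in>{..<K}. if i = j then [D] \<cdot> \<zeta> j else \<zero>)"
      unfolding ev_def using \<zeta>R by (intro finsum_addf) auto
    also have "(\<Oplus>j\<in>{..<K}. if i = j then [D] \<cdot> \<zeta> j else \<zero>) = [D] \<cdot> \<zeta> i"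
      using that \<zeta>R by (intro finsum_singleton) auto
    finally show ?thesis .
  qed
  obtain enc :: "'a \<Rightarrow> nat" where enc: "inj_on enc (carrier R)"
    using finite_imp_inj_to_nat_seg[OF finite_carrier] by blast
  define \<chi> where "\<chi> = (\<lambda>v. enc (ev v [^] s))"
  have pow\<mu>: "z [^] s \<in> \<mu>" if "z \<in> U" for z
    using that U_pow_card[OF that] by (simp add: \<mu>_def nat_pow_pow sd(1))
  \<comment> \<open>Besides \<open>s\<close>-th powers, which lie in \<open>\<mu>\<close>, there is
    the colour of zero; hence at most \<open>K + 1\<close> colours.\<close>
  have "range \<chi> \<subseteq> enc ` insert \<zero> \<mu>"
  proof
    fix k assume "k \<in> range \<chi>"
    then obtain v where v: "k = enc (ev v [^] s)" unfolding \<chi>_def by blast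
    show "k \<in> enc ` insert \<zero> \<mu>"
    proof (cases "ev v \<in> U")
      case True
      then show ?thesis using pow\<mu> v by blast
    next
      case False
      then have "ev v = \<zero>" using evR[of v] U_def' by blast
      then show ?thesis using v pos(1) by (simp add: nat_pow_zero)
    qed
  qed
  moreover have fin: "finite (enc ` insert \<zero> \<mu>)" using fin\<mu> by blast
  moreover have "card (enc ` insert \<zero> \<mu>) \<le> Suc K"
    using card_image_le[of "insert \<zero> \<mu>" enc] fin\<mu> card\<mu> by (auto simp: card_insert_if split: if_splits)
  ultimately have "finite (range \<chi>)" "card (range \<chi>) \<le> Suc K"
    by (meson finite_subset, meson card_mono le_trans)
  from N[OF this] obtain v D where vD: "1 \<le> D" "D \<le> N" "\<And>i. i < K \<Longrightarrow> \<chi> (v + axis D i) = \<chi> (v + axis D 0)" by blast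
  define \<delta> where "\<delta> = [D] \<cdot> \<one>"
  have \<delta>: "\<delta> \<in> U" unfolding \<delta>_def using vD p by (intro char_coprime) auto
  have K0: "0 < K" using pos(2) sd(4) by linarith
  have shift: "ev v \<oplus> [D] \<cdot> \<zeta> i = ev v \<oplus> \<delta> \<otimes> \<zeta> i" for i
    unfolding \<delta>_def using \<zeta>R by (simp add: add_pow_ldistr)
  define c0 where "c0 = (ev v \<oplus> \<delta> \<otimes> \<zeta> 0) [^] s"
  have same: "(ev v \<oplus> \<delta> \<otimes> y) [^] s = c0" if "y \<in> \<mu>" for y
  proof -
    obtain i where i: "i < K" "\<zeta> i = y" using \<zeta>_surj[OF \<open>y \<in> \<mu>\<close>] by blast
    have "enc ((ev v \<oplus> \<delta> \<otimes> \<zeta> i) [^] s) = enc ((ev v \<oplus> \<delta> \<otimes> \<zeta> 0) [^] s)"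
      using vD(3)[OF i(1)] unfolding \<chi>_def ev_add[OF i(1)] ev_add[OF K0] shift .
    then have "(ev v \<oplus> \<delta> \<otimes> \<zeta> i) [^] s = (ev v \<oplus> \<delta> \<otimes> \<zeta> 0) [^] s"
      by (rule inj_onD[OF enc]) (use evR \<delta> \<zeta>R in auto)
    then show ?thesis using i(2) c0_def by simp
  qed
  define a where "a = ev v \<otimes> inv \<delta>"
  have aR: "a \<in> carrier R" unfolding a_def using evR \<delta> by auto
  define c where "c = inv \<delta> [^] s \<otimes> c0"
  have const: "(a \<oplus> y) [^] s = c" if "y \<in> \<mu>" for y
  proof -
    have yR: "y \<in> carrier R" using \<mu>U \<open>y \<in> \<mu>\<close> by blast
    have i\<delta>: "inv \<delta> \<in> carrier R" using \<delta> by blast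
    have "inv \<delta> \<otimes> (ev v \<oplus> \<delta> \<otimes> y) = ev v \<otimes> inv \<delta> \<oplus> (inv \<delta> \<otimes> \<delta>) \<otimes> y"
      using evR[of v] i\<delta> U_carrier[OF \<delta>] yR
      by (simp add: r_distr m_assoc[symmetric] m_comm[of "ev v" "inv \<delta>"] del: U_inv_r)
    then have "a \<oplus> y = inv \<delta> \<otimes> (ev v \<oplus> \<delta> \<otimes> y)" unfolding a_def using \<delta> yR by simp
    then show ?thesis unfolding c_def using same[OF \<open>y \<in> \<mu>\<close>] evR[of v] i\<delta> U_carrier[OF \<delta>] yR
      by (simp add: nat_pow_distrib)
  qed
  have one_ne: "\<ominus> \<one> \<noteq> \<one>" using neg_one_neq by blast
  \<comment> \<open>Oddness of \<open>s\<close> excludes \<open>a = 0\<close>, because 1 and -1 both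
    belong to \<open>\<mu>\<close> and their \<open>s\<close>-th powers differ.\<close>
  have aU: "a \<in> U"
  proof (rule ccontr)
    assume "a \<notin> U"
    then have a0: "a = \<zero>" using aR U_def' by blast
    have "\<one> [^] s = c" using const[OF one\<mu>(1)] unfolding a0 by (simp only: l_zero one_closed)
    moreover have "(\<ominus> \<one>) [^] s = c"
      using const[OF one\<mu>(2)] unfolding a0 by (simp only: l_zero a_inv_closed one_closed)
    ultimately have "(\<ominus> \<one>) [^] s = \<one>" by simp
    moreover obtain k where "s = Suc (2 * k)" using sd(2) by (metis oddE Suc_eq_plus1)
    then have "(\<ominus> \<one>) [^] s = (\<ominus> \<one>) [^] (2 * k) \<otimes> \<ominus> \<one>" by simp
    ultimately show False using neg_one_pow_even[of "2 * k"] one_ne by simp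
  qed
  have apU: "a \<oplus> y \<in> U" if y: "y \<in> \<mu>" for y
  proof (rule ccontr)
    assume "a \<oplus> y \<notin> U"
    then have "a \<oplus> y = \<zero>" using aR \<mu>U[OF y] U_def' by blast
    then have c0': "c = \<zero>" using const[OF y] pos(1) by (simp add: nat_pow_zero)
    \<comment> \<open>If one sum vanishes, the common \<open>s\<close>-th power is zero and all sums
      vanish, which is impossible for two different \<open>y\<close>.\<close>
    have zero: "a \<oplus> z = \<zero>" if z: "z \<in> \<mu>" for z
    proof (rule ccontr)
      assume "a \<oplus> z \<noteq> \<zero>"
      then have "a \<oplus> z \<in> U" using aR \<mu>U[OF z] U_def' by blast
      then have "(a \<oplus> z) [^] s \<in> U" by blast
      then show False using const[OF z] c0' U_def' by blast
    qed
    have "a \<oplus> \<one> = a \<oplus> \<ominus> \<one>" using zero one\<mu> by simp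
    then have "\<one> = \<ominus> \<one>" using aR by simp
    then show False using one_ne by simp
  qed
  define f where "f = (\<lambda>x. x \<otimes> (a \<oplus> x [^] s))"
  have fU: "f x \<in> U" if "x \<in> U" for x unfolding f_def using that apU pow\<mu> by blast
  have bij: "bij_betw f U U"
  proof (rule inj_imp_bij_U[OF fU])
    fix x y assume xy: "x \<in> U" "y \<in> U" "f x = f y"
    have fs: "f z [^] s = z [^] s \<otimes> c" if "z \<in> U" for z
      unfolding f_def using const[OF pow\<mu>[OF that]] that aR by (simp add: nat_pow_distrib)
    have "c \<in> U" using const[OF one\<mu>(1)] apU[OF one\<mu>(1)] by (metis U_pow)
    moreover have "x [^] s \<otimes> c = y [^] s \<otimes> c" using fs[of x] fs[of y] xy by simp
    ultimately have "x [^] s = y [^] s" using U_cancel xy by blast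
    then have "x \<otimes> (a \<oplus> x [^] s) = y \<otimes> (a \<oplus> x [^] s)" using xy(3) unfolding f_def by simp
    then show "x = y" by (rule U_cancel[rotated -1]) (use xy apU pow\<mu> in auto)
  qed
  have "ext f \<in> H"
  proof (rule binom_in_H[of a \<one> 1 "Suc s"])
    show "Suc s < p ^ 2"
    proof -
      have "2 \<le> d" using pos(2) sd(3) by (cases "d = 1") auto
      then have "s * 2 \<le> p ^ 2 - 1" unfolding sd(1)[symmetric] by (rule mult_le_mono2)
      then show ?thesis using p_square_gt p_gt_3 pos(1) by linarith
    qed
    fix x assume "x \<in> U"
    then show "f x = a \<otimes> x [^] (1::nat) \<oplus> \<one> \<otimes> x [^] Suc s"
      unfolding f_def using aR by (simp add: r_distr m_comm)
  qed (use aU bij pos in auto)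
  moreover have "f (\<ominus> x) \<noteq> \<ominus> f x" if x: "x \<in> U" for x
  proof
    assume eq: "f (\<ominus> x) = \<ominus> f x"
    have xR: "x \<in> carrier R" using x by blast
    have neg: "(\<ominus> x) [^] s = \<ominus> (x [^] s)"
    proof -
      obtain k where k: "s = Suc (2 * k)" using sd(2) by (metis oddE Suc_eq_plus1)
      have "(\<ominus> x) [^] (2::nat) = x [^] (2::nat)"
        using xR by (simp add: numeral_2_eq_2 l_minus r_minus)
      then have "((\<ominus> x) [^] (2::nat)) [^] k = (x [^] (2::nat)) [^] k" by simp
      then have "(\<ominus> x) [^] (2 * k) = x [^] (2 * k)"
        using xR by (simp only: nat_pow_pow a_inv_closed)
      then show ?thesis unfolding k using xR by (simp add: r_minus)
    qed
    define z where "z = x [^] s"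
    have zU: "z \<in> U" unfolding z_def using x by blast
    have "(a \<oplus> \<ominus> z) \<otimes> (\<ominus> x) = (a \<oplus> z) \<otimes> (\<ominus> x)"
      using eq xR zU aR unfolding f_def neg z_def[symmetric] by (simp add: l_minus r_minus m_comm)
    then have "a \<oplus> \<ominus> z = a \<oplus> z" by (rule U_cancel[rotated -1]) (use x zU aR in auto)
    then have "\<ominus> z = z" using aR zU by simp
    then show False using neg_one_neq zU by blast
  qed
  ultimately show ?thesis by blast
qed

section \<open>Conclusion for a single field\<close>

theorem G_group_eq_Bij:
  assumes p3: "p mod 3 = 2" and f: "ext f \<in> H" "\<And>x. x \<in> U \<Longrightarrow> f (\<ominus> x) \<noteq> \<ominus> f x"
  shows "G_group R = Bij U"
proof -
  interpret M: comm_group "mult_of R"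
    using units_comm_group mult_of_is_Units by metis
  have pow: "x [^]\<^bsub>mult_of R\<^esub> n = x [^] n" for x and n :: nat
    by (simp add: Multiplicative_Group.nat_pow_mult_of)
  have invM: "inv\<^bsub>mult_of R\<^esub> x = inv x" if "x \<in> U" for x
    using m_inv_mult_of that unfolding U_mult_of by simp
  have core: "half_rotation_group (mult_of R) H S"
  proof (intro half_rotation_group.intro half_rotation_group_axioms.intro perm_set.intro)
    show "comm_group (mult_of R)" by (rule M.comm_group_axioms)
    show "subgroup S (mult_of R)"
    proof (rule M.subgroupI)
      show "S \<subseteq> carrier (mult_of R)" using S_U unfolding U_mult_of by blast
      show "S \<noteq> {}" using one_S by blast
      show "inv\<^bsub>mult_of R\<^esub> x \<in> S" if "x \<in> S" for x using S_inv[OF that] invM[OF S_U[OF that]] by simp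
      show "x \<otimes>\<^bsub>mult_of R\<^esub> y \<in> S" if "x \<in> S" "y \<in> S" for x y
        using S_mult_iff[of x y] S_U that by simp
    qed
    show "card {b \<in> S. b [^]\<^bsub>mult_of R\<^esub> w = \<one>\<^bsub>mult_of R\<^esub>} \<le> w" if "w > 0" for w :: nat
    proof -
      have "card {b \<in> S. b [^] w = \<one>} \<le> card {x \<in> U. x [^] w = \<one>}"
        using S_U by (intro card_mono) auto
      then show ?thesis using card_roots_le[OF that] unfolding pow by simp
    qed
    show "(\<lambda>x. if x \<in> S then t \<otimes>\<^bsub>mult_of R\<^esub> x else x) \<in> H" if "t \<in> S" for t
    proof -
      have "(\<lambda>x. if x \<in> S then t \<otimes>\<^bsub>mult_of R\<^esub> x else x) = ext (rot t)"
        using S_U by (auto simp: ext_def rot_def fun_eq_iff)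
      then show ?thesis using rot_H[OF that] by simp
    qed
    show "\<exists>\<gamma>\<in>H. \<gamma> ` S = carrier (mult_of R) - S"
    proof -
      obtain \<nu> where \<nu>: "\<nu> \<in> U" "\<nu> \<notin> S" using nonsquare_exists by blast
      have "ext (\<lambda>x. \<nu> \<otimes> x) ` S = (\<lambda>x. \<nu> \<otimes> x) ` S"
        using S_U by (intro image_cong) (auto simp: ext_def)
      then show ?thesis using nonsquare_scaling[OF \<nu>] scalar_H[OF \<nu>(1)] unfolding U_mult_of by metis
    qed
    show "\<exists>g\<in>H. g x \<in> S \<and> g y \<notin> S" if "x \<in> carrier (mult_of R)" "y \<in> carrier (mult_of R)" "x \<noteq> y" for x y
      using separation[OF p3 f] that unfolding U_mult_of by blast
    show "card S \<ge> 3" using card_S half_ge_12 by simp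
    show "finite (carrier (mult_of R))" unfolding U_mult_of by blast
    show "\<phi> permutes carrier (mult_of R)" if "\<phi> \<in> H" for \<phi> using that unfolding U_mult_of H_def by blast
  qed (auto intro: H_comp H_inv H_id)
  define \<iota> where "\<iota> = ext (\<lambda>x. inv x)"
  have inv_eq: "inv x = x \<longleftrightarrow> x = \<one> \<or> x = \<ominus> \<one>" if x: "x \<in> U" for x
  proof
    assume "inv x = x"
    then have "x \<otimes> x = \<one> \<otimes> \<one>" using U_inv_r(1)[OF x] by simp
    then show "x = \<one> \<or> x = \<ominus> \<one>" using x by (intro square_eq) auto
  next
    assume "x = \<one> \<or> x = \<ominus> \<one>"
    then have "x \<otimes> x = \<one>" by (auto simp: l_minus r_minus)
    then have "inv x \<otimes> x = x \<otimes> x" using x by simp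
    then show "inv x = x" by (rule U_cancel[rotated -1]) (use x in auto)
  qed
  have "{x. \<iota> x \<noteq> x} = U - {\<one>, \<ominus> \<one>}"
    unfolding \<iota>_def ext_def using inv_eq by auto
  moreover have "card (U - {\<one>, \<ominus> \<one>}) = card U - card {\<one>, \<ominus> \<one>}"
    by (rule card_Diff_subset) auto
  moreover have "card {\<one>, \<ominus> \<one>} = 2" using neg_one_neq[of \<one>] by (simp add: card_insert_if eq_commute)
  ultimately have card: "card {x. \<iota> x \<noteq> x} = p ^ 2 - 1 - 2" using card_U by simp
  obtain k where k: "p ^ 2 - 1 = 8 * k" using p_square_mod_8 by blast
  have "k > 0" using k p_square_gt p_gt_3 by (intro Nat.gr0I) auto
  \<comment> \<open>Inversion fixes 1 and -1 only, so it moves \<open>8 * k - 2\<close> points, that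
    is, it consists of an odd number of transpositions.\<close>
  then have card: "card {x. \<iota> x \<noteq> x} = 4 * (2 * k - 1) + 2" using card k by simp
  have invol: "\<iota> (\<iota> x) = x" for x
    unfolding \<iota>_def ext_def using U_inv_inv U_inv by auto
  have full: "\<phi> \<in> H" if "\<phi> permutes U" for \<phi>
    using half_rotation_group.contains_all_permutations[OF core _ invol card, of \<phi>] inverse_H that
    unfolding U_mult_of \<iota>_def by blast
  show ?thesis
  proof (intro equalityI subsetI)
    fix g assume "g \<in> G_group R"
    then have "g \<in> carrier (BijGroup U)"
      unfolding G_group_def using group.generate_in_carrier[OF group_BijGroup binom_perms_Bij] by blast
    then show "g \<in> Bij U" by (simp add: BijGroup_def)
  next
    fix g assume g: "g \<in> Bij U"
    then have "ext g \<in> H" by (intro full ext_permutes) (simp add: Bij_def)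
    then have "restrict (ext g) U \<in> G_group R" by (simp add: H_def)
    moreover have "restrict (ext g) U = g"
      using g by (auto simp: Bij_def ext_def fun_eq_iff extensional_def)
    ultimately show "g \<in> G_group R" by simp
  qed
qed

end

text \<open>One of \<open>p - 1\<close> and \<open>p + 1\<close> is twice an odd number, so a factor
  \<open>2 ^ 11\<close> of their product would force \<open>2 ^ 10 = 1024\<close> to divide the
  other.\<close>

lemma odd_part_of_p_square:
  fixes p :: nat
  assumes "odd p" "p > 3" "p mod 1024 \<noteq> 1" "p mod 1024 \<noteq> 1023"
  shows "\<exists>s d. s * d = p ^ 2 - 1 \<and> odd s \<and> even d \<and> d \<le> 1024"
proof -
  have p2: "p ^ 2 - 1 = (p - 1) * (p + 1)"
    using assms(2) by (simp add: power2_eq_square algebra_simps)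
  then have nz: "p ^ 2 - 1 \<noteq> 0" using assms(2) by simp
  define v where "v = multiplicity 2 (p ^ 2 - 1)"
  obtain s where s: "p ^ 2 - 1 = 2 ^ v * s" "odd s"
    unfolding v_def using multiplicity_decompose'[OF nz, of 2] by auto
  have v: "\<not> 2 ^ 11 dvd p ^ 2 - 1"
  proof
    assume dvd: "2 ^ 11 dvd p ^ 2 - 1"
    have key: "1024 dvd x" if "2 ^ 11 dvd x * (2 * m)" "odd m" for x m :: nat
    proof -
      have "2 * 1024 dvd 2 * (x * m)" using that(1) by (simp add: mult_ac)
      then have "1024 dvd x * m" by (subst (asm) dvd_times_left_cancel_iff) auto
      moreover have "coprime (2 ^ 10) m" using that(2) by (subst coprime_power_left_iff) simp
      then have "coprime 1024 m" by simp
      ultimately show ?thesis using coprime_dvd_mult_left_iff by blast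
    qed
    have "p mod 4 = 1 \<or> p mod 4 = 3" using assms(1) by presburger
    then show False
    proof
      assume 1: "p mod 4 = 1"
      have "p + 1 = 2 * (2 * (p div 4) + 1)" using 1 by presburger
      then have "1024 dvd p - 1" using dvd unfolding p2 by (intro key[of _ "2 * (p div 4) + 1"]) auto
      then have "(p - 1) mod 1024 = 0" by simp
      then have "(p - 1 + 1) mod 1024 = 1" by (subst mod_add_left_eq[symmetric]) simp
      then show False using assms(2,3) by simp
    next
      assume 3: "p mod 4 = 3"
      have "p - 1 = 2 * (2 * (p div 4) + 1)" using 3 by presburger
      then have "1024 dvd p + 1" using dvd unfolding p2
        by (intro key[of _ "2 * (p div 4) + 1"]) (auto simp: mult.commute)
      then have "(p + 1 + 1023) mod 1024 = 1023" by (subst mod_add_left_eq[symmetric]) simp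
      then have "p mod 1024 = 1023" by simp
      then show False using assms(4) by simp
    qed
  qed
  have "v \<le> 10"
  proof (rule ccontr)
    assume "\<not> v \<le> 10"
    then have "(2::nat) ^ 11 dvd 2 ^ v" by (intro le_imp_power_dvd) simp
    then show False using v s(1) dvd_mult2 by metis
  qed
  then have "(2::nat) ^ v \<le> 2 ^ 10" by (intro power_increasing) auto
  moreover have "v \<noteq> 0"
  proof
    assume "v = 0"
    then have "odd (p ^ 2 - 1)" using s by simp
    then show False unfolding p2 using assms(1) by simp
  qed
  ultimately show ?thesis using s by (intro exI[of _ s] exI[of _ "2 ^ v"]) (auto simp: mult.commute)
qed

text \<open>One application of Gallai's theorem, with 1024 directions and 1025 colours, serves all
  \<open>p\<close>. The bound \<open>N + 4\<close> ensures both \<open>N < p\<close> and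
  \<open>3 < p\<close>.\<close>

theorem G_full_eventually:
  "\<exists>P0. \<forall>p. prime p \<longrightarrow> p \<ge> P0 \<longrightarrow> p mod 3 = 2 \<longrightarrow> p mod 1024 \<noteq> 1 \<longrightarrow> p mod 1024 \<noteq> 1023 \<longrightarrow> G_full (p ^ 2)"
proof -
  obtain N where N: "\<And>\<chi> :: (nat \<Rightarrow> nat) \<Rightarrow> nat. finite (range \<chi>) \<Longrightarrow> card (range \<chi>) \<le> Suc 1024 \<Longrightarrow>
      \<exists>v\<in>box 1024 N. \<exists>D. 1 \<le> D \<and> D \<le> N \<and> (\<forall>i<1024. \<chi> (v + axis D i) = \<chi> (v + axis D 0))"
    using homothety_regular[of 1024 1024] unfolding homothety_regular_def by (meson order_refl)
  have "G_full (p ^ 2)"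
    if p: "prime p" "p \<ge> N + 4" "p mod 3 = 2" "p mod 1024 \<noteq> 1" "p mod 1024 \<noteq> 1023" for p
    unfolding G_full_def
  proof (intro allI impI)
    fix R :: "nat ring" assume R: "field R \<and> finite (carrier R) \<and> card (carrier R) = p ^ 2"
    interpret quadratic_field R p
      using R p by (intro quadratic_field.intro quadratic_field_axioms.intro) auto
    obtain s d where sd: "s * d = p ^ 2 - 1" "odd s" "even d" "d \<le> 1024"
      using odd_part_of_p_square[OF odd_p p_gt_3 p(4,5)] by blast
    obtain f where "ext f \<in> H" "\<forall>x\<in>U. f (\<ominus>\<^bsub>R\<^esub> x) \<noteq> \<ominus>\<^bsub>R\<^esub> f x"
      using odd_binomial[OF sd N] p(2) by auto
    then show "G_group R = Bij (units_set R)" using G_group_eq_Bij[OF p(3)] by blast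
  qed
  then show ?thesis by blast
qed

theorem theorem1p2:
  shows "infinite {p :: nat. Factorial_Ring.prime p \<and> G_full (p^2)} \<and>
    liminf (\<lambda>N :: nat. ereal (real (card {p :: nat. Factorial_Ring.prime p \<and> p \<le> N \<and> G_full (p^2)})
                             / real (card {p :: nat. Factorial_Ring.prime p \<and> p \<le> N})))
      \<ge> ereal (1/96)"
proof -
  obtain P0 where "\<And>p. prime p \<Longrightarrow> p \<ge> P0 \<Longrightarrow> p mod 3 = 2 \<Longrightarrow> p mod 1024 \<noteq> 1 \<Longrightarrow> p mod 1024 \<noteq> 1023 \<Longrightarrow> G_full (p ^ 2)"
    using G_full_eventually by blast
  from density_of_good_primes[of P0 "\<lambda>p. G_full (p ^ 2)", OF this]
  have "eventually (\<lambda>N. real (card {p. prime p \<and> p \<le> N \<and> G_full (p ^ 2)}) / real (card {p. prime p \<and> p \<le> N}) \<ge> 1 / 96) sequentially"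
    by blast
  from infinite_and_liminf_of_eventually[OF this] show ?thesis by simp
qed

end
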